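(* Let $A$ be a distance set. The following are equivalent: (i) $A$ satisfies the $4$-values condition and either $A$ is closed or $0$ is not a limit point of $A$; (ii) $A$ satisfies the $4$-values condition and $\mathcal{V}_A$ is Borel; (iii) $A$ satisfies the $4$-values condition and $\mathcal{V}_A$ is analytic; (iv) there exists $X \in \mathcal{V}_A$ which is $A$-Urysohn; (v) $A$ satisfies the $4$-values condition and there exists $X \in \mathcal{V}_A$ which is Polish $A$-universal.
   Context: $\mathbb{R}^+ = [0,\infty)$. A Polish metric space is a nonempty separable complete metric space. For a metric space $X$ let $D(X) = \{ d_X(x,y) \mid x,y \in X\}$. A set $A \subseteq \mathbb{R}^+$ is a distance set if $A = D(X)$ for some Polish metric space $X$. $\mathbb{U}$ is the Urysohn space and $F(\mathbb{U})$ is the set of nonempty closed subsets of $\mathbb{U}$ with the Effros Borel structure; $\mathcal{V}_A = \{X \in F(\mathbb{U}) \mid D(X) \subseteq A\}$ (Borel/analytic refer to subsets of $F(\mathbb{U})$). A triple $(a,b,c)$ of elements of $\mathbb{R}^+$ is metric if $a \le b+c$, $b \le a+c$, $c \le a+b$. A set $A$ satisfies the $4$-values condition if for all metric triples $(a,b,x)$ and $(c,d,x)$ of elements of $A$ there is $y \in A$ such that both $(b,c,y)$ and $(a,d,y)$ are metric triples. A metric space $X$ is ultrahomogeneous if every isometry between finite subsets of $X$ extends to an isometry of $X$ onto itself. $X \in \mathcal{V}_A$ is Polish $A$-universal if every $Y \in \mathcal{V}_A$ isometrically embeds into $X$; it is $A$-Urysohn if moreover it is ultrahomogeneous. *)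

theory Defs
  imports "HOL-Analysis.Analysis"
begin

subsection \<open>Polish metric spaces and distance sets\<close>

definition polish_metric :: "'a metric \<Rightarrow> bool" where
  "polish_metric m \<longleftrightarrow>
     mspace m \<noteq> {} \<and> mcomplete_of m \<and> separable_space (mtopology_of m)"

definition distances :: "'a metric \<Rightarrow> real set" where
  "distances m = {mdist m x y | x y. x \<in> mspace m \<and> y \<in> mspace m}"

text \<open>A Polish metric space has at most continuum many points, so up to isometry it is carried
  by a set of reals.  Quantification over all Polish metric spaces is therefore rendered as
  quantification over \<^typ>\<open>real metric\<close>, that is, arbitrary metrics (unrelated to the usual one) on
  arbitrary sets of reals; \<open>polish_metric_real_copy\<close> below shows that nothing is lost.\<close>

definition distance_set :: "real set \<Rightarrow> bool" where
  "distance_set A \<longleftrightarrow> (\<exists>m :: real metric. polish_metric m \<and> A = distances m)"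

subsection \<open>The 4-values condition\<close>

definition metric_triple :: "real \<Rightarrow> real \<Rightarrow> real \<Rightarrow> bool" where
  "metric_triple a b c \<longleftrightarrow> a \<le> b + c \<and> b \<le> a + c \<and> c \<le> a + b"

definition four_values :: "real set \<Rightarrow> bool" where
  "four_values A \<longleftrightarrow>
     (\<forall>a\<in>A. \<forall>b\<in>A. \<forall>c\<in>A. \<forall>d\<in>A. \<forall>x\<in>A.
        metric_triple a b x \<and> metric_triple c d x \<longrightarrow>
        (\<exists>y\<in>A. metric_triple b c y \<and> metric_triple a d y))"

subsection \<open>Isometries, ultrahomogeneity, the Urysohn space\<close>

definition isometric_embedding :: "'a metric \<Rightarrow> 'b metric \<Rightarrow> ('a \<Rightarrow> 'b) \<Rightarrow> bool" where
  "isometric_embedding m m' f \<longleftrightarrow>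
     f \<in> mspace m \<rightarrow> mspace m' \<and>
     (\<forall>x\<in>mspace m. \<forall>y\<in>mspace m. mdist m' (f x) (f y) = mdist m x y)"

definition isometry_onto :: "'a metric \<Rightarrow> 'b metric \<Rightarrow> ('a \<Rightarrow> 'b) \<Rightarrow> bool" where
  "isometry_onto m m' f \<longleftrightarrow> isometric_embedding m m' f \<and> f ` mspace m = mspace m'"

definition isometrically_embeds :: "'a metric \<Rightarrow> 'b metric \<Rightarrow> bool" where
  "isometrically_embeds m m' \<longleftrightarrow> (\<exists>f. isometric_embedding m m' f)"

definition ultrahomogeneous :: "'a metric \<Rightarrow> bool" where
  "ultrahomogeneous m \<longleftrightarrow>
     (\<forall>P Q f. P \<subseteq> mspace m \<and> finite P \<and> Q \<subseteq> mspace m \<and> finite Q \<and>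
        isometry_onto (submetric m P) (submetric m Q) f \<longrightarrow>
        (\<exists>g. isometry_onto m m g \<and> (\<forall>x\<in>P. g x = f x)))"

text \<open>Urysohn's theorem: up to isometry there is exactly one such space.\<close>

definition urysohn_space :: "'u metric \<Rightarrow> bool" where
  "urysohn_space U \<longleftrightarrow>
     polish_metric U \<and> ultrahomogeneous U \<and>
     (\<forall>m :: real metric. polish_metric m \<longrightarrow> isometrically_embeds m U)"

subsection \<open>The Effros Borel structure and analytic sets\<close>

definition closed_subsets :: "'u metric \<Rightarrow> 'u set set" where
  "closed_subsets U = {X. closedin (mtopology_of U) X \<and> X \<noteq> {}}"

definition effros :: "'u metric \<Rightarrow> 'u set measure" where
  "effros U =
     sigma (closed_subsets U)
       {{X \<in> closed_subsets U. X \<inter> W \<noteq> {}} | W. openin (mtopology_of U) W}"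

definition polish_topology :: "'a topology \<Rightarrow> bool" where
  "polish_topology T \<longleftrightarrow> completely_metrizable_space T \<and> second_countable T"

definition borel_of_topology :: "'a topology \<Rightarrow> 'a measure" where
  "borel_of_topology T = sigma (topspace T) {W. openin T W}"

text \<open>A subset of a standard Borel space is analytic if it is a Borel image of a Polish space
  (possibly empty, with carrier again without loss of generality a set of reals).\<close>

definition analytic_in :: "'b measure \<Rightarrow> 'b set \<Rightarrow> bool" where
  "analytic_in N S \<longleftrightarrow>
     (\<exists>(T :: real topology) f.
        polish_topology T \<and> f \<in> borel_of_topology T \<rightarrow>\<^sub>M N \<and> f ` topspace T = S)"

subsection \<open>Spaces with distances in a given set\<close>

definition V :: "'u metric \<Rightarrow> real set \<Rightarrow> 'u set set" where
  "V U A = {X \<in> closed_subsets U. distances (submetric U X) \<subseteq> A}"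

definition polish_universal :: "'u metric \<Rightarrow> real set \<Rightarrow> 'u set \<Rightarrow> bool" where
  "polish_universal U A X \<longleftrightarrow>
     X \<in> V U A \<and> (\<forall>Y\<in>V U A. isometrically_embeds (submetric U Y) (submetric U X))"

definition urysohn_for :: "'u metric \<Rightarrow> real set \<Rightarrow> 'u set \<Rightarrow> bool" where
  "urysohn_for U A X \<longleftrightarrow> polish_universal U A X \<and> ultrahomogeneous (submetric U X)"

subsection \<open>Adequacy of real carriers\<close>

lemma polish_metric_card:
  fixes m :: "'a metric"
  assumes "polish_metric m"
  obtains h :: "'a \<Rightarrow> real" where "inj_on h (mspace m)"
proof -
  obtain C where C: "countable C" "C \<subseteq> mspace m" "mtopology_of m closure_of C = mspace m"
    using assms by (auto simp: polish_metric_def separable_space_def)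
  define e where "e x = {p. case prod_decode p of (n, k) \<Rightarrow>
      mdist m x (from_nat_into C n) < 1 / real (Suc k)}" for x
  have inj: "inj_on e (mspace m)"
  proof (rule inj_onI, rule ccontr)
    fix x y assume xy: "x \<in> mspace m" "y \<in> mspace m" "e x = e y" "x \<noteq> y"
    have "mdist m x y \<noteq> 0" using xy(1,2,4) by simp
    then have "mdist m x y / 2 > 0" using mdist_nonneg[of m x y] by linarith
    then obtain k where "inverse (real (Suc k)) < mdist m x y / 2"
      using reals_Archimedean by blast
    then have k: "1 / real (Suc k) < mdist m x y / 2" by (simp only: inverse_eq_divide)
    interpret Metric_space "mspace m" "mdist m" by simp
    have "x \<in> mtopology closure_of C"
      using C(3) xy(1) by (simp add: mtopology_of_def)
    then have "\<forall>r>0. \<exists>c\<in>C. c \<in> mball x r"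
      unfolding metric_closure_of by blast
    moreover have "0 < 1 / real (Suc k)" by simp
    ultimately have "\<exists>c\<in>C. c \<in> mball x (1 / real (Suc k))" by blast
    then obtain c where c: "c \<in> C" "mdist m x c < 1 / real (Suc k)"
      unfolding in_mball by blast
    obtain n where n: "from_nat_into C n = c"
      using from_nat_into_surj[OF C(1) c(1)] by blast
    have "prod_encode (n, k) \<in> e x"
      unfolding e_def mem_Collect_eq prod_encode_inverse prod.case n by (rule c(2))
    then have "prod_encode (n, k) \<in> e y" using xy(3) by simp
    then have "mdist m y c < 1 / real (Suc k)"
      unfolding e_def mem_Collect_eq prod_encode_inverse prod.case n .
    moreover have "mdist m x y \<le> mdist m x c + mdist m y c"
      using mdist_triangle[of x m c y] mdist_commute[of m y c] xy(1,2) c(1) C(2) by auto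
    ultimately show False using c(2) k by linarith
  qed
  obtain r :: "nat set \<Rightarrow> real" where "bij r"
    using nat_sets_eqpoll_reals by (auto simp: eqpoll_def)
  then have "inj_on (r \<circ> e) (mspace m)"
    by (intro comp_inj_on[OF inj] inj_on_subset[OF bij_is_inj subset_UNIV])
  then show thesis using that by blast
qed

lemma polish_metric_real_copy:
  fixes m :: "'a metric"
  assumes "polish_metric m"
  obtains m' :: "real metric" and f where "polish_metric m'" "isometry_onto m m' f"
proof -
  obtain h :: "'a \<Rightarrow> real" where inj: "inj_on h (mspace m)"
    using polish_metric_card[OF assms] .
  define M where "M = mspace m"
  define g where "g = inv_into M h"
  define d where "d u v = mdist m (g u) (g v)" for u v
  have gh [simp]: "g (h x) = x" if "x \<in> M" for x
    using that inj by (simp add: g_def M_def)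
  have gM [simp]: "g u \<in> M" "h (g u) = u" if "u \<in> h ` M" for u
    using that by (auto simp: g_def inv_into_into f_inv_into_f)
  interpret S: Metric_space M "mdist m"
    by (simp add: M_def)
  interpret S': Metric_space "h ` M" d
  proof
    show "0 \<le> d x y" for x y by (simp add: d_def)
    show "d x y = d y x" for x y by (simp add: d_def mdist_commute)
    show "d x y = 0 \<longleftrightarrow> x = y" if "x \<in> h ` M" "y \<in> h ` M" for x y
      using that by (auto simp: d_def M_def[symmetric])
    show "d x z \<le> d x y + d y z" if "x \<in> h ` M" "y \<in> h ` M" "z \<in> h ` M" for x y z
      using that by (auto simp: d_def S.triangle)
  qed
  interpret SS: Metric_space12 M "mdist m" "h ` M" d ..
  define m' where "m' = metric (h ` M, d)"
  have m' [simp]: "mspace m' = h ` M" "mdist m' = d"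
    by (simp_all add: m'_def S'.mspace_metric S'.mdist_metric)
  have "homeomorphic_map S.mtopology S'.mtopology h"
    by (rule SS.isometry_imp_homeomorphic_map) (auto simp: d_def)
  then have hs: "S.mtopology homeomorphic_space S'.mtopology"
    using homeomorphic_map_imp_homeomorphic_space by blast
  have top: "mtopology_of m = S.mtopology" "mtopology_of m' = S'.mtopology"
    by (simp_all add: mtopology_of_def M_def)
  have sep: "separable_space (mtopology_of m')"
    using hs assms homeomorphic_separable_space top by (auto simp: polish_metric_def)
  have comp: "S.mcomplete"
    using assms by (simp add: polish_metric_def mcomplete_of_def M_def)
  have "S'.mcomplete"
    unfolding S'.mcomplete_def
  proof (intro allI impI)
    fix s assume s: "S'.MCauchy s"
    then have "S.MCauchy (g \<circ> s)"
      unfolding S.MCauchy_def S'.MCauchy_def d_def by (auto simp: image_subset_iff)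
    then obtain x where x: "limitin S.mtopology (g \<circ> s) x sequentially"
      using comp by (auto simp: S.mcomplete_def)
    have "limitin S'.mtopology s (h x) sequentially"
      using x s by (auto simp: S.limit_metric_sequentially S'.limit_metric_sequentially d_def
          S'.MCauchy_def range_subsetD)
    then show "\<exists>x. limitin S'.mtopology s x sequentially" by blast
  qed
  then have "polish_metric m'"
    using sep assms by (simp add: polish_metric_def mcomplete_of_def M_def)
  moreover have "isometry_onto m m' h"
    by (auto simp: isometry_onto_def isometric_embedding_def d_def M_def[symmetric])
  ultimately show thesis using that by blast
qed

lemma distance_set_distances:
  fixes m :: "'a metric"
  assumes "polish_metric m"
  shows "distance_set (distances m)"
proof -
  obtain m' :: "real metric" and f where m': "polish_metric m'" "isometry_onto m m' f"
    using polish_metric_real_copy[OF assms] .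
  have im: "mspace m' = f ` mspace m"
    and d: "\<And>x y. x \<in> mspace m \<Longrightarrow> y \<in> mspace m \<Longrightarrow> mdist m' (f x) (f y) = mdist m x y"
    using m'(2) by (simp_all add: isometry_onto_def isometric_embedding_def)
  have "distances m = distances m'"
  proof (intro set_eqI iffI)
    fix a assume "a \<in> distances m"
    then obtain x y where "x \<in> mspace m" "y \<in> mspace m" "a = mdist m x y"
      unfolding distances_def by blast
    then have "f x \<in> mspace m'" "f y \<in> mspace m'" "a = mdist m' (f x) (f y)"
      using im d by simp_all
    then show "a \<in> distances m'" unfolding distances_def by blast
  next
    fix a assume "a \<in> distances m'"
    then obtain x y where "x \<in> mspace m" "y \<in> mspace m" "a = mdist m' (f x) (f y)"
      unfolding distances_def im by blast
    then show "a \<in> distances m" unfolding distances_def using d by blast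
  qed
  then show ?thesis using m'(1) by (auto simp: distance_set_def)
qed

lemma urysohn_space_universal:
  fixes m :: "'a metric" and U :: "'u metric"
  assumes "urysohn_space U" "polish_metric m"
  shows "isometrically_embeds m U"
proof -
  obtain m' :: "real metric" and f where m': "polish_metric m'" "isometry_onto m m' f"
    using polish_metric_real_copy[OF assms(2)] .
  obtain g where g: "isometric_embedding m' U g"
    using assms(1) m'(1) by (auto simp: urysohn_space_def isometrically_embeds_def)
  have "isometric_embedding m U (g \<circ> f)"
    using m'(2) g by (auto simp: isometry_onto_def isometric_embedding_def Pi_iff)
  then show ?thesis by (auto simp: isometrically_embeds_def)
qed

end

(* Everything takes place inside U, which realises every finite real-valued one-point extension of
   its finite subsets. The 4-values condition is exactly what lets an A-valued one-point extension
   of a finite A-valued space be prolonged to one more point, so a sequence in U with A-valued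
   distances can be built that realises a dense set of such extensions of its initial segments. Its
   closure is the A-Urysohn space: if 0 is not a limit point of A, then A is countable and the
   extensions are realised exactly; if A is closed and accumulates at 0, approximate realisations
   are corrected along a Cauchy sequence. Conversely, ultrahomogeneity glues two triangles along a
   side, which gives the 4-values condition, and a universal X exhibits V U A as the image of the
   set of pairs of isometric sequences in U and X.

   If A is not closed and accumulates at 0, choose r in the closure of A but not in A. Nodes of a
   tree at ultrametric distances tending to 0, together with a point at distance a(n) from the nodes
   of length n, where a(n) tends to r, form a space whose closure realises the distance r exactly
   when the tree has an infinite branch. So well-foundedness of trees reduces to membership in
   V U A; but a tree that searches for a proof that its own code lies in a given Suslin set shows
   that well-foundedness is not Suslin, hence neither analytic nor Borel. *)

theory Submission
  imports Defs
begin

subsection \<open>Metric preliminaries\<close>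

text \<open>The condition on 0 enters through limits. An approximate realisation is repaired only by
  moves whose lengths belong to \<open>A\<close> and tend to 0, and a closure keeps its distances in
  \<open>A\<close> if \<open>A\<close> is closed; if \<open>A\<close> has a gap above 0, the
  constructed sequence is already closed. The negative half has the same source: the missing value
  \<open>r\<close> is reached along a Cauchy sequence with distances in \<open>A\<close>, which uses
  arbitrarily small elements of \<open>A\<close>. On the descriptive side the obstacle is that
  analyticity speaks of Borel images of Polish topologies, whereas the diagonal argument works with
  finite initial segments. Everything is therefore carried over to the Baire space: points of a
  Polish space are coded by geometrically convergent sequences of indices, a closed set by the
  countably many balls that it meets, and Suslin sets are projections of closed sets of pairs, where
  membership can be tested on finite segments. The self-referential tree takes the place of a
  universal analytic set and of a rank argument.\<close>

lemma mdist_self [simp]: "x \<in> mspace m \<Longrightarrow> mdist m x x = 0"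
  by simp

lemma mdist_triple:
  assumes "x \<in> mspace m" "y \<in> mspace m" "z \<in> mspace m"
  shows "metric_triple (mdist m z x) (mdist m z y) (mdist m x y)"
  using mdist_triangle[of z m y x] mdist_triangle[of z m x y] mdist_triangle[of x m z y] assms
    mdist_commute[of m x y] mdist_commute[of m x z]
  by (simp add: metric_triple_def)

lemma mdist_perturb:
  assumes "x \<in> mspace m" "y \<in> mspace m" "x' \<in> mspace m" "y' \<in> mspace m"
  shows "\<bar>mdist m x y - mdist m x' y'\<bar> \<le> mdist m x x' + mdist m y y'"
  using mdist_triangle[of x m x' y] mdist_triangle[of x' m y' y]
    mdist_triangle[of x' m x y'] mdist_triangle[of x m y y'] assms
    mdist_commute[of m x x'] mdist_commute[of m y y']
  by linarith

lemma mdist_small_imp_eq: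
  assumes "x \<in> mspace m" "y \<in> mspace m" "\<And>\<epsilon>. \<epsilon> > 0 \<Longrightarrow> mdist m x y < \<epsilon>"
  shows "x = y"
proof (rule ccontr)
  assume "x \<noteq> y"
  then have "mdist m x y > 0"
    using assms(1,2) mdist_nonneg[of m x y] by (simp add: less_le)
  then show False using assms(3) by blast
qed

text \<open>Separability passes to the subset \<open>X\<close>: of each ball of radius
  \<open>1 / Suc k\<close> around a point of the countable dense set, one point of \<open>X\<close>
  is kept whenever there is one.\<close>

lemma polish_dense_sequence:
  assumes "polish_metric m" "X \<subseteq> mspace m" "X \<noteq> {}"
  obtains y :: "nat \<Rightarrow> 'a"
  where "range y \<subseteq> X" "\<And>x \<epsilon>. x \<in> X \<Longrightarrow> \<epsilon> > 0 \<Longrightarrow> \<exists>n. mdist m x (y n) < \<epsilon>"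
proof -
  interpret Metric_space "mspace m" "mdist m" by simp
  obtain C where C: "countable C" "C \<subseteq> mspace m" "mtopology_of m closure_of C = mspace m"
    using assms(1) by (auto simp: polish_metric_def separable_space_def)
  have "C \<noteq> {}" using C(3) assms(2,3) by auto
  have dense: "\<exists>c\<in>C. mdist m x c < r" if "x \<in> mspace m" "r > 0" for x r
  proof -
    have "x \<in> mtopology closure_of C"
      using C(3) that(1) by (simp add: mtopology_of_def)
    then show ?thesis unfolding metric_closure_of using that(2) by auto
  qed
  obtain x0 where "x0 \<in> X" using assms(3) by blast
  define P where "P p x \<longleftrightarrow> x \<in> X \<and>
      mdist m x (from_nat_into C (fst (prod_decode p))) < 1 / Suc (snd (prod_decode p))" for p x
  \<comment> \<open>The default \<open>x0\<close> serves the balls that miss \<open>X\<close>, so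
    that \<open>y\<close> stays in \<open>X\<close>.\<close>
  define y where "y p = (if \<exists>x. P p x then SOME x. P p x else x0)" for p
  have yP: "P p (y p)" if "\<exists>x. P p x" for p
    using someI_ex[OF that] that by (simp add: y_def)
  have "range y \<subseteq> X"
    using yP \<open>x0 \<in> X\<close> by (auto simp: y_def P_def)
  moreover have "\<exists>n. mdist m x (y n) < \<epsilon>" if x: "x \<in> X" "\<epsilon> > 0" for x \<epsilon>
  proof -
    obtain k where "inverse (real (Suc k)) < \<epsilon> / 2"
      using reals_Archimedean[of "\<epsilon> / 2"] x(2) by auto
    then have k: "1 / real (Suc k) < \<epsilon> / 2" by (simp only: inverse_eq_divide)
    obtain c where c: "c \<in> C" "mdist m x c < 1 / real (Suc k)"
      using dense[of x "1 / real (Suc k)"] x assms(2) by auto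
    obtain n where n: "from_nat_into C n = c"
      using from_nat_into_surj[OF C(1) c(1)] by blast
    define p where "p = prod_encode (n, k)"
    have "P p x" using x(1) c(2) n by (simp add: P_def p_def)
    then have y: "P p (y p)" using yP by blast
    have "mdist m x (y p) \<le> mdist m x c + mdist m (y p) c"
      using mdist_triangle[of x m c "y p"] mdist_commute[of m "y p" c] x assms(2) c(1) C(2) y
      by (auto simp: P_def)
    moreover have "mdist m (y p) c < 1 / real (Suc k)"
      using y n by (simp add: P_def p_def)
    ultimately have "mdist m x (y p) < \<epsilon>" using c(2) k by linarith
    then show ?thesis by blast
  qed
  ultimately show thesis using that by blast
qed

lemma half_power_small:
  assumes "(\<epsilon>::real) > 0"
  obtains n where "C * (1/2) ^ n < \<epsilon>"
proof -
  have "(\<lambda>n. C * (1/2) ^ n) \<longlonglongrightarrow> C * 0"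
    by (intro tendsto_mult_left LIMSEQ_power_zero) auto
  then have "eventually (\<lambda>n. C * (1/2) ^ n < \<epsilon>) sequentially"
    using assms by (intro order_tendstoD) auto
  then show ?thesis using that by (meson eventually_sequentially order_refl)
qed

text \<open>The right-hand side is the exact sum of \<open>C * (1/2) ^ i\<close> over
  \<open>n \<le> i < n + k\<close>; with the subtracted term the induction closes.\<close>

lemma geometric_chain_bound:
  assumes "range \<sigma> \<subseteq> mspace m" "\<And>n. mdist m (\<sigma> n) (\<sigma> (Suc n)) \<le> C * (1/2) ^ n"
  shows "mdist m (\<sigma> n) (\<sigma> (n + k)) \<le> 2 * C * (1/2) ^ n - 2 * C * (1/2) ^ (n + k)"
proof (induction k)
  case 0
  have "\<sigma> n \<in> mspace m" using assms(1) by blast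
  then show ?case by simp
next
  case (Suc k)
  have "mdist m (\<sigma> n) (\<sigma> (n + Suc k)) \<le>
      mdist m (\<sigma> n) (\<sigma> (n + k)) + mdist m (\<sigma> (n + k)) (\<sigma> (n + Suc k))"
    using assms(1) by (intro mdist_triangle) auto
  also have "mdist m (\<sigma> (n + k)) (\<sigma> (n + Suc k)) \<le> C * (1/2) ^ (n + k)"
    using assms(2)[of "n + k"] by simp
  finally show ?case using Suc by simp
qed

text \<open>The rate survives in the limit. Later proofs compare distances at the limit with
  distances at stage \<open>n\<close> through this bound alone.\<close>

lemma geometric_limit:
  assumes "mcomplete_of m" "range \<sigma> \<subseteq> mspace m"
    and "\<And>n. mdist m (\<sigma> n) (\<sigma> (Suc n)) \<le> C * (1/2) ^ n"
  obtains l where "l \<in> mspace m" "\<And>n. mdist m (\<sigma> n) l \<le> 2 * C * (1/2) ^ n"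
proof -
  interpret Metric_space "mspace m" "mdist m" by simp
  have \<sigma>: "\<sigma> n \<in> mspace m" for n using assms(2) by (rule range_subsetD)
  have C0: "C \<ge> 0" using order_trans[OF mdist_nonneg assms(3)[of 0]] by simp
  have le: "mdist m (\<sigma> n) (\<sigma> k) \<le> 2 * C * (1/2) ^ n" if "n \<le> k" for n k
  proof -
    have "2 * C * (1/2) ^ k \<ge> 0" using C0 by simp
    then show ?thesis
      using geometric_chain_bound[OF assms(2,3), of n "k - n"] that by simp
  qed
  have small: "\<exists>N. 2 * C * (1/2) ^ N < \<epsilon>" if "\<epsilon> > 0" for \<epsilon> :: real
    by (rule half_power_small[OF that, of "2 * C"]) (rule exI)
  have "MCauchy \<sigma>"
    unfolding MCauchy_def
  proof (intro conjI allI impI assms(2))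
    fix \<epsilon> :: real assume "\<epsilon> > 0"
    then obtain N where N: "2 * C * (1/2) ^ N < \<epsilon> / 2" using small[of "\<epsilon> / 2"] by auto
    have "mdist m (\<sigma> n) (\<sigma> n') < \<epsilon>" if "N \<le> n" "N \<le> n'" for n n'
      using mdist_triangle[OF \<sigma>[of n] \<sigma>[of N] \<sigma>[of n']] le[OF that(1)] le[OF that(2)] N
        mdist_commute[of m "\<sigma> N" "\<sigma> n"] by linarith
    then show "\<exists>N. \<forall>n n'. N \<le> n \<longrightarrow> N \<le> n' \<longrightarrow> mdist m (\<sigma> n) (\<sigma> n') < \<epsilon>" by blast
  qed
  then obtain l where l: "limitin mtopology \<sigma> l sequentially"
    using assms(1) unfolding mcomplete_of_def mcomplete_def by blast
  then have lm: "l \<in> mspace m" using limitin_mspace by blast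
  have "mdist m (\<sigma> n) l \<le> 2 * C * (1/2) ^ n" for n
  proof (rule field_le_epsilon)
    fix \<epsilon> :: real assume "\<epsilon> > 0"
    then obtain N where N: "\<forall>k\<ge>N. mdist m (\<sigma> k) l < \<epsilon>"
      using l unfolding limit_metric_sequentially by blast
    define k where "k = max n N"
    have "mdist m (\<sigma> k) l < \<epsilon>" "mdist m (\<sigma> n) (\<sigma> k) \<le> 2 * C * (1/2) ^ n"
      using N le[of n k] by (auto simp: k_def)
    then show "mdist m (\<sigma> n) l \<le> 2 * C * (1/2) ^ n + \<epsilon>"
      using mdist_triangle[OF \<sigma>[of n] \<sigma>[of k] lm] by linarith
  qed
  then show thesis using that lm by blast
qed

text \<open>The topological closure of a subset of the space, written with \<open>mdist\<close>
  only, so that approximation arguments need no topology.\<close>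

definition mclosure :: "'a metric \<Rightarrow> 'a set \<Rightarrow> 'a set" where
  "mclosure m S = {x \<in> mspace m. \<forall>\<epsilon>>0. \<exists>s\<in>S. mdist m x s < \<epsilon>}"

lemma mclosure_eq_closure_of:
  assumes "S \<subseteq> mspace m"
  shows "mclosure m S = mtopology_of m closure_of S"
proof -
  interpret Metric_space "mspace m" "mdist m" by simp
  have "(\<exists>s\<in>S. mdist m x s < \<epsilon>) \<longleftrightarrow> (\<exists>s\<in>S. s \<in> mball x \<epsilon>)" if "x \<in> mspace m" for x \<epsilon>
    using that subsetD[OF assms] by (simp cong: bex_cong)
  then show ?thesis
    unfolding mclosure_def mtopology_of_def metric_closure_of by (simp cong: conj_cong)
qed

lemma mclosure_superset:
  assumes "S \<subseteq> mspace m"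
  shows "S \<subseteq> mclosure m S"
proof
  fix s assume "s \<in> S"
  then show "s \<in> mclosure m S"
    using subsetD[OF assms \<open>s \<in> S\<close>] \<open>s \<in> S\<close>
    unfolding mclosure_def by (intro CollectI conjI allI impI bexI[of _ s]) simp_all
qed

lemma mclosure_subset_mspace: "mclosure m S \<subseteq> mspace m"
  by (auto simp: mclosure_def)

lemma closed_subsets_iff:
  "X \<in> closed_subsets m \<longleftrightarrow> X \<subseteq> mspace m \<and> X \<noteq> {} \<and> mclosure m X \<subseteq> X"
proof -
  interpret Metric_space "mspace m" "mdist m" by simp
  have "closedin (mtopology_of m) X \<longleftrightarrow> X \<subseteq> mspace m \<and> mclosure m X \<subseteq> X"
    using mclosure_eq_closure_of[of X m] closure_of_subset_eq[of X "mtopology_of m"]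
      closedin_subset[of "mtopology_of m" X] by auto
  then show ?thesis by (auto simp: closed_subsets_def)
qed

lemma closed_subsetsD:
  assumes "X \<in> closed_subsets m" "x \<in> mspace m" "\<And>\<epsilon>. \<epsilon> > 0 \<Longrightarrow> \<exists>s\<in>X. mdist m x s < \<epsilon>"
  shows "x \<in> X"
  using assms unfolding closed_subsets_iff mclosure_def by blast

lemma closed_subsets_subset: "X \<in> closed_subsets m \<Longrightarrow> X \<subseteq> mspace m"
  by (simp add: closed_subsets_iff)

lemma mclosure_closed:
  assumes "S \<subseteq> mspace m" "S \<noteq> {}"
  shows "mclosure m S \<in> closed_subsets m"
  using mclosure_superset[OF assms(1)] mclosure_eq_closure_of[OF assms(1)] assms(2)
  by (auto simp: closed_subsets_def)

lemma mclosure_minimal: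
  assumes "S \<subseteq> X" "X \<in> closed_subsets m"
  shows "mclosure m S \<subseteq> X"
  using assms unfolding closed_subsets_iff mclosure_def by blast

text \<open>This makes closures Effros measurable in their generators: hitting an open set is
  decided on a countable dense set.\<close>

lemma mclosure_meets_open:
  assumes "S \<subseteq> mspace m" "openin (mtopology_of m) W"
  shows "mclosure m S \<inter> W \<noteq> {} \<longleftrightarrow> S \<inter> W \<noteq> {}"
  using openin_Int_closure_of_eq_empty[OF assms(2), of S] mclosure_eq_closure_of[OF assms(1)]
  by auto

lemma openin_metricD:
  assumes "openin (mtopology_of m) W" "x \<in> W"
  obtains r where "r > 0" "\<And>y. y \<in> mspace m \<Longrightarrow> mdist m x y < r \<Longrightarrow> y \<in> W"
proof -
  interpret Metric_space "mspace m" "mdist m" by simp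
  have W: "W \<subseteq> mspace m" "\<forall>x. x \<in> W \<longrightarrow> (\<exists>r>0. mball x r \<subseteq> W)"
    using assms(1) unfolding mtopology_of_def openin_mtopology by auto
  then obtain r where r: "r > 0" "mball x r \<subseteq> W"
    using assms(2) by blast
  have "x \<in> mspace m" using W(1) assms(2) by blast
  with r show thesis using that[of r] by (auto simp: subset_iff)
qed

lemma openin_mball_of:
  assumes "x \<in> mspace m"
  shows "openin (mtopology_of m) {y \<in> mspace m. mdist m x y < r}"
proof -
  interpret Metric_space "mspace m" "mdist m" by simp
  have "{y \<in> mspace m. mdist m x y < r} = mball x r" using assms by auto
  then show ?thesis by (simp add: mtopology_of_def)
qed

subsection \<open>Extension of partial isometries\<close>

text \<open>A relation instead of a function: its converse is of the same kind, which is what a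
  back-and-forth argument needs, and single-valuedness follows from preservation of
  distances.\<close>

definition partial_isometry :: "'a metric \<Rightarrow> 'b metric \<Rightarrow> ('a \<times> 'b) set \<Rightarrow> bool" where
  "partial_isometry m m' R \<longleftrightarrow> R \<subseteq> mspace m \<times> mspace m' \<and>
     (\<forall>(a, b)\<in>R. \<forall>(c, d)\<in>R. mdist m a c = mdist m' b d)"

lemma partial_isometryD:
  assumes "partial_isometry m m' R" "(a, b) \<in> R" "(c, d) \<in> R"
  shows "mdist m a c = mdist m' b d"
  using assms by (auto simp: partial_isometry_def)

lemma partial_isometry_converse:
  "partial_isometry m m' R \<Longrightarrow> partial_isometry m' m (R\<inverse>)"
  by (fastforce simp: partial_isometry_def)

lemma partial_isometry_functional:
  assumes "partial_isometry m m' R" "(a, b) \<in> R" "(a, d) \<in> R"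
  shows "b = d"
proof -
  have "a \<in> mspace m" "b \<in> mspace m'" "d \<in> mspace m'"
    using assms by (auto simp: partial_isometry_def)
  moreover have "mdist m' b d = mdist m a a"
    using partial_isometryD[OF assms] by simp
  ultimately show ?thesis by simp
qed

text \<open>The image of \<open>x\<close> is the limit of the partners \<open>b\<close> of points
  \<open>a\<close> tending to \<open>x\<close>; these partners form a Cauchy sequence because
  \<open>R\<close> preserves distances. The relation \<open>near\<close> describes the limit
  independently of the approximating sequence.\<close>

lemma partial_isometry_extend:
  assumes R: "partial_isometry m m' R"
    and dense: "\<And>x \<epsilon>. x \<in> mspace m \<Longrightarrow> \<epsilon> > 0 \<Longrightarrow> \<exists>(a, b)\<in>R. mdist m x a < \<epsilon>"
    and complete: "mcomplete_of m'"
  obtains f where "isometric_embedding m m' f" "\<And>a b. (a, b) \<in> R \<Longrightarrow> f a = b"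
proof -
  have Rm: "a \<in> mspace m" "b \<in> mspace m'" if "(a, b) \<in> R" for a b
    using that R by (auto simp: partial_isometry_def)
  define near where
    "near x y \<longleftrightarrow> (\<forall>\<epsilon>>0. \<exists>(a, b)\<in>R. mdist m x a < \<epsilon> \<and> mdist m' y b < \<epsilon>)" for x y
  have ex: "\<exists>y\<in>mspace m'. near x y" if x: "x \<in> mspace m" for x
  proof -
    have "\<exists>p. p \<in> R \<and> mdist m x (fst p) < (1/2) ^ n" for n :: nat
      using dense[OF x, of "(1/2) ^ n"] by auto
    then obtain p where p: "\<And>n. p n \<in> R" "\<And>n. mdist m x (fst (p n)) < (1/2) ^ n"
      by metis
    have pm: "fst (p n) \<in> mspace m" "snd (p n) \<in> mspace m'" for n
      using Rm[of "fst (p n)" "snd (p n)"] p(1)[of n] by auto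
    have "mdist m' (snd (p n)) (snd (p (Suc n))) \<le> 2 * (1/2) ^ n" for n
    proof -
      have "mdist m' (snd (p n)) (snd (p (Suc n))) = mdist m (fst (p n)) (fst (p (Suc n)))"
        using partial_isometryD[OF R, of "fst (p n)" "snd (p n)" "fst (p (Suc n))"
            "snd (p (Suc n))"] p(1) by simp
      also have "\<dots> \<le> mdist m x (fst (p n)) + mdist m x (fst (p (Suc n)))"
        using mdist_triangle[of "fst (p n)" m x "fst (p (Suc n))"] pm x
          mdist_commute[of m x "fst (p n)"] by simp
      also have "\<dots> \<le> (1/2) ^ n + (1/2) ^ Suc n"
        using p(2)[of n] p(2)[of "Suc n"] by linarith
      also have "\<dots> \<le> 2 * (1/2) ^ n" by simp
      finally show ?thesis .
    qed
    moreover have "range (\<lambda>n. snd (p n)) \<subseteq> mspace m'" using pm(2) by blast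
    ultimately obtain l
      where l: "l \<in> mspace m'" "\<And>n. mdist m' (snd (p n)) l \<le> 2 * 2 * (1/2) ^ n"
      using geometric_limit[OF complete, of "\<lambda>n. snd (p n)" 2] by blast
    have "near x l"
      unfolding near_def
    proof (intro allI impI)
      fix \<epsilon> :: real assume "\<epsilon> > 0"
      then obtain n where n: "4 * (1/2) ^ n < \<epsilon>" using half_power_small[of \<epsilon> 4] by blast
      moreover have "(1/2::real) ^ n \<le> 4 * (1/2) ^ n" by simp
      ultimately have "mdist m x (fst (p n)) < \<epsilon>" "mdist m' l (snd (p n)) < \<epsilon>"
        using p(2)[of n] l(2)[of n] mdist_commute[of m' l "snd (p n)"] by linarith+
      then show "\<exists>(a, b)\<in>R. mdist m x a < \<epsilon> \<and> mdist m' l b < \<epsilon>"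
        using p(1)[of n] by (metis (mono_tags, lifting) case_prod_beta)
    qed
    then show ?thesis using l(1) by blast
  qed
  have near_dist: "mdist m' y y' = mdist m x x'"
    if nr: "near x y" "near x' y'" and mem: "x \<in> mspace m" "x' \<in> mspace m"
      "y \<in> mspace m'" "y' \<in> mspace m'" for x x' y y'
  proof (rule ccontr)
    assume "mdist m' y y' \<noteq> mdist m x x'"
    \<comment> \<open>A quarter, because the four errors at \<open>x\<close>, \<open>x'\<close>,
      \<open>y\<close>, \<open>y'\<close> together must stay below the supposed discrepancy.\<close>
    then have pos: "\<bar>mdist m' y y' - mdist m x x'\<bar> / 4 > 0" (is "?e > 0") by simp
    obtain a b where ab: "(a, b) \<in> R" "mdist m x a < ?e" "mdist m' y b < ?e"
      using nr(1) pos unfolding near_def by blast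
    obtain c d where cd: "(c, d) \<in> R" "mdist m x' c < ?e" "mdist m' y' d < ?e"
      using nr(2) pos unfolding near_def by blast
    have "mdist m a c = mdist m' b d" using partial_isometryD[OF R ab(1) cd(1)] .
    moreover have "\<bar>mdist m x x' - mdist m a c\<bar> \<le> mdist m x a + mdist m x' c"
      by (rule mdist_perturb) (use mem Rm ab cd in auto)
    moreover have "\<bar>mdist m' y y' - mdist m' b d\<bar> \<le> mdist m' y b + mdist m' y' d"
      by (rule mdist_perturb) (use mem Rm ab cd in auto)
    ultimately show False using ab(2,3) cd(2,3) by argo
  qed
  define f where "f x = (SOME y. y \<in> mspace m' \<and> near x y)" for x
  have f: "f x \<in> mspace m'" "near x (f x)" if "x \<in> mspace m" for x
    using someI_ex[of "\<lambda>y. y \<in> mspace m' \<and> near x y"] ex[OF that] by (auto simp: f_def)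
  have "isometric_embedding m m' f"
    using f near_dist by (auto simp: isometric_embedding_def)
  moreover have "f a = b" if "(a, b) \<in> R" for a b
  proof -
    have "near a b"
      unfolding near_def using that Rm[OF that] by force
    then have "mdist m' (f a) b = mdist m a a"
      using near_dist[of a "f a" a b] f Rm[OF that] by blast
    then show ?thesis using f(1)[of a] Rm[OF that] by simp
  qed
  ultimately show thesis using that by blast
qed

text \<open>Extending the converse relation as well gives a right inverse \<open>g\<close> of
  \<open>f\<close>: a pair of \<open>R\<close> close to \<open>y\<close> shows that
  \<open>f (g y)\<close> and \<open>y\<close> are arbitrarily close.\<close>

lemma partial_isometry_extend_onto:
  assumes R: "partial_isometry m m' R"
    and dense: "\<And>x \<epsilon>. x \<in> mspace m \<Longrightarrow> \<epsilon> > 0 \<Longrightarrow> \<exists>(a, b)\<in>R. mdist m x a < \<epsilon>"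
    and dense': "\<And>y \<epsilon>. y \<in> mspace m' \<Longrightarrow> \<epsilon> > 0 \<Longrightarrow> \<exists>(a, b)\<in>R. mdist m' y b < \<epsilon>"
    and complete: "mcomplete_of m" "mcomplete_of m'"
  obtains f where "isometry_onto m m' f" "\<And>a b. (a, b) \<in> R \<Longrightarrow> f a = b"
proof -
  obtain f where f: "isometric_embedding m m' f" "\<And>a b. (a, b) \<in> R \<Longrightarrow> f a = b"
    using partial_isometry_extend[OF R dense complete(2)] by blast
  have conv: "\<exists>(b, a)\<in>R\<inverse>. mdist m' y b < \<epsilon>" if "y \<in> mspace m'" "\<epsilon> > 0" for y \<epsilon>
    using dense'[OF that] by auto
  obtain g where g: "isometric_embedding m' m g" "\<And>b a. (b, a) \<in> R\<inverse> \<Longrightarrow> g b = a"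
    by (rule partial_isometry_extend[OF partial_isometry_converse[OF R] conv complete(1)], assumption+, rule that)
  have "y \<in> f ` mspace m" if y: "y \<in> mspace m'" for y
  proof -
    have gm: "g y \<in> mspace m" and fg: "f (g y) \<in> mspace m'"
      using f(1) g(1) y by (auto simp: isometric_embedding_def)
    have "f (g y) = y"
    proof (rule mdist_small_imp_eq[OF fg y])
      fix \<epsilon> :: real assume "\<epsilon> > 0"
      then obtain a b where ab: "(a, b) \<in> R" "mdist m' y b < \<epsilon> / 2"
        using dense'[OF y, of "\<epsilon> / 2"] by auto
      have abm: "a \<in> mspace m" "b \<in> mspace m'"
        using ab(1) R by (auto simp: partial_isometry_def)
      have "mdist m (g y) a = mdist m' y b"
        using g(1) g(2)[of b a] ab(1) y abm by (auto simp: isometric_embedding_def)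
      moreover have "mdist m' (f (g y)) b = mdist m (g y) a"
        using f(1) f(2)[OF ab(1)] gm abm by (auto simp: isometric_embedding_def)
      ultimately show "mdist m' (f (g y)) y < \<epsilon>"
        using mdist_triangle[of "f (g y)" m' b y] fg y abm ab(2) mdist_commute[of m' y b] by simp
    qed
    then show ?thesis using gm by (metis image_eqI)
  qed
  then have "isometry_onto m m' f"
    using f(1) by (auto simp: isometry_onto_def isometric_embedding_def)
  then show thesis using that f(2) by blast
qed

lemma closed_subset_complete:
  assumes "mcomplete_of m" "X \<in> closed_subsets m"
  shows "mcomplete_of (submetric m X)"
proof -
  interpret Metric_space "mspace m" "mdist m" by simp
  have X: "X \<subseteq> mspace m" by (rule closed_subsets_subset[OF assms(2)])
  interpret Submetric "mspace m" "mdist m" X by standard (rule X)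
  have "sub.mcomplete"
    using closedin_mcomplete_imp_mcomplete assms
    by (simp add: closed_subsets_def mtopology_of_def mcomplete_of_def)
  moreover have "X \<inter> mspace m = X" using X by blast
  ultimately show ?thesis by (simp add: mcomplete_of_def)
qed

subsection \<open>Extension properties\<close>

text \<open>A Katetov function: the distances prescribed for one new point. On points of the space
  the case \<open>x = y\<close> gives \<open>k x \<ge> 0\<close>. The value 0 is allowed and forces
  the new point to coincide with an old one.\<close>

definition katetov :: "'a metric \<Rightarrow> 'a set \<Rightarrow> ('a \<Rightarrow> real) \<Rightarrow> bool" where
  "katetov m F k \<longleftrightarrow> (\<forall>x\<in>F. \<forall>y\<in>F. metric_triple (k x) (k y) (mdist m x y))"

definition extension_property :: "'a metric \<Rightarrow> 'a set \<Rightarrow> real set \<Rightarrow> bool" where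
  "extension_property m X A \<longleftrightarrow>
     (\<forall>F k. finite F \<longrightarrow> F \<subseteq> X \<longrightarrow> k ` F \<subseteq> A \<longrightarrow> katetov m F k \<longrightarrow>
        (\<exists>z\<in>X. \<forall>x\<in>F. mdist m z x = k x))"

lemma extension_propertyD:
  assumes "extension_property m X A" "finite F" "F \<subseteq> X" "k ` F \<subseteq> A" "katetov m F k"
  obtains z where "z \<in> X" "\<And>x. x \<in> F \<Longrightarrow> mdist m z x = k x"
  using assms unfolding extension_property_def by meson

text \<open>Entries of the list may repeat. A triple at distance 0 forces equal values, so it does
  not matter which index is chosen for a point.\<close>

lemma katetov_of_list:
  assumes "set xs \<subseteq> mspace m"
    and triple: "\<And>i j. i < length xs \<Longrightarrow> j < length xs \<Longrightarrow>
      metric_triple (k i) (k j) (mdist m (xs ! i) (xs ! j))"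
  obtains k' where "katetov m (set xs) k'" "\<And>i. i < length xs \<Longrightarrow> k' (xs ! i) = k i"
proof -
  define idx where "idx x = (SOME i. i < length xs \<and> xs ! i = x)" for x
  have idx: "idx x < length xs" "xs ! idx x = x" if "x \<in> set xs" for x
    using someI_ex[of "\<lambda>i. i < length xs \<and> xs ! i = x"] that
    by (auto simp: idx_def in_set_conv_nth)
  have "katetov m (set xs) (k \<circ> idx)"
    unfolding katetov_def using triple[OF idx(1) idx(1)] idx(2) by fastforce
  moreover have "(k \<circ> idx) (xs ! i) = k i" if i: "i < length xs" for i
  proof -
    have mem: "xs ! i \<in> set xs" using i by simp
    then have "mdist m (xs ! idx (xs ! i)) (xs ! i) = 0"
      using idx(2)[OF mem] assms(1) by auto
    then have "k (idx (xs ! i)) = k i"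
      using triple[OF idx(1)[OF mem] i] by (simp add: metric_triple_def)
    then show ?thesis by simp
  qed
  ultimately show thesis using that by blast
qed

lemma extension_property_list:
  assumes "extension_property m X A" "X \<subseteq> mspace m" "set xs \<subseteq> X"
    and "\<And>i. i < length xs \<Longrightarrow> k i \<in> A"
    and "\<And>i j. i < length xs \<Longrightarrow> j < length xs \<Longrightarrow>
      metric_triple (k i) (k j) (mdist m (xs ! i) (xs ! j))"
  obtains z where "z \<in> X" "\<And>i. i < length xs \<Longrightarrow> mdist m z (xs ! i) = k i"
proof -
  obtain k' where k': "katetov m (set xs) k'" "\<And>i. i < length xs \<Longrightarrow> k' (xs ! i) = k i"
    using katetov_of_list[OF subset_trans[OF assms(3,2)] assms(5)] by blast
  have "k' ` set xs \<subseteq> A"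
    using assms(4) k'(2) by (auto simp: in_set_conv_nth)
  then obtain z where "z \<in> X" "\<And>x. x \<in> set xs \<Longrightarrow> mdist m z x = k' x"
    using extension_propertyD[OF assms(1) finite_set assms(3) _ k'(1)] by blast
  then show thesis using that k'(2) by force
qed

text \<open>Dependent choice for constructions in which each new term depends on all earlier
  ones.\<close>

lemma list_choice:
  assumes "P []" "\<And>xs. P xs \<Longrightarrow> \<exists>z. P (xs @ [z])"
  obtains h :: "nat \<Rightarrow> 'a" where "\<And>n. P (map h [0..<n])"
proof -
  define ls where "ls = rec_nat [] (\<lambda>_ xs. xs @ [SOME z. P (xs @ [z])])"
  have ls: "ls 0 = []" "ls (Suc n) = ls n @ [SOME z. P (ls n @ [z])]" for n
    by (simp_all add: ls_def)
  define h where "h n = last (ls (Suc n))" for n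
  have "ls n = map h [0..<n]" for n
    by (induction n) (simp_all add: ls h_def)
  moreover have "P (ls n)" for n
    by (induction n) (use assms(1) someI_ex[OF assms(2)] in \<open>simp_all add: ls\<close>)
  ultimately have "P (map h [0..<n])" for n by simp
  then show thesis using that by blast
qed

text \<open>Points are added one at a time, row \<open>n\<close> of the matrix being a Katetov
  function on the points already placed. A pseudometric is allowed because dense sequences may
  repeat terms.\<close>

lemma realise_pseudometric:
  fixes \<delta> :: "nat \<Rightarrow> nat \<Rightarrow> real"
  assumes "extension_property m X A" "X \<subseteq> mspace m"
    and "\<And>i j. \<delta> i j \<in> A" "\<And>i. \<delta> i i = 0" "\<And>i j. \<delta> i j = \<delta> j i"
    and tri: "\<And>i j k. \<delta> i k \<le> \<delta> i j + \<delta> j k"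
  obtains h where "range h \<subseteq> X" "\<And>i j. mdist m (h i) (h j) = \<delta> i j"
proof -
  define P where "P xs \<longleftrightarrow> set xs \<subseteq> X \<and>
    (\<forall>i<length xs. \<forall>j<length xs. mdist m (xs ! i) (xs ! j) = \<delta> i j)" for xs
  have step: "\<exists>z. P (xs @ [z])" if xs: "P xs" for xs
  proof -
    let ?n = "length xs"
    have "metric_triple (\<delta> ?n i) (\<delta> ?n j) (mdist m (xs ! i) (xs ! j))"
      if "i < ?n" "j < ?n" for i j
    proof -
      have "mdist m (xs ! i) (xs ! j) = \<delta> i j" using xs that by (simp add: P_def)
      then show ?thesis
        using tri[of ?n i j] tri[of ?n j i] tri[of i j ?n] assms(5)[of i j] assms(5)[of ?n]
        by (simp add: metric_triple_def)
    qed
    then obtain z where z: "z \<in> X" "\<And>i. i < ?n \<Longrightarrow> mdist m z (xs ! i) = \<delta> ?n i"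
      using extension_property_list[OF assms(1,2), of xs "\<delta> ?n"] assms(3) xs
      unfolding P_def by blast
    have "z \<in> mspace m" using z(1) assms(2) by blast
    moreover have "mdist m (xs ! i) z = \<delta> i ?n" if "i < ?n" for i
      using z(2)[OF that] mdist_commute[of m z] assms(5)[of i ?n] by simp
    ultimately have "P (xs @ [z])"
      using xs z assms(4) by (auto simp: P_def nth_append less_Suc_eq)
    then show ?thesis by blast
  qed
  have "P []" by (simp add: P_def)
  then obtain h where h: "\<And>n. P (map h [0..<n])"
    using list_choice[of P] step by blast
  have "h i \<in> X" for i
    using h[of "Suc i"] by (auto simp: P_def)
  moreover have "mdist m (h i) (h j) = \<delta> i j" for i j
    using h[of "Suc (max i j)"] unfolding P_def by (auto simp del: upt_Suc)
  ultimately show thesis using that by blast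
qed

lemma finite_polish_metric:
  assumes "finite (mspace m)" "mspace m \<noteq> {}"
  shows "polish_metric m"
proof -
  interpret Metric_space "mspace m" "mdist m" by simp
  have "compact_space mtopology"
    using assms(1) unfolding compact_space_def by (intro finite_imp_compactin) auto
  then have "mcomplete" by (rule compact_space_imp_mcomplete)
  moreover have "separable_space (mtopology_of m)"
    unfolding separable_space_def using assms(1) closure_of_topspace[of "mtopology_of m"]
    by (metis countable_finite order_refl topspace_mtopology_of)
  ultimately show ?thesis
    using assms(2) by (simp add: polish_metric_def mcomplete_of_def)
qed

text \<open>Together with a new point \<open>F\<close> is a finite metric space, which embeds into
  \<open>U\<close>. Ultrahomogeneity moves the copy of \<open>F\<close> back onto \<open>F\<close>
  and takes the new point along.\<close>

lemma urysohn_extension_property: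
  fixes U :: "'u metric"
  assumes U: "urysohn_space U"
  shows "extension_property U (mspace U) {0..}"
  unfolding extension_property_def
proof (intro allI impI)
  fix F and k :: "'u \<Rightarrow> real"
  assume F: "finite F" "F \<subseteq> mspace U" and k: "k ` F \<subseteq> {0..}" and kat: "katetov U F k"
  have FU: "x \<in> mspace U" if "x \<in> F" for x using that F(2) by blast
  have tr: "metric_triple (k x) (k y) (mdist U x y)" if "x \<in> F" "y \<in> F" for x y
    using kat that by (simp add: katetov_def)
  show "\<exists>z\<in>mspace U. \<forall>x\<in>F. mdist U z x = k x"
  proof (cases "\<exists>p\<in>F. k p = 0")
    case True
    then obtain p where p: "p \<in> F" "k p = 0" by blast
    have "mdist U p x = k x" if "x \<in> F" for x
      using tr[OF p(1) that] p(2) by (simp add: metric_triple_def)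
    then show ?thesis using p(1) F(2) by blast
  next
    case False
    have pos: "k x > 0" if "x \<in> F" for x
      using False k that by (force simp: less_le)
    define dd :: "'u option \<Rightarrow> 'u option \<Rightarrow> real" where
      "dd u v = (case u of None \<Rightarrow> (case v of None \<Rightarrow> 0 | Some y \<Rightarrow> k y)
         | Some x \<Rightarrow> (case v of None \<Rightarrow> k x | Some y \<Rightarrow> mdist U x y))" for u v
    have dd [simp]: "dd None None = 0" "dd None (Some y) = k y" "dd (Some x) None = k x"
      "dd (Some x) (Some y) = mdist U x y" for x y by (simp_all add: dd_def)
    define M where "M = insert None (Some ` F)"
    \<comment> \<open>Outside \<open>M\<close> the distance is cut off to 0, since nonnegativity and
      symmetry are demanded of all arguments and \<open>k\<close> may be negative off
      \<open>F\<close>.\<close>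
    interpret S: Metric_space M "\<lambda>u v. if u \<in> M \<and> v \<in> M then dd u v else 0"
    proof
      fix u v w
      show "0 \<le> (if u \<in> M \<and> v \<in> M then dd u v else 0)"
        using pos by (auto simp: M_def less_imp_le)
      show "(if u \<in> M \<and> v \<in> M then dd u v else 0) = (if v \<in> M \<and> u \<in> M then dd v u else 0)"
        by (auto simp: M_def mdist_commute)
      assume uv: "u \<in> M" "v \<in> M"
      show "((if u \<in> M \<and> v \<in> M then dd u v else 0) = 0) = (u = v)"
        using uv subsetD[OF F(2)] pos by (cases u; cases v) (auto simp: M_def less_imp_neq[symmetric] dest: pos)
      assume w: "w \<in> M"
      have "dd u w \<le> dd u v + dd v w"
      proof (cases u; cases v; cases w)
        fix x y z assume "u = Some x" "v = Some y" "w = Some z"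
        then show ?thesis using uv w F(2) by (auto simp: M_def intro!: mdist_triangle)
      next
        fix x y assume e: "u = Some x" "v = None" "w = Some y"
        show ?thesis using tr[of x y] uv w e by (auto simp: M_def metric_triple_def)
      next
        fix x y assume e: "u = Some x" "v = Some y" "w = None"
        show ?thesis using tr[of x y] uv w e by (auto simp: M_def metric_triple_def)
      next
        fix x y assume e: "u = None" "v = Some x" "w = Some y"
        show ?thesis using tr[of x y] uv w e by (auto simp: M_def metric_triple_def)
      qed (use uv w pos in \<open>auto simp: M_def less_imp_le\<close>)
      then show "(if u \<in> M \<and> w \<in> M then dd u w else 0) \<le>
          (if u \<in> M \<and> v \<in> M then dd u v else 0) + (if v \<in> M \<and> w \<in> M then dd v w else 0)"
        using uv w by simp
    qed
    define m' where "m' = metric (M, \<lambda>u v. if u \<in> M \<and> v \<in> M then dd u v else 0)"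
    have m': "mspace m' = M" "\<And>u v. u \<in> M \<Longrightarrow> v \<in> M \<Longrightarrow> mdist m' u v = dd u v"
      by (simp_all add: m'_def S.mspace_metric S.mdist_metric)
    have "polish_metric m'"
      using F(1) by (intro finite_polish_metric) (auto simp: m' M_def)
    then obtain e where e: "isometric_embedding m' U e"
      using urysohn_space_universal[OF U] by (auto simp: isometrically_embeds_def)
    have eU: "e u \<in> mspace U" if "u \<in> M" for u
      using e that by (auto simp: isometric_embedding_def m')
    have ed: "mdist U (e u) (e v) = dd u v" if "u \<in> M" "v \<in> M" for u v
      using e that m' by (auto simp: isometric_embedding_def)
    have FM: "Some x \<in> M" if "x \<in> F" for x using that by (simp add: M_def)
    have inj: "inj_on (e \<circ> Some) F"
    proof (rule inj_onI)
      fix x y assume xy: "x \<in> F" "y \<in> F" "(e \<circ> Some) x = (e \<circ> Some) y"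
      then have "mdist U x y = 0" using ed[OF FM FM, of x y] eU[OF FM, of y] by simp
      then show "x = y" using xy FU by simp
    qed
    define f where "f = inv_into F (e \<circ> Some)"
    define P where "P = (e \<circ> Some) ` F"
    have f: "f (e (Some x)) = x" if "x \<in> F" for x
      using inv_into_f_f[OF inj that] by (simp add: f_def)
    have P: "P \<subseteq> mspace U" "finite P" using eU FM F(1) by (auto simp: P_def)
    have "isometry_onto (submetric U P) (submetric U F) f"
    proof -
      have "f ` P = F" using f by (simp add: P_def image_image)
      moreover have "mdist U (f u) (f v) = mdist U u v" if "u \<in> P" "v \<in> P" for u v
        using that f ed[OF FM FM] by (auto simp: P_def)
      moreover have "P \<inter> mspace U = P" "F \<inter> mspace U = F" using P(1) F(2) by auto
      ultimately show ?thesis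
        by (auto simp: isometry_onto_def isometric_embedding_def)
    qed
    then obtain g where g: "isometry_onto U U g" "\<forall>x\<in>P. g x = f x"
      using U P F unfolding urysohn_space_def ultrahomogeneous_def by blast
    have NM: "None \<in> M" by (simp add: M_def)
    have "g (e None) \<in> mspace U"
      using g(1) eU[OF NM] by (auto simp: isometry_onto_def isometric_embedding_def)
    moreover have "mdist U (g (e None)) x = k x" if x: "x \<in> F" for x
    proof -
      have "g (e (Some x)) = x" using g(2) f[OF x] x by (auto simp: P_def)
      moreover have "mdist U (g (e None)) (g (e (Some x))) = mdist U (e None) (e (Some x))"
        using g(1) eU[OF NM] eU[OF FM[OF x]]
        by (simp add: isometry_onto_def isometric_embedding_def)
      ultimately show ?thesis using ed[OF NM FM[OF x]] by simp
    qed
    ultimately show ?thesis by blast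
  qed
qed

section \<open>From the extension property to universality and ultrahomogeneity\<close>

lemma V_iff:
  "X \<in> V U A \<longleftrightarrow> X \<in> closed_subsets U \<and> (\<forall>x\<in>X. \<forall>y\<in>X. mdist U x y \<in> A)"
proof -
  have "distances (submetric U X) = {mdist U x y |x y. x \<in> X \<and> y \<in> X}"
    if "X \<in> closed_subsets U"
    using Int_absorb2[OF closed_subsets_subset[OF that]] by (simp add: distances_def)
  then show ?thesis by (auto simp: V_def)
qed

lemma submetric_closed_mspace:
  "X \<in> closed_subsets U \<Longrightarrow> mspace (submetric U X) = X"
  using closed_subsets_subset[of X U] by auto

text \<open>The distance matrix of a dense sequence of \<open>Y\<close> is realised in
  \<open>X\<close>, and the resulting partial isometry is extended to \<open>Y\<close> by
  completeness of \<open>X\<close>.\<close>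

lemma extension_property_imp_embeds:
  assumes "polish_metric U" "X \<in> closed_subsets U" "extension_property U X A" "Y \<in> V U A"
  shows "isometrically_embeds (submetric U Y) (submetric U X)"
proof -
  have Y: "Y \<in> closed_subsets U" "\<And>x y. x \<in> Y \<Longrightarrow> y \<in> Y \<Longrightarrow> mdist U x y \<in> A"
    using assms(4) by (auto simp: V_iff)
  have YU: "Y \<subseteq> mspace U" "Y \<noteq> {}" using Y(1) by (auto simp: closed_subsets_iff)
  obtain y :: "nat \<Rightarrow> _" where y: "range y \<subseteq> Y" "\<And>x \<epsilon>. x \<in> Y \<Longrightarrow> \<epsilon> > 0 \<Longrightarrow> \<exists>n. mdist U x (y n) < \<epsilon>"
    using polish_dense_sequence[OF assms(1) YU] by blast
  have yY: "y i \<in> Y" for i using y(1) by (rule range_subsetD)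
  then have yU: "y i \<in> mspace U" for i using YU(1) by blast
  obtain h where h: "range h \<subseteq> X" "\<And>i j. mdist U (h i) (h j) = mdist U (y i) (y j)"
    using realise_pseudometric[OF assms(3) closed_subsets_subset[OF assms(2)],
        of "\<lambda>i j. mdist U (y i) (y j)"] Y(2) yY yU mdist_triangle mdist_commute
    by (metis mdist_self)
  define R where "R = range (\<lambda>i. (y i, h i))"
  have "partial_isometry (submetric U Y) (submetric U X) R"
    using yY h by (auto simp: partial_isometry_def R_def submetric_closed_mspace[OF Y(1)]
        submetric_closed_mspace[OF assms(2)] simp del: mspace_submetric)
  moreover have "\<exists>(a, b)\<in>R. mdist (submetric U Y) x a < \<epsilon>"
    if "x \<in> mspace (submetric U Y)" "\<epsilon> > 0" for x \<epsilon>
    using y(2)[of x \<epsilon>] that by (auto simp: R_def)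
  moreover have "mcomplete_of (submetric U X)"
    using closed_subset_complete assms(1,2) by (auto simp: polish_metric_def)
  ultimately obtain f where "isometric_embedding (submetric U Y) (submetric U X) f"
    by (rule partial_isometry_extend)
  then show ?thesis by (auto simp: isometrically_embeds_def)
qed

lemma partial_isometry_add_point:
  assumes EP: "extension_property m (mspace m) A" and "distances m \<subseteq> A"
    and R: "partial_isometry m m R" "finite R" and a: "a \<in> mspace m"
  obtains b where "partial_isometry m m (insert (a, b) R)"
proof -
  \<comment> \<open>The choice is unambiguous, because the converse of a partial isometry is
    single-valued too.\<close>
  define k where "k y = mdist m a (SOME x. (x, y) \<in> R)" for y
  have k: "k y = mdist m a x" if "(x, y) \<in> R" for x y
  proof -
    have "(SOME x. (x, y) \<in> R) = x"
      using partial_isometry_functional[OF partial_isometry_converse[OF R(1)], of y] that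
      by (intro some_equality) auto
    then show ?thesis by (simp add: k_def)
  qed
  have Rm: "x \<in> mspace m" "y \<in> mspace m" if "(x, y) \<in> R" for x y
    using that R(1) by (auto simp: partial_isometry_def)
  have "katetov m (snd ` R) k"
    unfolding katetov_def
  proof safe
    fix x y x' y' assume p: "(x, y) \<in> R" "(x', y') \<in> R"
    have "metric_triple (mdist m a x) (mdist m a x') (mdist m x x')"
      by (rule mdist_triple) (use p Rm a in auto)
    then show "metric_triple (k (snd (x, y))) (k (snd (x', y'))) (mdist m (snd (x, y)) (snd (x', y')))"
      using k[OF p(1)] k[OF p(2)] partial_isometryD[OF R(1) p] by simp
  qed
  moreover have "k ` snd ` R \<subseteq> A"
    using k Rm a assms(2) by (fastforce simp: distances_def)
  moreover have "snd ` R \<subseteq> mspace m" using Rm by auto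
  ultimately obtain b where b: "b \<in> mspace m" "\<And>y. y \<in> snd ` R \<Longrightarrow> mdist m b y = k y"
    using extension_propertyD[OF EP, of "snd ` R" k] R(2) by blast
  have bk: "mdist m b y = mdist m a x" if "(x, y) \<in> R" for x y
    using b(2)[of y] k[OF that] that by force
  then have "mdist m x a = mdist m y b" if "(x, y) \<in> R" for x y
    using bk[OF that] mdist_commute[of m x a] mdist_commute[of m y b] by simp
  then have "partial_isometry m m (insert (a, b) R)"
    using bk R(1) a b(1) by (auto simp: partial_isometry_def)
  then show thesis using that by blast
qed

text \<open>Back and forth along a dense sequence \<open>e\<close>, starting from the graph of the
  given finite isometry; the union of the stages is dense on both sides.\<close>

lemma extension_property_imp_ultrahomogeneous:
  assumes EP: "extension_property m (mspace m) A" and D: "distances m \<subseteq> A"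
    and compl: "mcomplete_of m"
    and e: "range e \<subseteq> mspace m" "\<And>x \<epsilon>. x \<in> mspace m \<Longrightarrow> \<epsilon> > 0 \<Longrightarrow> \<exists>n::nat. mdist m x (e n) < \<epsilon>"
  shows "ultrahomogeneous m"
  unfolding ultrahomogeneous_def
proof (intro allI impI, elim conjE)
  fix P Q f
  assume P: "P \<subseteq> mspace m" "finite P" and Q: "Q \<subseteq> mspace m" "finite Q"
    and f: "isometry_onto (submetric m P) (submetric m Q) f"
  have eM: "e n \<in> mspace m" for n using e(1) by (rule range_subsetD)
  have fQ: "f x \<in> Q" and fd: "\<And>y. y \<in> P \<Longrightarrow> mdist m (f x) (f y) = mdist m x y" if "x \<in> P" for x
    using f that Int_absorb2[OF P(1)] Int_absorb2[OF Q(1)]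
    by (auto simp: isometry_onto_def isometric_embedding_def)
  define R0 where "R0 = (\<lambda>x. (x, f x)) ` P"
  have R0: "partial_isometry m m R0" "finite R0"
    using P Q fQ fd by (auto simp: partial_isometry_def R0_def)
  \<comment> \<open>Stage \<open>2 * n\<close> puts \<open>e n\<close> into the domain, stage
    \<open>2 * n + 1\<close> puts it into the range.\<close>
  define G where "G xs \<longleftrightarrow> partial_isometry m m (R0 \<union> set xs) \<and>
    (\<forall>n<length xs. e (n div 2) = (if even n then fst else snd) (xs ! n))" for xs
  have "\<exists>z. G (xs @ [z])" if xs: "G xs" for xs
  proof -
    let ?n = "length xs"
    let ?R = "R0 \<union> set xs"
    have R: "partial_isometry m m ?R" "finite ?R" using xs R0(2) by (auto simp: G_def)
    have "\<exists>z. partial_isometry m m (insert z ?R) \<and>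
        e (?n div 2) = (if even ?n then fst else snd) z"
    proof (cases "even ?n")
      case True
      obtain b where "partial_isometry m m (insert (e (?n div 2), b) ?R)"
        using partial_isometry_add_point[OF EP D R eM] by blast
      then show ?thesis using True by (intro exI[of _ "(e (?n div 2), b)"]) simp
    next
      case False
      have "finite (?R\<inverse>)" using R(2) by simp
      then obtain b where "partial_isometry m m (insert (e (?n div 2), b) (?R\<inverse>))"
        using partial_isometry_add_point[OF EP D partial_isometry_converse[OF R(1)] _ eM] by blast
      moreover have "(insert (e (?n div 2), b) (?R\<inverse>))\<inverse> = insert (b, e (?n div 2)) ?R"
        by auto
      ultimately have "partial_isometry m m (insert (b, e (?n div 2)) ?R)"
        using partial_isometry_converse by metis
      then show ?thesis using False by (intro exI[of _ "(b, e (?n div 2))"]) simp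
    qed
    then obtain z where z: "partial_isometry m m (insert z ?R)"
      "e (?n div 2) = (if even ?n then fst else snd) z" by blast
    then have "G (xs @ [z])"
      using xs by (auto simp: G_def nth_append less_Suc_eq)
    then show ?thesis by blast
  qed
  moreover have "G []" using R0(1) by (simp add: G_def)
  ultimately obtain h where h: "\<And>n. G (map h [0..<n])"
    using list_choice[of G] by blast
  define R where "R = R0 \<union> range h"
  have ev: "\<exists>n. \<forall>k\<ge>n. p \<in> R0 \<union> set (map h [0..<k])" if "p \<in> R" for p
  proof (cases "p \<in> R0")
    case False
    then obtain i where "p = h i" using \<open>p \<in> R\<close> by (auto simp: R_def)
    then have "\<forall>k\<ge>Suc i. p \<in> R0 \<union> set (map h [0..<k])" by auto
    then show ?thesis by blast
  qed simp
  have isoR: "partial_isometry m m R"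
  proof -
    have sub: "p \<in> mspace m \<times> mspace m" if pR: "p \<in> R" for p
    proof -
      obtain n where n: "p \<in> R0 \<union> set (map h [0..<n])" using ev[OF pR] by blast
      have "R0 \<union> set (map h [0..<n]) \<subseteq> mspace m \<times> mspace m"
        using h[of n] unfolding G_def partial_isometry_def by (elim conjE)
      then show ?thesis using n by (rule subsetD)
    qed
    have "mdist m a c = mdist m b d" if p: "(a, b) \<in> R" "(c, d) \<in> R" for a b c d
    proof -
      obtain k where "(a, b) \<in> R0 \<union> set (map h [0..<k])"
        "(c, d) \<in> R0 \<union> set (map h [0..<k])"
        using ev[OF p(1)] ev[OF p(2)] by (meson nat_le_linear)
      then show ?thesis using h[of k] partial_isometryD unfolding G_def by metis
    qed
    then show ?thesis using sub by (auto simp: partial_isometry_def)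
  qed
  have hn: "e (n div 2) = (if even n then fst else snd) (h n)" for n
  proof -
    have "e (n div 2) = (if even n then fst else snd) (map h [0..<Suc n] ! n)"
      using h[of "Suc n"] unfolding G_def by (metis diff_zero length_map length_upt lessI)
    then show ?thesis by (simp del: upt_Suc)
  qed
  have dense: "\<exists>(a, b)\<in>R. mdist m x a < \<epsilon>" "\<exists>(a, b)\<in>R. mdist m x b < \<epsilon>"
    if "x \<in> mspace m" "\<epsilon> > 0" for x \<epsilon>
  proof -
    obtain n where n: "mdist m x (e n) < \<epsilon>" using e(2)[OF \<open>x \<in> mspace m\<close> \<open>\<epsilon> > 0\<close>] by blast
    have "fst (h (2 * n)) = e n" "snd (h (2 * n + 1)) = e n"
      using hn[of "2 * n"] hn[of "2 * n + 1"] by simp_all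
    then have "mdist m x (fst (h (2 * n))) < \<epsilon>" "mdist m x (snd (h (2 * n + 1))) < \<epsilon>"
      using n by simp_all
    moreover have "h i \<in> R" for i by (simp add: R_def)
    ultimately show "\<exists>(a, b)\<in>R. mdist m x a < \<epsilon>" "\<exists>(a, b)\<in>R. mdist m x b < \<epsilon>"
      by (metis (mono_tags, lifting) case_prod_beta)+
  qed
  obtain g where g: "isometry_onto m m g" "\<And>a b. (a, b) \<in> R \<Longrightarrow> g a = b"
    by (rule partial_isometry_extend_onto[OF isoR dense compl compl], assumption+, rule that)
  have "\<forall>x\<in>P. g x = f x" using g(2) by (auto simp: R_def R0_def)
  then show "\<exists>g. isometry_onto m m g \<and> (\<forall>x\<in>P. g x = f x)" using g(1) by blast
qed

lemma extension_property_imp_urysohn_for: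
  assumes "polish_metric U" "X \<in> V U A" "extension_property U X A"
  shows "urysohn_for U A X"
proof -
  have X: "X \<in> closed_subsets U" using assms(2) by (simp add: V_iff)
  then have XU: "X \<subseteq> mspace U" "X \<noteq> {}" by (auto simp: closed_subsets_iff)
  obtain y :: "nat \<Rightarrow> _" where "range y \<subseteq> X" "\<And>x \<epsilon>. x \<in> X \<Longrightarrow> \<epsilon> > 0 \<Longrightarrow> \<exists>n. mdist U x (y n) < \<epsilon>"
    using polish_dense_sequence[OF assms(1) XU] by blast
  moreover have "extension_property (submetric U X) X A"
    using assms(3) by (simp add: extension_property_def katetov_def)
  moreover have "distances (submetric U X) \<subseteq> A"
    using assms(2) by (simp add: V_def)
  moreover have "mcomplete_of (submetric U X)"
    using closed_subset_complete X assms(1) by (auto simp: polish_metric_def)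
  ultimately have "ultrahomogeneous (submetric U X)"
    using submetric_closed_mspace[OF X]
    by (intro extension_property_imp_ultrahomogeneous[where A = A and e = y])
      (simp_all del: mspace_submetric)
  then show ?thesis
    using extension_property_imp_embeds[OF assms(1) X assms(3)] assms(2)
    by (auto simp: urysohn_for_def polish_universal_def)
qed

subsection \<open>The Urysohn space of a distance set\<close>

lemma katetov_extend_point:
  assumes four: "four_values A" and "0 \<in> A" "A \<subseteq> {0..}"
    and F: "finite F" "insert w F \<subseteq> mspace m"
    and dA: "\<And>x y. x \<in> insert w F \<Longrightarrow> y \<in> insert w F \<Longrightarrow> mdist m x y \<in> A"
    and k: "k ` F \<subseteq> A" "katetov m F k"
  obtains k' where "\<And>x. x \<in> F \<Longrightarrow> k' x = k x" "k' ` insert w F \<subseteq> A" "katetov m (insert w F) k'"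
proof (cases "w \<in> F \<or> F = {}")
  case True
  then consider "w \<in> F" | "F = {}" by blast
  then show thesis
  proof cases
    case 1
    then show thesis using that[of k] k by (simp add: insert_absorb)
  next
    case 2
    then show thesis using that[of "\<lambda>_. 0"] assms(2) F
      by (simp add: katetov_def metric_triple_def)
  qed
next
  case False
  have kx: "k x \<in> A" if "x \<in> F" for x using k(1) that by blast
  have wm: "w \<in> mspace m" and xm: "x \<in> mspace m" if "x \<in> F" for x using F(2) that by auto
  have kt: "metric_triple (k x) (k y) (mdist m x y)" if "x \<in> F" "y \<in> F" for x y
    using k(2) that by (simp add: katetov_def)
  (* The distance y to w has to satisfy f x <= y <= g x for all x in F; the 4-values condition is
     applied to a point x1 with the largest lower bound and a point x2 with the least upper bound. *)
  define f where "f x = \<bar>k x - mdist m w x\<bar>" for x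
  define g where "g x = k x + mdist m w x" for x
  have "Max (f ` F) \<in> f ` F" "Min (g ` F) \<in> g ` F"
    using F(1) False by (auto intro!: Max_in Min_in)
  then obtain x1 x2 where x: "x1 \<in> F" "f x1 = Max (f ` F)" "x2 \<in> F" "g x2 = Min (g ` F)"
    by force
  have le: "f x \<le> f x1" "g x2 \<le> g x" if "x \<in> F" for x
    using x(2,4) F(1) that by auto
  have "metric_triple (k x1) (k x2) (mdist m x1 x2)" using kt x by blast
  moreover have "metric_triple (mdist m w x2) (mdist m w x1) (mdist m x1 x2)"
    using mdist_triple[OF xm xm wm, of x2 x1] x mdist_commute[of m x1 x2] by metis
  \<comment> \<open>The two triples share the side \<open>mdist m x1 x2\<close>. The instance is
    read off with \<open>a = k x1\<close>, \<open>b = k x2\<close>, \<open>c = mdist m w x2\<close>,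
    \<open>d = mdist m w x1\<close>, which yields \<open>f x1 \<le> y \<le> g x2\<close>.\<close>
  ultimately obtain y where y: "y \<in> A" "metric_triple (k x2) (mdist m w x2) y"
    "metric_triple (k x1) (mdist m w x1) y"
    using four x kx dA unfolding four_values_def by (metis insertCI)
  define k' where "k' = k(w := y)"
  have k': "k' x = k x" if "x \<in> F" for x using that False by (auto simp: k'_def)
  have yb: "\<bar>k x - mdist m w x\<bar> \<le> y" "y \<le> k x + mdist m w x" if "x \<in> F" for x
    using le[OF that] y(2,3) by (auto simp: f_def g_def metric_triple_def)
  have "k' ` insert w F \<subseteq> A" using k' kx y(1) by (auto simp: k'_def)
  moreover have "metric_triple (k' u) (k' v) (mdist m u v)"
    if uv: "u \<in> insert w F" "v \<in> insert w F" for u v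
  proof -
    have "y \<ge> 0" using y(1) assms(3) by auto
    have kw: "k' w = y" by (simp add: k'_def)
    consider "u = w" "v = w" | "u \<in> F" "v = w" | "u = w" "v \<in> F" | "u \<in> F" "v \<in> F"
      using uv by blast
    then show ?thesis
    proof cases
      case 1
      then show ?thesis using kw \<open>y \<ge> 0\<close> F(2) by (simp add: metric_triple_def)
    next
      case 2
      then show ?thesis using yb[of u] k'[of u] kw mdist_commute[of m u w]
        unfolding metric_triple_def by auto
    next
      case 3
      then show ?thesis using yb[of v] k'[of v] kw unfolding metric_triple_def by auto
    next
      case 4
      then show ?thesis using kt k' by simp
    qed
  qed
  ultimately show thesis using that[of k'] k' by (auto simp: katetov_def)
qed

lemma katetov_extend:
  assumes four: "four_values A" and "0 \<in> A" "A \<subseteq> {0..}"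
    and "finite F" "finite G" "F \<union> G \<subseteq> mspace m"
    and dA: "\<And>x y. x \<in> F \<union> G \<Longrightarrow> y \<in> F \<union> G \<Longrightarrow> mdist m x y \<in> A"
    and k: "k ` F \<subseteq> A" "katetov m F k"
  shows "\<exists>k'. (\<forall>x\<in>F. k' x = k x) \<and> k' ` (F \<union> G) \<subseteq> A \<and> katetov m (F \<union> G) k'"
  using assms(5,6,7)
proof (induction G rule: finite_induct)
  case empty
  then show ?case using k by auto
next
  case (insert w G)
  have "F \<union> G \<subseteq> mspace m" "\<And>x y. x \<in> F \<union> G \<Longrightarrow> y \<in> F \<union> G \<Longrightarrow> mdist m x y \<in> A"
    using insert.prems by auto
  from insert.IH[OF this]
  obtain k1 where k1: "\<forall>x\<in>F. k1 x = k x" "k1 ` (F \<union> G) \<subseteq> A" "katetov m (F \<union> G) k1"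
    by blast
  have eq: "F \<union> insert w G = insert w (F \<union> G)" by blast
  have fin: "finite (F \<union> G)" using assms(4) insert.hyps by blast
  obtain k' where k': "\<And>x. x \<in> F \<union> G \<Longrightarrow> k' x = k1 x" "k' ` insert w (F \<union> G) \<subseteq> A"
    "katetov m (insert w (F \<union> G)) k'"
    using katetov_extend_point[OF assms(1-3) fin, of w m k1]
      insert.prems[unfolded eq] k1(2,3) by blast
  then show ?case using k1(1) unfolding eq by (intro exI[of _ k']) auto
qed

text \<open>The approximating tuples must belong to \<open>K\<close> themselves, and
  \<open>K\<close> need not contain rational tuples. Each rational tuple with a tolerance therefore
  selects a nearby member of \<open>K\<close>. A countable \<open>A\<close> allows \<open>K\<close>
  to be listed exactly, which the discrete case relies on.\<close>

lemma dense_enumeration: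
  fixes K :: "real list set"
  assumes K: "\<And>ks. ks \<in> K \<Longrightarrow> length ks = n \<and> set ks \<subseteq> A"
  shows "\<exists>en :: nat \<Rightarrow> real list. \<forall>ks\<in>K. \<forall>\<epsilon>>0. \<exists>j. en j \<in> K \<and>
    (\<forall>i<n. \<bar>en j ! i - ks ! i\<bar> < \<epsilon>) \<and> (countable A \<longrightarrow> en j = ks)"
proof (cases "countable A")
  case True
  then have "countable K"
    using K by (intro countable_subset[OF _ countable_lists[OF True]]) auto
  then have "\<exists>j. from_nat_into K j = ks" if "ks \<in> K" for ks
    using from_nat_into_surj that by metis
  then show ?thesis by (intro exI[of _ "from_nat_into K"]) fastforce
next
  case False
  define Q where "Q p ks \<longleftrightarrow> ks \<in> K \<and>
    (\<forall>i<n. \<bar>of_rat (fst p ! i) - ks ! i\<bar> < 1 / Suc (snd p))" for p :: "rat list \<times> nat" and ks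
  \<comment> \<open>If no member of \<open>K\<close> is near the rational tuple, the value is
    arbitrary; for this reason every use of \<open>en\<close> first checks membership in
    \<open>K\<close>.\<close>
  define en where "en j = (SOME ks. Q (from_nat j) ks)" for j
  have main: "\<exists>j. en j \<in> K \<and> (\<forall>i<n. \<bar>en j ! i - ks ! i\<bar> < \<epsilon>)" if ks: "ks \<in> K" "\<epsilon> > 0" for ks \<epsilon>
  proof -
    obtain N where "inverse (real (Suc N)) < \<epsilon> / 2"
      using reals_Archimedean[of "\<epsilon> / 2"] ks(2) by auto
    then have N: "1 / real (Suc N) < \<epsilon> / 2" by (simp only: inverse_eq_divide)
    have "\<exists>q :: rat. \<bar>of_rat q - ks ! i\<bar> < 1 / Suc N" for i
    proof -
      have "ks ! i < ks ! i + 1 / Suc N" by simp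
      then obtain q where "ks ! i < of_rat q" "of_rat q < ks ! i + 1 / Suc N"
        using of_rat_dense by blast
      then show ?thesis by (intro exI[of _ q]) linarith
    qed
    then obtain q :: "nat \<Rightarrow> rat" where q: "\<And>i. \<bar>of_rat (q i) - ks ! i\<bar> < 1 / Suc N"
      by metis
    define p where "p = (map q [0..<n], N)"
    have "Q p ks" using ks(1) q by (simp add: Q_def p_def)
    then have Q: "Q p (en (to_nat p))" unfolding en_def by (simp add: someI_ex[of "Q p"] exI)
    have "\<bar>en (to_nat p) ! i - ks ! i\<bar> < \<epsilon>" if "i < n" for i
    proof -
      have "\<bar>of_rat (q i) - en (to_nat p) ! i\<bar> < 1 / Suc N"
        using Q that by (simp add: Q_def p_def)
      then show ?thesis using q[of i] N by linarith
    qed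
    then show ?thesis using Q by (auto simp: Q_def)
  qed
  have "\<exists>j. en j \<in> K \<and> (\<forall>i<n. \<bar>en j ! i - ks ! i\<bar> < \<epsilon>) \<and> (countable A \<longrightarrow> en j = ks)"
    if "ks \<in> K" "\<epsilon> > 0" for ks \<epsilon>
    using main[OF that] False by simp
  then show ?thesis by (intro exI[of _ en] ballI allI impI)
qed

text \<open>Bookkeeping: step \<open>prod_encode (l, j)\<close> realises the \<open>j\<close>-th
  listed extension of the first \<open>l\<close> points. Every pair occurs as a step, and it occurs
  after its \<open>l\<close> points have been placed.\<close>

lemma urysohn_sequence:
  fixes U :: "'u metric"
  assumes U: "extension_property U (mspace U) {0..}"
    and A: "four_values A" "0 \<in> A" "A \<subseteq> {0..}"
  obtains x :: "nat \<Rightarrow> 'u" where "range x \<subseteq> mspace U" "\<And>i j. mdist U (x i) (x j) \<in> A"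
    "\<And>n k \<epsilon>. k ` x ` {..<n} \<subseteq> A \<Longrightarrow> katetov U (x ` {..<n}) k \<Longrightarrow> \<epsilon> > 0 \<Longrightarrow>
      \<exists>l. \<forall>i<n. \<bar>mdist U (x l) (x i) - k (x i)\<bar> < \<epsilon> \<and>
        (countable A \<longrightarrow> mdist U (x l) (x i) = k (x i))"
proof -
  define K where "K xs = {ks. length ks = length xs \<and> set ks \<subseteq> A \<and>
    (\<forall>i<length xs. \<forall>j<length xs. metric_triple (ks ! i) (ks ! j) (mdist U (xs ! i) (xs ! j)))}"
    for xs
  have "\<exists>en :: nat \<Rightarrow> real list. \<forall>ks\<in>K xs. \<forall>\<epsilon>>0. \<exists>j. en j \<in> K xs \<and>
    (\<forall>i<length xs. \<bar>en j ! i - ks ! i\<bar> < \<epsilon>) \<and> (countable A \<longrightarrow> en j = ks)" for xs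
    by (rule dense_enumeration) (auto simp: K_def)
  then obtain en :: "'u list \<Rightarrow> nat \<Rightarrow> real list" where
    en: "\<And>xs ks \<epsilon>. ks \<in> K xs \<Longrightarrow> \<epsilon> > 0 \<Longrightarrow> \<exists>j. en xs j \<in> K xs \<and>
      (\<forall>i<length xs. \<bar>en xs j ! i - ks ! i\<bar> < \<epsilon>) \<and> (countable A \<longrightarrow> en xs j = ks)"
    by metis
  define task where "task xs n z \<longleftrightarrow>
    (case prod_decode n of (l, j) \<Rightarrow> en (take l xs) j \<in> K (take l xs) \<longrightarrow>
      (\<forall>i<l. mdist U z (xs ! i) = en (take l xs) j ! i))" for xs n z
  define P where "P xs \<longleftrightarrow> set xs \<subseteq> mspace U \<and> (\<forall>u\<in>set xs. \<forall>v\<in>set xs. mdist U u v \<in> A) \<and>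
    (\<forall>n<length xs. task (take n xs) n (xs ! n))" for xs
  have "\<exists>z. P (xs @ [z])" if xs: "P xs" for xs
  proof -
    let ?n = "length xs"
    obtain l j where lj: "prod_decode ?n = (l, j)" by fastforce
    have l: "l \<le> ?n" using le_prod_encode_1[of l j] lj by (metis prod_decode_inverse)
    \<comment> \<open>If the listed tuple is not a valid extension, the step has no task; the empty
      list then lets the next point be any \<open>A\<close>-valued extension.\<close>
    define ys where "ys = (if en (take l xs) j \<in> K (take l xs) then take l xs else [])"
    have ys: "set ys \<subseteq> set xs" by (auto simp: ys_def dest: in_set_takeD)
    have ysm: "set ys \<subseteq> mspace U" using ys xs by (auto simp: P_def)
    have ly: "length ys \<le> l" using l by (simp add: ys_def)
    have "metric_triple (en (take l xs) j ! i) (en (take l xs) j ! i') (mdist U (ys ! i) (ys ! i'))"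
      if "i < length ys" "i' < length ys" for i i'
      using that by (auto simp: ys_def K_def split: if_splits)
    then obtain k where k: "katetov U (set ys) k"
      "\<And>i. i < length ys \<Longrightarrow> k (ys ! i) = en (take l xs) j ! i"
      using katetov_of_list[OF ysm, of "\<lambda>i. en (take l xs) j ! i"] by blast
    have "k ` set ys \<subseteq> A"
    proof (cases "en (take l xs) j \<in> K (take l xs)")
      case True
      then have "en (take l xs) j ! i \<in> A" if "i < length ys" for i
        using that l nth_mem[of i "en (take l xs) j"] by (auto simp: ys_def K_def)
      then show ?thesis using k(2) by (auto simp: in_set_conv_nth)
    qed (simp add: ys_def)
    \<comment> \<open>The task prescribes distances to the first \<open>l\<close> points only. By
      the 4-values condition they are prolonged to all points placed so far with values in
      \<open>A\<close>.\<close>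
    then obtain k' where k': "\<forall>x\<in>set ys. k' x = k x" "k' ` (set ys \<union> set xs) \<subseteq> A"
      "katetov U (set ys \<union> set xs) k'"
      using katetov_extend[OF A, of "set ys" "set xs" U k] k(1) xs ys ysm
      unfolding P_def by blast
    have eq: "set ys \<union> set xs = set xs" using ys by blast
    have "k' ` set xs \<subseteq> {0..}" using k'(2) A(3) unfolding eq by blast
    then obtain z where z: "z \<in> mspace U" "\<And>x. x \<in> set xs \<Longrightarrow> mdist U z x = k' x"
      using extension_propertyD[OF U, of "set xs" k'] k'(3) xs unfolding eq P_def by blast
    have zA: "mdist U z x \<in> A" "mdist U x z \<in> A" if "x \<in> set xs" for x
      using z(2)[OF that] k'(2) that mdist_commute[of U x z] unfolding eq by auto
    have "task xs ?n z"
      unfolding task_def lj prod.case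
    proof (intro impI allI)
      fix i assume e: "en (take l xs) j \<in> K (take l xs)" and i: "i < l"
      have ys_eq: "ys = take l xs" using e by (simp add: ys_def)
      then have il: "i < length ys" "ys ! i = xs ! i" using i l by auto
      then have "mdist U z (xs ! i) = k (ys ! i)"
        using z(2)[of "ys ! i"] k'(1) ys by (metis nth_mem subsetD)
      then show "mdist U z (xs ! i) = en (take l xs) j ! i" using k(2)[OF il(1)] by simp
    qed
    then have "P (xs @ [z])"
      using xs z(1) zA A(2) by (auto simp: P_def nth_append less_Suc_eq)
    then show ?thesis by blast
  qed
  moreover have "P []" by (simp add: P_def)
  ultimately obtain x where x: "\<And>n. P (map x [0..<n])"
    using list_choice[of P] by blast
  have xm: "x i \<in> mspace U" for i
    using x[of "Suc i"] by (auto simp: P_def)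
  have xA: "mdist U (x i) (x j) \<in> A" for i j
    using x[of "Suc (max i j)"] unfolding P_def by (auto simp del: upt_Suc)
  have xtask: "task (map x [0..<n]) n (x n)" for n
  proof -
    have "task (take n (map x [0..<Suc n])) n (map x [0..<Suc n] ! n)"
      using x[of "Suc n"] unfolding P_def by (metis diff_zero length_map length_upt lessI)
    then show ?thesis by (simp add: take_map nth_append)
  qed
  have main: "\<exists>l. \<forall>i<n. \<bar>mdist U (x l) (x i) - k (x i)\<bar> < \<epsilon> \<and>
      (countable A \<longrightarrow> mdist U (x l) (x i) = k (x i))"
    if k: "k ` x ` {..<n} \<subseteq> A" "katetov U (x ` {..<n}) k" "\<epsilon> > 0" for n k \<epsilon>
  proof -
    define ys where "ys = map x [0..<n]"
    have ys: "length ys = n" "\<And>i. i < n \<Longrightarrow> ys ! i = x i" by (simp_all add: ys_def)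
    define ks where "ks = map (\<lambda>i. k (x i)) [0..<n]"
    have "ks \<in> K ys"
      using k(1,2) by (auto simp: K_def ys ks_def katetov_def)
    then obtain j where j: "en ys j \<in> K ys" "\<forall>i<n. \<bar>en ys j ! i - ks ! i\<bar> < \<epsilon>"
      "countable A \<longrightarrow> en ys j = ks" using en[OF _ k(3), of ks ys] ys(1) by auto
    define l where "l = prod_encode (n, j)"
    have nl: "n \<le> l" by (simp add: l_def le_prod_encode_1)
    have t: "take n (map x [0..<l]) = ys" using nl by (simp add: ys_def take_map)
    have "mdist U (x l) (x i) = en ys j ! i" if "i < n" for i
    proof -
      have dec: "prod_decode l = (n, j)" by (simp add: l_def)
      show ?thesis
        using xtask[of l] j(1) that nl unfolding task_def dec prod.case t by simp
    qed
    then show ?thesis using j by (intro exI[of _ l]) (auto simp: ks_def)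
  qed
  have "range x \<subseteq> mspace U" using xm by blast
  then show thesis by (rule that[OF _ xA main])
qed

section \<open>Distance sets with a gap above 0\<close>

lemma distance_setD:
  assumes "distance_set A"
  shows "0 \<in> A" "A \<subseteq> {0..}"
proof -
  obtain m :: "real metric" where m: "polish_metric m" "A = distances m"
    using assms by (auto simp: distance_set_def)
  then obtain x where "x \<in> mspace m" by (auto simp: polish_metric_def)
  then show "0 \<in> A" unfolding m(2) distances_def using mdist_self by fastforce
  show "A \<subseteq> {0..}" by (auto simp: m(2) distances_def)
qed

lemma distance_set_gap:
  assumes "distance_set A" "\<not> 0 islimpt A"
  obtains r where "r > 0" "\<And>a. a \<in> A \<Longrightarrow> a \<noteq> 0 \<Longrightarrow> r \<le> a"
proof -
  obtain r where r: "r > 0" "\<And>a. a \<in> A \<Longrightarrow> a \<noteq> 0 \<Longrightarrow> \<not> dist a 0 < r"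
    using assms(2) by (auto simp: islimpt_approachable)
  have "r \<le> a" if "a \<in> A" "a \<noteq> 0" for a
    using r(2)[OF that] distance_setD(2)[OF assms(1)] that by (auto simp: dist_real_def subset_iff)
  then show thesis using that r(1) by blast
qed

text \<open>With a gap \<open>r\<close> above 0, balls of radius \<open>r\<close> are single points,
  so a dense sequence exhausts the space.\<close>

lemma distance_set_countable:
  assumes "distance_set A" "\<not> 0 islimpt A"
  shows "countable A"
proof -
  obtain m :: "real metric" where m: "polish_metric m" "A = distances m"
    using assms(1) by (auto simp: distance_set_def)
  obtain r where r: "r > 0" "\<And>a. a \<in> A \<Longrightarrow> a \<noteq> 0 \<Longrightarrow> r \<le> a"
    using distance_set_gap[OF assms] by metis
  obtain y :: "nat \<Rightarrow> real" where y: "range y \<subseteq> mspace m"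
    "\<And>x \<epsilon>. x \<in> mspace m \<Longrightarrow> \<epsilon> > 0 \<Longrightarrow> \<exists>n. mdist m x (y n) < \<epsilon>"
    using polish_dense_sequence[OF m(1) order_refl] m(1) by (auto simp: polish_metric_def)
  have "x \<in> range y" if x: "x \<in> mspace m" for x
  proof -
    obtain n where n: "mdist m x (y n) < r" using y(2)[OF x r(1)] by blast
    have yn: "y n \<in> mspace m" using y(1) by blast
    have "mdist m x (y n) \<in> A" using x yn by (auto simp: m(2) distances_def)
    then have "mdist m x (y n) = 0" using n r(2) by force
    then show ?thesis using x yn by simp
  qed
  then have "mspace m \<subseteq> range y" by blast
  then have "countable (mspace m)" by (rule countable_subset) simp
  moreover have "A = (\<lambda>(x, y). mdist m x y) ` (mspace m \<times> mspace m)"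
    by (auto simp: m(2) distances_def)
  ultimately show ?thesis by simp
qed

text \<open>The sequence realises extensions of whole initial segments. A function given on
  \<open>F\<close> alone is first prolonged to an initial segment containing
  \<open>F\<close>.\<close>

lemma extension_property_discrete:
  assumes x: "range x \<subseteq> mspace U" "\<And>i j. mdist U (x i) (x j) \<in> A"
    and real: "\<And>n k. k ` x ` {..<n} \<subseteq> A \<Longrightarrow> katetov U (x ` {..<n}) k \<Longrightarrow>
      \<exists>l. \<forall>i<n. mdist U (x l) (x i) = k (x i)"
    and A: "four_values A" "0 \<in> A" "A \<subseteq> {0..}"
  shows "extension_property U (range (x :: nat \<Rightarrow> 'u)) A"
  unfolding extension_property_def
proof (intro allI impI)
  fix F and k :: "'u \<Rightarrow> real"
  assume F: "finite F" "F \<subseteq> range x" and k: "k ` F \<subseteq> A" "katetov U F k"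
  obtain I where I: "finite I" "F = x ` I" using finite_subset_image[OF F] by blast
  obtain n where n: "\<And>i. i \<in> I \<Longrightarrow> i < n"
    using I(1) unfolding finite_nat_set_iff_bounded by blast
  have sub: "F \<union> x ` {..<n} = x ` {..<n}" using I(2) n by auto
  have "\<exists>k'. (\<forall>u\<in>F. k' u = k u) \<and> k' ` (F \<union> x ` {..<n}) \<subseteq> A \<and> katetov U (F \<union> x ` {..<n}) k'"
    unfolding sub
    by (rule katetov_extend[OF A F(1) _ _ _ k, of "x ` {..<n}", unfolded sub]) (use x in auto)
  then obtain k' where k': "\<forall>u\<in>F. k' u = k u" "k' ` x ` {..<n} \<subseteq> A" "katetov U (x ` {..<n}) k'"
    unfolding sub by blast
  obtain l where l: "\<forall>i<n. mdist U (x l) (x i) = k' (x i)" using real[OF k'(2,3)] by blast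
  have "mdist U (x l) u = k u" if "u \<in> F" for u
    using l k'(1) that n I(2) by auto
  then show "\<exists>z\<in>range x. \<forall>u\<in>F. mdist U z u = k u" by blast
qed

lemma mclosure_discrete:
  assumes S: "S \<subseteq> mspace U" and r: "r > 0"
    "\<And>s t. s \<in> S \<Longrightarrow> t \<in> S \<Longrightarrow> mdist U s t < r \<Longrightarrow> s = t"
  shows "mclosure U S = S"
proof (intro equalityI mclosure_superset[OF S] subsetI)
  fix v assume v: "v \<in> mclosure U S"
  then have vm: "v \<in> mspace U" and near: "\<And>\<epsilon>. \<epsilon> > 0 \<Longrightarrow> \<exists>s\<in>S. mdist U v s < \<epsilon>"
    by (auto simp: mclosure_def)
  obtain s where s: "s \<in> S" "mdist U v s < r / 2" using near[of "r / 2"] r(1) by auto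
  have sm: "s \<in> mspace U" using s(1) S by blast
  have "mdist U v s < \<epsilon>" if e: "\<epsilon> > 0" for \<epsilon>
  proof -
    have "min \<epsilon> (r / 2) > 0" using e r(1) by simp
    then obtain t where t: "t \<in> S" "mdist U v t < min \<epsilon> (r / 2)"
      using near by blast
    have "t \<in> mspace U" using t(1) S by blast
    then have "mdist U s t \<le> mdist U v s + mdist U v t"
      using mdist_triangle[of s U v t] sm vm mdist_commute[of U s v] by simp
    then have "s = t" using r(2)[OF s(1) t(1)] s(2) t(2) by simp
    then show ?thesis using t(2) by simp
  qed
  then have "v = s" by (rule mdist_small_imp_eq[OF vm sm])
  then show "v \<in> S" using s(1) by simp
qed

lemma mclosure_V:
  assumes S: "S \<subseteq> mspace U" "S \<noteq> {}" and A: "closed A"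
    and d: "\<And>s t. s \<in> S \<Longrightarrow> t \<in> S \<Longrightarrow> mdist U s t \<in> A"
  shows "mclosure U S \<in> V U A"
  unfolding V_iff
proof (intro conjI mclosure_closed[OF S] ballI)
  fix u v assume u: "u \<in> mclosure U S" and v: "v \<in> mclosure U S"
  have "\<exists>a\<in>A. dist a (mdist U u v) < \<epsilon>" if e: "\<epsilon> > 0" for \<epsilon>
  proof -
    have e2: "\<epsilon> / 2 > 0" using e by simp
    obtain s where s: "s \<in> S" "mdist U u s < \<epsilon> / 2" using u e2 unfolding mclosure_def by blast
    obtain t where t: "t \<in> S" "mdist U v t < \<epsilon> / 2" using v e2 unfolding mclosure_def by blast
    have "\<bar>mdist U u v - mdist U s t\<bar> \<le> mdist U u s + mdist U v t"
      by (rule mdist_perturb) (use u v s t S in \<open>auto simp: mclosure_def\<close>)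
    then show ?thesis
      using s(2) t(2) d[OF s(1) t(1)] by (intro bexI[of _ "mdist U s t"]) (auto simp: dist_real_def)
  qed
  then show "mdist U u v \<in> A" using closed_approachable[OF A] by blast
qed

text \<open>An approximate realisation \<open>z\<^sub>n\<close> of \<open>k\<close> is improved by adding it to \<open>F\<close> as a point that must be
  at the small distance \<open>\<eta> n \<in> A\<close>; here \<open>0\<close> has to be a limit point of \<open>A\<close>.\<close>

lemma extension_property_from_approximate:
  fixes U :: "'u metric"
  assumes complete: "mcomplete_of U" and X: "X \<in> closed_subsets U"
    and A: "0 islimpt A" "A \<subseteq> {0..}"
    and approx: "\<And>F k \<epsilon>. finite F \<Longrightarrow> F \<subseteq> X \<Longrightarrow> k ` F \<subseteq> A \<Longrightarrow> katetov U F k \<Longrightarrow> \<epsilon> > 0 \<Longrightarrow>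
      \<exists>z\<in>X. \<forall>p\<in>F. \<bar>mdist U z p - k p\<bar> < \<epsilon>"
  shows "extension_property U X A"
  unfolding extension_property_def
proof (intro allI impI)
  fix F and k :: "'u \<Rightarrow> real"
  assume F: "finite F" "F \<subseteq> X" and k: "k ` F \<subseteq> A" "katetov U F k"
  have XU: "X \<subseteq> mspace U" by (rule closed_subsets_subset[OF X])
  have tr: "metric_triple (k x) (k y) (mdist U x y)" if "x \<in> F" "y \<in> F" for x y
    using k(2) that by (simp add: katetov_def)
  show "\<exists>z\<in>X. \<forall>p\<in>F. mdist U z p = k p"
  proof (cases "\<exists>p\<in>F. k p = 0")
    case True
    then obtain p where p: "p \<in> F" "k p = 0" by blast
    have "mdist U p x = k x" if "x \<in> F" for x
      using tr[OF p(1) that] p(2) by (simp add: metric_triple_def)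
    then show ?thesis using p(1) F(2) by blast
  next
    case False
    have kpos: "k p > 0" if "p \<in> F" for p
    proof -
      have "k p \<in> A" "k p \<noteq> 0" using False k(1) that by auto
      then show ?thesis using A(2) by force
    qed
    \<comment> \<open>A lower bound for \<open>k\<close>; the added 1 covers empty \<open>F\<close>.
      Keeping \<open>\<eta> n\<close> below it ensures that the approximant \<open>z\<close> is not
      in \<open>F\<close> and that \<open>\<eta> n \<le> k p\<close>, as the triangle inequalities
      for the enlarged function require.\<close>
    obtain \<mu> where \<mu>: "\<mu> > 0" "\<And>p. p \<in> F \<Longrightarrow> \<mu> \<le> k p"
    proof
      show "Min (insert 1 (k ` F)) > 0" using F(1) kpos by simp
      show "Min (insert 1 (k ` F)) \<le> k p" if "p \<in> F" for p using F(1) that by simp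
    qed
    have "\<exists>a. a \<in> A \<and> 0 < a \<and> a < \<mu> \<and> a < (1/2) ^ n" for n :: nat
    proof -
      have "0 < min \<mu> ((1/2) ^ n)" using \<mu>(1) by simp
      then obtain a where "a \<in> A" "a \<noteq> 0" "dist a 0 < min \<mu> ((1/2) ^ n)"
        using A(1) unfolding islimpt_approachable by blast
      moreover have "a \<ge> 0" using \<open>a \<in> A\<close> A(2) by auto
      ultimately show ?thesis by (intro exI[of _ a]) (auto simp: dist_real_def)
    qed
    then obtain \<eta> where \<eta>: "\<And>n::nat. \<eta> n \<in> A" "\<And>n. 0 < \<eta> n" "\<And>n. \<eta> n < \<mu>"
      "\<And>n. \<eta> n < (1/2) ^ n" by metis
    have "\<exists>z. \<forall>n. (z n \<in> X \<and> (\<forall>p\<in>F. \<bar>mdist U (z n) p - k p\<bar> \<le> \<eta> n)) \<and>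
        mdist U (z n) (z (Suc n)) \<le> 2 * \<eta> n"
    proof (rule dependent_nat_choice)
      show "\<exists>z. z \<in> X \<and> (\<forall>p\<in>F. \<bar>mdist U z p - k p\<bar> \<le> \<eta> 0)"
        using approx[OF F k \<eta>(2)[of 0]] by force
    next
      fix z n assume z: "z \<in> X \<and> (\<forall>p\<in>F. \<bar>mdist U z p - k p\<bar> \<le> \<eta> n)"
      have zm: "z \<in> mspace U" using z XU by blast
      have zF: "z \<notin> F"
        using z \<eta>(3)[of n] \<mu>(2)[of z] kpos[of z] zm by force
      define k' where "k' = k(z := \<eta> n)"
      have k': "k' z = \<eta> n" "\<And>p. p \<in> F \<Longrightarrow> k' p = k p" using zF by (auto simp: k'_def)
      have b: "mdist U z p \<le> k p + \<eta> n" "k p \<le> mdist U z p + \<eta> n" "\<eta> n \<le> k p" "\<eta> n > 0"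
        "mdist U p z = mdist U z p" if "p \<in> F" for p
        using z \<eta>(2,3)[of n] \<mu>(2)[OF that] that mdist_commute[of U p z] by (force simp: abs_le_iff)+
      have "metric_triple (k' u) (k' v) (mdist U u v)"
        if uv: "u \<in> insert z F" "v \<in> insert z F" for u v
      proof -
        consider "u = z" "v = z" | "u \<in> F" "v = z" | "u = z" "v \<in> F" | "u \<in> F" "v \<in> F"
          using uv by blast
        then show ?thesis
        proof cases
          case 1
          then show ?thesis using k'(1) \<eta>(2)[of n] zm by (simp add: metric_triple_def)
        next
          case 2
          then show ?thesis using b[of u] k'(1) k'(2)[of u] mdist_nonneg[of U z u]
            unfolding metric_triple_def by auto
        next
          case 3
          then show ?thesis using b[of v] k'(1) k'(2)[of v] mdist_nonneg[of U z v]
            unfolding metric_triple_def by auto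
        next
          case 4
          then show ?thesis using tr k' by simp
        qed
      qed
      then have "katetov U (insert z F) k'" by (simp add: katetov_def)
      moreover have "k' ` insert z F \<subseteq> A" using k' k(1) \<eta>(1) by auto
      \<comment> \<open>The bound \<open>\<eta> (Suc n)\<close> is the precision wanted at
        \<open>F\<close>; the bound \<open>\<eta> n\<close> keeps the move from \<open>z\<close>
        below \<open>2 * \<eta> n\<close>.\<close>
      moreover have "min (\<eta> n) (\<eta> (Suc n)) > 0" using \<eta>(2) by simp
      moreover have "finite (insert z F)" "insert z F \<subseteq> X" using F z by auto
      ultimately obtain w where w: "w \<in> X"
        "\<And>p. p \<in> insert z F \<Longrightarrow> \<bar>mdist U w p - k' p\<bar> < min (\<eta> n) (\<eta> (Suc n))"
        using approx by meson
      have "\<bar>mdist U w p - k p\<bar> \<le> \<eta> (Suc n)" if "p \<in> F" for p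
        using w(2)[of p] k'(2)[OF that] that by simp
      moreover have "mdist U z w \<le> 2 * \<eta> n"
        using less_le_trans[OF w(2)[of z, OF insertI1] min.cobounded1] k'(1)
          mdist_commute[of U w z] by linarith
      ultimately show "\<exists>w. (w \<in> X \<and> (\<forall>p\<in>F. \<bar>mdist U w p - k p\<bar> \<le> \<eta> (Suc n))) \<and>
          mdist U z w \<le> 2 * \<eta> n" using w(1) by blast
    qed
    then obtain z where z: "\<And>n. z n \<in> X" "\<And>n p. p \<in> F \<Longrightarrow> \<bar>mdist U (z n) p - k p\<bar> \<le> \<eta> n"
      "\<And>n. mdist U (z n) (z (Suc n)) \<le> 2 * \<eta> n" by blast
    have zm: "z n \<in> mspace U" for n using z(1) XU by blast
    have "mdist U (z n) (z (Suc n)) \<le> 2 * (1/2) ^ n" for n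
      using z(3)[of n] \<eta>(4)[of n] by simp
    moreover have "range z \<subseteq> mspace U" using zm by blast
    ultimately obtain l where l: "l \<in> mspace U" "\<And>n. mdist U (z n) l \<le> 2 * 2 * (1/2) ^ n"
      using geometric_limit[OF complete, of z 2] by blast
    have "l \<in> X"
    proof (rule closed_subsetsD[OF X l(1)])
      fix \<epsilon> :: real assume "\<epsilon> > 0"
      then obtain n where "2 * 2 * (1/2) ^ n < \<epsilon>" using half_power_small by blast
      then have "mdist U l (z n) < \<epsilon>" using l(2)[of n] mdist_commute[of U l "z n"] by simp
      then show "\<exists>s\<in>X. mdist U l s < \<epsilon>" using z(1) by blast
    qed
    moreover have "mdist U l p = k p" if p: "p \<in> F" for p
    proof (rule ccontr)
      have pm: "p \<in> mspace U" using p F(2) XU by blast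
      assume "mdist U l p \<noteq> k p"
      then have "\<bar>mdist U l p - k p\<bar> > 0" by simp
      \<comment> \<open>The factor 5 is 4 for the distance from \<open>z n\<close> to its limit and
        1 for the error \<open>\<eta> n\<close>.\<close>
      then obtain n where n: "5 * (1/2) ^ n < \<bar>mdist U l p - k p\<bar>" using half_power_small by blast
      have "\<bar>mdist U (z n) p - mdist U l p\<bar> \<le> mdist U (z n) l + mdist U p p"
        by (rule mdist_perturb) (use zm l pm in auto)
      then show False using n l(2)[of n] z(2)[OF p, of n] \<eta>(4)[of n] pm by simp
    qed
    ultimately show ?thesis by blast
  qed
qed

text \<open>Points of \<open>F\<close> may be proper limits of the sequence. They are replaced by
  nearby terms, after \<open>k\<close> has been prolonged to these terms so that the values there
  are close to those on \<open>F\<close>.\<close>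

lemma approximate_extension:
  fixes U :: "'u metric" and x :: "nat \<Rightarrow> 'u"
  assumes x: "range x \<subseteq> mspace U"
    and real: "\<And>n k \<epsilon>. k ` x ` {..<n} \<subseteq> A \<Longrightarrow> katetov U (x ` {..<n}) k \<Longrightarrow> \<epsilon> > 0 \<Longrightarrow>
      \<exists>l. \<forall>i<n. \<bar>mdist U (x l) (x i) - k (x i)\<bar> < \<epsilon>"
    and A: "four_values A" "0 \<in> A" "A \<subseteq> {0..}"
    and X: "X = mclosure U (range x)" "X \<in> V U A"
    and F: "finite F" "F \<subseteq> X" and k: "k ` F \<subseteq> A" "katetov U F k" and "\<epsilon> > 0"
  shows "\<exists>z\<in>X. \<forall>p\<in>F. \<bar>mdist U z p - k p\<bar> < \<epsilon>"
proof -
  have xX: "x i \<in> X" for i using mclosure_superset[OF x] X(1) by blast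
  have XU: "X \<subseteq> mspace U" using X(1) mclosure_subset_mspace[of U "range x"] by simp
  have XA: "mdist U u v \<in> A" if "u \<in> X" "v \<in> X" for u v using X(2) that by (simp add: V_iff)
  \<comment> \<open>Three errors add up: moving the point \<open>p\<close> to a term of the
    sequence, the change of \<open>k'\<close> along this move, and the realisation at that
    term.\<close>
  have e3: "\<epsilon> / 3 > 0" using \<open>\<epsilon> > 0\<close> by simp
  have "\<forall>p\<in>F. \<exists>i. mdist U p (x i) < \<epsilon> / 3"
    using F(2) X(1) e3 unfolding mclosure_def by fastforce
  then obtain i where i: "\<And>p. p \<in> F \<Longrightarrow> mdist U p (x (i p)) < \<epsilon> / 3" by metis
  have "finite (i ` F)" using F(1) by simp
  then obtain n where n: "\<And>p. p \<in> F \<Longrightarrow> i p < n"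
    unfolding finite_nat_set_iff_bounded by blast
  have "\<exists>k'. (\<forall>u\<in>F. k' u = k u) \<and> k' ` (F \<union> x ` {..<n}) \<subseteq> A \<and> katetov U (F \<union> x ` {..<n}) k'"
    by (rule katetov_extend[OF A F(1) _ _ _ k]) (use XA xX F XU in auto)
  then obtain k' where k': "\<forall>u\<in>F. k' u = k u" "k' ` (F \<union> x ` {..<n}) \<subseteq> A"
    "katetov U (F \<union> x ` {..<n}) k'" by blast
  have "k' ` x ` {..<n} \<subseteq> A" "katetov U (x ` {..<n}) k'"
    using k'(2,3) by (auto simp: katetov_def)
  then obtain l where l: "\<forall>i<n. \<bar>mdist U (x l) (x i) - k' (x i)\<bar> < \<epsilon> / 3"
    using real e3 by meson
  have "\<bar>mdist U (x l) p - k p\<bar> < \<epsilon>" if p: "p \<in> F" for p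
  proof -
    have pm: "p \<in> mspace U" and xm: "\<And>i. x i \<in> mspace U" using p F(2) XU xX by auto
    have "metric_triple (k' p) (k' (x (i p))) (mdist U p (x (i p)))"
      using k'(3) p n[OF p] by (auto simp: katetov_def)
    then have "\<bar>k p - k' (x (i p))\<bar> \<le> mdist U p (x (i p))"
      using k'(1) p by (auto simp: metric_triple_def)
    moreover have "\<bar>mdist U (x l) p - mdist U (x l) (x (i p))\<bar> \<le>
        mdist U (x l) (x l) + mdist U p (x (i p))"
      by (rule mdist_perturb) (use pm xm in auto)
    moreover have "mdist U (x l) (x l) = 0" using xm by simp
    moreover have "\<bar>mdist U (x l) (x (i p)) - k' (x (i p))\<bar> < \<epsilon> / 3" using l n[OF p] by blast
    ultimately show ?thesis using i[OF p] by linarith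
  qed
  then show ?thesis using xX by blast
qed

lemma urysohn_for_exists:
  fixes U :: "'u metric"
  assumes U: "urysohn_space U" and A: "distance_set A" "four_values A"
    and "closed A \<or> \<not> 0 islimpt A"
  shows "\<exists>X\<in>V U A. urysohn_for U A X"
proof -
  have polish: "polish_metric U" using U by (simp add: urysohn_space_def)
  then have complete: "mcomplete_of U" by (simp add: polish_metric_def)
  note A0 = distance_setD[OF A(1)]
  obtain x :: "nat \<Rightarrow> 'u" where x: "range x \<subseteq> mspace U" "\<And>i j. mdist U (x i) (x j) \<in> A"
    and real: "\<And>n k \<epsilon>. k ` x ` {..<n} \<subseteq> A \<Longrightarrow> katetov U (x ` {..<n}) k \<Longrightarrow> \<epsilon> > 0 \<Longrightarrow>
      \<exists>l. \<forall>i<n. \<bar>mdist U (x l) (x i) - k (x i)\<bar> < \<epsilon> \<and>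
        (countable A \<longrightarrow> mdist U (x l) (x i) = k (x i))"
    using urysohn_sequence[OF urysohn_extension_property[OF U] A(2) A0] by metis
  have "\<exists>X\<in>V U A. extension_property U X A"
  proof (cases "0 islimpt A")
    case False
    obtain r where r: "r > 0" "\<And>a. a \<in> A \<Longrightarrow> a \<noteq> 0 \<Longrightarrow> r \<le> a"
      using distance_set_gap[OF A(1) False] by metis
    have "mclosure U (range x) = range x"
    proof (rule mclosure_discrete[OF x(1) r(1)])
      fix s t assume st: "s \<in> range x" "t \<in> range x" "mdist U s t < r"
      then have "mdist U s t \<in> A" using x(2) by auto
      then have "mdist U s t = 0" using r(2) st(3) by force
      moreover have "s \<in> mspace U" "t \<in> mspace U" using st x(1) by auto
      ultimately show "s = t" by simp
    qed
    then have "range x \<in> V U A"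
      using mclosure_closed[OF x(1)] x(2) by (auto simp: V_iff)
    moreover have "extension_property U (range x) A"
    proof (rule extension_property_discrete[OF x _ A(2) A0])
      fix n k assume "k ` x ` {..<n} \<subseteq> A" "katetov U (x ` {..<n}) k"
      \<comment> \<open>Any tolerance would do: \<open>A\<close> is countable here, so the
        realisation is exact.\<close>
      from real[OF this, of 1] show "\<exists>l. \<forall>i<n. mdist U (x l) (x i) = k (x i)"
        using distance_set_countable[OF A(1) False] by auto
    qed
    ultimately show ?thesis by blast
  next
    case True
    then have "closed A" using assms(4) by blast
    define X where "X = mclosure U (range x)"
    have XV: "X \<in> V U A"
      unfolding X_def by (rule mclosure_V[OF x(1) _ \<open>closed A\<close>]) (use x(2) in auto)
    have "extension_property U X A"
    proof (rule extension_property_from_approximate[OF complete _ True A0(2)])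
      show "X \<in> closed_subsets U" using XV by (simp add: V_iff)
      show "\<exists>z\<in>X. \<forall>p\<in>F. \<bar>mdist U z p - k p\<bar> < \<epsilon>"
        if "finite F" "F \<subseteq> X" "k ` F \<subseteq> A" "katetov U F k" "\<epsilon> > 0" for F k \<epsilon>
      proof (rule approximate_extension[OF x(1) _ A(2) A0 X_def XV that])
        fix n k and \<epsilon> :: real
        assume "k ` x ` {..<n} \<subseteq> A" "katetov U (x ` {..<n}) k" "\<epsilon> > 0"
        from real[OF this] show "\<exists>l. \<forall>i<n. \<bar>mdist U (x l) (x i) - k (x i)\<bar> < \<epsilon>" by blast
      qed
    qed
    then show ?thesis using XV by blast
  qed
  then show ?thesis using extension_property_imp_urysohn_for[OF polish] by blast
qed

subsection \<open>Necessity of the 4-values condition\<close>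

text \<open>The triangle is first drawn in \<open>U\<close>, where all nonnegative distances are
  available. Its three points form a member of \<open>V U A\<close>, which universality moves into
  \<open>X\<close>.\<close>

lemma urysohn_triangle:
  fixes U :: "'u metric"
  assumes U: "urysohn_space U" and univ: "polish_universal U A X"
    and A: "0 \<in> A" "A \<subseteq> {0..}" and abx: "a \<in> A" "b \<in> A" "x \<in> A" "metric_triple a b x"
  obtains p0 p1 p2 where "p0 \<in> X" "p1 \<in> X" "p2 \<in> X"
    "mdist U p0 p1 = a" "mdist U p0 p2 = b" "mdist U p1 p2 = x"
proof -
  note EP = urysohn_extension_property[OF U]
  obtain u1 where u1: "u1 \<in> mspace U"
    using U by (auto simp: urysohn_space_def polish_metric_def)
  have pos: "a \<ge> 0" "b \<ge> 0" "x \<ge> 0" using abx A(2) by auto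
  obtain u2 where u2: "u2 \<in> mspace U" "mdist U u2 u1 = x"
    using extension_propertyD[OF EP, of "{u1}" "\<lambda>_. x"] u1 pos
    by (auto simp: katetov_def metric_triple_def)
  then have d12: "mdist U u1 u2 = x" using mdist_commute by metis
  define k where "k i = (if i = (0::nat) then a else b)" for i
  have tr: "metric_triple (k i) (k j) (mdist U ([u1, u2] ! i) ([u1, u2] ! j))"
    if "i < length [u1, u2]" "j < length [u1, u2]" for i j
  proof -
    have "i = 0 \<or> i = 1" "j = 0 \<or> j = 1" using that by auto
    then show ?thesis using abx(4) u1 u2 d12 pos by (auto simp: k_def metric_triple_def)
  qed
  have kA: "k i \<in> {0..}" if "i < length [u1, u2]" for i using pos by (simp add: k_def)
  have u12: "set [u1, u2] \<subseteq> mspace U" using u1 u2 by simp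
  obtain u0 where u0: "u0 \<in> mspace U"
    "\<And>i. i < length [u1, u2] \<Longrightarrow> mdist U u0 ([u1, u2] ! i) = k i"
    by (rule extension_property_list[OF EP order_refl u12 kA tr], assumption+, rule that)
  have d: "mdist U u0 u1 = a" "mdist U u0 u2 = b" using u0(2)[of 0] u0(2)[of 1] by (auto simp: k_def)
  define Y where "Y = {u0, u1, u2}"
  have YU: "Y \<subseteq> mspace U" using u0 u1 u2 by (simp add: Y_def)
  have "closedin (mtopology_of U) Y"
  proof -
    interpret Metric_space "mspace U" "mdist U" by simp
    show ?thesis unfolding mtopology_of_def
      using YU by (intro closedin_Hausdorff_finite Hausdorff_space_mtopology) (auto simp: Y_def)
  qed
  then have Yc: "Y \<in> closed_subsets U" by (simp add: closed_subsets_def Y_def)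
  moreover have "mdist U s t \<in> A" if "s \<in> Y" "t \<in> Y" for s t
    using that abx A(1) d d12 u2 u0(1) u1 mdist_commute[of U u1 u0] mdist_commute[of U u2 u0]
    by (auto simp: Y_def)
  ultimately have "Y \<in> V U A" by (simp add: V_iff)
  then obtain e where e: "isometric_embedding (submetric U Y) (submetric U X) e"
    using univ by (auto simp: polish_universal_def isometrically_embeds_def)
  have XU: "X \<in> closed_subsets U" using univ by (simp add: polish_universal_def V_iff)
  have "e s \<in> X" "mdist U (e s) (e t) = mdist U s t" if "s \<in> Y" "t \<in> Y" for s t
    using e that submetric_closed_mspace[OF XU] submetric_closed_mspace[OF Yc]
    by (auto simp: isometric_embedding_def simp del: mspace_submetric)
  then show thesis using that[of "e u0" "e u1" "e u2"] d d12 by (auto simp: Y_def)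
qed

lemma urysohn_for_imp_four_values:
  fixes U :: "'u metric"
  assumes U: "urysohn_space U" and A: "distance_set A" and X: "urysohn_for U A X"
  shows "four_values A"
  unfolding four_values_def
proof (intro ballI impI, elim conjE)
  fix a b c d x
  assume m: "a \<in> A" "b \<in> A" "c \<in> A" "d \<in> A" "x \<in> A" "metric_triple a b x" "metric_triple c d x"
  note A0 = distance_setD[OF A]
  have univ: "polish_universal U A X" and uh: "ultrahomogeneous (submetric U X)"
    using X by (auto simp: urysohn_for_def)
  have XV: "X \<in> V U A" using univ by (simp add: polish_universal_def)
  have Xm: "mspace (submetric U X) = X"
    using XV submetric_closed_mspace by (auto simp: V_iff)
  obtain p0 p1 p2 where p: "p0 \<in> X" "p1 \<in> X" "p2 \<in> X"
    "mdist U p0 p1 = a" "mdist U p0 p2 = b" "mdist U p1 p2 = x"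
    by (rule urysohn_triangle[OF U univ A0 m(1,2,5,6)])
  \<comment> \<open>The swap puts \<open>d\<close> and \<open>a\<close> at the same end of the
    common side and \<open>c\<close> and \<open>b\<close> at the other.\<close>
  have "metric_triple d c x" using m(7) by (auto simp: metric_triple_def)
  then obtain q0 q1 q2 where q: "q0 \<in> X" "q1 \<in> X" "q2 \<in> X"
    "mdist U q0 q1 = d" "mdist U q0 q2 = c" "mdist U q1 q2 = x"
    by (rule urysohn_triangle[OF U univ A0 m(4,3,5)])
  have XU: "X \<subseteq> mspace U" using XV closed_subsets_subset by (auto simp: V_iff)
  then have pq: "p0 \<in> mspace U" "p1 \<in> mspace U" "p2 \<in> mspace U" "q1 \<in> mspace U" "q2 \<in> mspace U"
    using p q by auto
  define f where "f u = (if u = q1 then p1 else p2)" for u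
  \<comment> \<open>If \<open>x = 0\<close>, then \<open>q1 = q2\<close>, but also
    \<open>p1 = p2\<close>, so the second equation remains true.\<close>
  have f: "f q1 = p1" "f q2 = p2" using p(6) q(6) pq by (auto simp: f_def)
  have "mdist U p2 p1 = mdist U q2 q1" using p(6) q(6) mdist_commute by metis
  then have "isometry_onto (submetric (submetric U X) {q1, q2}) (submetric (submetric U X) {p1, p2}) f"
    using f p q pq XU by (auto simp: isometry_onto_def isometric_embedding_def)
  then obtain g where g: "isometry_onto (submetric U X) (submetric U X) g" "g q1 = p1" "g q2 = p2"
    using uh p q f unfolding ultrahomogeneous_def Xm
    by (metis (no_types, lifting) empty_subsetI finite.emptyI finite_insert insert_iff insert_subset)
  have gX: "g u \<in> X" "mdist U (g u) (g v) = mdist U u v" if "u \<in> X" "v \<in> X" for u v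
    using g(1) that Xm by (auto simp: isometry_onto_def isometric_embedding_def simp del: mspace_submetric)
  define y where "y = mdist U p0 (g q0)"
  have y: "y \<in> A" using XV p(1) gX(1)[OF q(1,1)] by (simp add: V_iff y_def)
  have gm: "g q0 \<in> mspace U" using gX(1)[OF q(1,1)] XU by blast
  have "mdist U (g q0) p2 = c" "mdist U (g q0) p1 = d"
    using gX(2)[OF q(1,3)] gX(2)[OF q(1,2)] g q by auto
  then have "mdist U p2 (g q0) = c" "mdist U p1 (g q0) = d" using mdist_commute by metis+
  moreover have "mdist U p2 p0 = b" "mdist U p1 p0 = a" using p mdist_commute by metis+
  ultimately have "metric_triple b c y" "metric_triple a d y"
    using mdist_triple[OF pq(1) gm pq(3)] mdist_triple[OF pq(1) gm pq(2)] by (simp_all add: y_def)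
  then show "\<exists>y\<in>A. metric_triple b c y \<and> metric_triple a d y" using y by blast
qed

subsection \<open>The Borel case\<close>

lemma space_effros [simp]: "space (effros U) = closed_subsets U"
  unfolding effros_def by (rule space_measure_of) auto

lemma sets_effros:
  "sets (effros U) = sigma_sets (closed_subsets U)
     {{X \<in> closed_subsets U. X \<inter> W \<noteq> {}} | W. openin (mtopology_of U) W}"
  unfolding effros_def by (rule sets_measure_of) auto

lemma hit_in_sets_effros:
  assumes "openin (mtopology_of U) W"
  shows "{X \<in> closed_subsets U. X \<inter> W \<noteq> {}} \<in> sets (effros U)"
  unfolding sets_effros using assms by blast

lemma pred_hit:
  assumes "openin (mtopology_of U) W"
  shows "Measurable.pred (effros U) (\<lambda>X. X \<inter> W \<noteq> {})"
  using hit_in_sets_effros[OF assms] by (simp add: pred_def)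

text \<open>A distance outside a closed set stays outside under small perturbations. Hence a bad
  pair of points is witnessed by two balls around points of the dense sequence all of whose mutual
  distances are bad, and only countably many such pairs of balls have to be avoided.\<close>

lemma V_closed_in_sets_effros:
  assumes "polish_metric U" "closed A"
  shows "V U A \<in> sets (effros U)"
proof -
  obtain q :: "nat \<Rightarrow> _" where q: "range q \<subseteq> mspace U"
    "\<And>x \<epsilon>. x \<in> mspace U \<Longrightarrow> \<epsilon> > 0 \<Longrightarrow> \<exists>n. mdist U x (q n) < \<epsilon>"
    using polish_dense_sequence[OF assms(1) order_refl] assms(1)
    unfolding polish_metric_def by metis
  have qm: "q n \<in> mspace U" for n using q(1) by blast
  define B where "B i k = {y \<in> mspace U. mdist U (q i) y < 1 / real (Suc k)}" for i k
  have hit [measurable]: "Measurable.pred (effros U) (\<lambda>X. X \<inter> B i k \<noteq> {})" for i k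
    unfolding B_def by (rule pred_hit[OF openin_mball_of[OF qm]])
  define G where "G i j k \<longleftrightarrow> (\<forall>u\<in>B i k. \<forall>v\<in>B j k. mdist U u v \<notin> A)" for i j k
  have "V U A = {X \<in> space (effros U). \<forall>i j k. G i j k \<longrightarrow> \<not> (X \<inter> B i k \<noteq> {} \<and> X \<inter> B j k \<noteq> {})}"
  proof (intro equalityI subsetI)
    fix X assume "X \<in> V U A"
    then show "X \<in> {X \<in> space (effros U). \<forall>i j k. G i j k \<longrightarrow> \<not> (X \<inter> B i k \<noteq> {} \<and> X \<inter> B j k \<noteq> {})}"
      unfolding V_iff G_def by auto
  next
    fix X assume X: "X \<in> {X \<in> space (effros U). \<forall>i j k. G i j k \<longrightarrow> \<not> (X \<inter> B i k \<noteq> {} \<and> X \<inter> B j k \<noteq> {})}"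
    then have Xc: "X \<in> closed_subsets U" by simp
    have "mdist U u v \<in> A" if uv: "u \<in> X" "v \<in> X" for u v
    proof (rule ccontr)
      assume nA: "mdist U u v \<notin> A"
      have um: "u \<in> mspace U" "v \<in> mspace U" using uv closed_subsets_subset[OF Xc] by auto
      obtain \<epsilon> where \<epsilon>: "\<epsilon> > 0" "\<And>a. a \<in> A \<Longrightarrow> \<epsilon> \<le> dist a (mdist U u v)"
        using closed_approachable[OF assms(2)] nA by (meson not_less)
      \<comment> \<open>Two points of one ball of radius below \<open>\<epsilon> / 4\<close> are
        less than \<open>\<epsilon> / 2\<close> apart, and a distance depends on two points.\<close>
      have "\<epsilon> / 4 > 0" using \<epsilon>(1) by simp
      then obtain k where "inverse (real (Suc k)) < \<epsilon> / 4" using reals_Archimedean by blast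
      then have k: "1 / real (Suc k) < \<epsilon> / 4" by (simp only: inverse_eq_divide)
      have k0: "1 / real (Suc k) > 0" by simp
      obtain i where "mdist U u (q i) < 1 / real (Suc k)" using q(2)[OF um(1) k0] by blast
      moreover obtain j where "mdist U v (q j) < 1 / real (Suc k)" using q(2)[OF um(2) k0] by blast
      ultimately have uB: "u \<in> B i k" "v \<in> B j k"
        using um mdist_commute[of U u "q i"] mdist_commute[of U v "q j"] by (auto simp: B_def)
      have "mdist U u' v' \<notin> A" if "u' \<in> B i k" "v' \<in> B j k" for u' v'
      proof
        assume a: "mdist U u' v' \<in> A"
        have m': "u' \<in> mspace U" "v' \<in> mspace U" using that by (auto simp: B_def)
        have "mdist U u' u < \<epsilon> / 2" "mdist U v' v < \<epsilon> / 2"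
          using mdist_triangle[OF m'(1) qm[of i] um(1)] mdist_triangle[OF m'(2) qm[of j] um(2)]
            that uB k mdist_commute[of U u' "q i"] mdist_commute[of U v' "q j"]
          by (auto simp: B_def)
        moreover have "\<bar>mdist U u' v' - mdist U u v\<bar> \<le> mdist U u' u + mdist U v' v"
          by (rule mdist_perturb) (use m' um in auto)
        ultimately show False using \<epsilon>(2)[OF a] by (simp add: dist_real_def)
      qed
      then have "G i j k" by (simp add: G_def)
      then show False using X uB uv by blast
    qed
    then show "X \<in> V U A" using Xc by (simp add: V_iff)
  qed
  also have "\<dots> \<in> sets (effros U)" by measurable
  finally show ?thesis .
qed

text \<open>The closed case secures that distinct points of \<open>X\<close> are at least
  \<open>r\<close> apart. A ball of radius \<open>r / 2\<close> then isolates at most one point of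
  \<open>X\<close>, and the distance between two isolated points can be compared with each of the
  countably many elements of \<open>A\<close>.\<close>

lemma V_discrete_in_sets_effros:
  assumes "polish_metric U" "countable A" "r > 0" "A \<subseteq> {0} \<union> {r..}"
  shows "V U A \<in> sets (effros U)"
proof -
  obtain q :: "nat \<Rightarrow> _" where q: "range q \<subseteq> mspace U"
    "\<And>x \<epsilon>. x \<in> mspace U \<Longrightarrow> \<epsilon> > 0 \<Longrightarrow> \<exists>n. mdist U x (q n) < \<epsilon>"
    using polish_dense_sequence[OF assms(1) order_refl] assms(1)
    unfolding polish_metric_def by metis
  have qm: "q n \<in> mspace U" for n using q(1) by blast
  define B where "B i = {y \<in> mspace U. mdist U (q i) y < r / 2}" for i
  define b where "b i k = {y \<in> mspace U. mdist U (q i) y < 1 / real (Suc k)}" for i k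
  have Bo: "openin (mtopology_of U) (B i)" "openin (mtopology_of U) (b i k)" for i k
    unfolding B_def b_def by (rule openin_mball_of[OF qm])+
  have hit [measurable]: "Measurable.pred (effros U) (\<lambda>X. X \<inter> B i \<noteq> {})"
    "Measurable.pred (effros U) (\<lambda>X. X \<inter> (B i \<inter> b j k) \<noteq> {})" for i j k
    by (intro pred_hit openin_Int Bo)+
  have VB [measurable]: "V U ({0} \<union> {r..}) \<in> sets (effros U)"
    by (rule V_closed_in_sets_effros[OF assms(1)]) auto
  \<comment> \<open>Hitting \<open>B i \<inter> b i' k\<close> locates the one point of
    \<open>X\<close> in \<open>B i\<close> up to \<open>1 / Suc k\<close>. The value
    \<open>a\<close> stands outside the quantifier over \<open>k\<close>, so the distance equals
    \<open>a\<close> and is not merely close to \<open>A\<close>.\<close>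
  define Q where "Q X i j \<longleftrightarrow> (\<exists>a\<in>A. \<forall>k. \<exists>i' j'. \<bar>mdist U (q i') (q j') - a\<bar> < 1 / Suc k \<and>
      X \<inter> (B i \<inter> b i' k) \<noteq> {} \<and> X \<inter> (B j \<inter> b j' k) \<noteq> {})" for X i j
  have Qm [measurable]: "Measurable.pred (effros U) (\<lambda>X. Q X i j)" for i j
    unfolding Q_def using assms(2) by measurable
  have "V U A = {X \<in> space (effros U). X \<in> V U ({0} \<union> {r..}) \<and>
      (\<forall>i j. X \<inter> B i \<noteq> {} \<and> X \<inter> B j \<noteq> {} \<longrightarrow> Q X i j)}" (is "_ = ?R")
  proof (intro equalityI subsetI)
    fix X assume X: "X \<in> V U A"
    then have Xc: "X \<in> closed_subsets U" and XA: "\<And>u v. u \<in> X \<Longrightarrow> v \<in> X \<Longrightarrow> mdist U u v \<in> A"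
      by (auto simp: V_iff)
    have "Q X i j" if ij: "X \<inter> B i \<noteq> {}" "X \<inter> B j \<noteq> {}" for i j
    proof -
      obtain u v where uv: "u \<in> X" "u \<in> B i" "v \<in> X" "v \<in> B j" using ij by blast
      have um: "u \<in> mspace U" "v \<in> mspace U" using uv by (auto simp: B_def)
      have "\<exists>i' j'. \<bar>mdist U (q i') (q j') - mdist U u v\<bar> < 1 / Suc k \<and>
        X \<inter> (B i \<inter> b i' k) \<noteq> {} \<and> X \<inter> (B j \<inter> b j' k) \<noteq> {}" for k
      proof -
        obtain h where k0: "h > 0" and half: "1 / real (Suc k) = h + h"
          by (rule that[of "1 / real (Suc k) / 2"]) (simp_all only: field_sum_of_halves, simp)
        obtain i' where i': "mdist U u (q i') < h" using q(2)[OF um(1) k0] by blast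
        obtain j' where j': "mdist U v (q j') < h" using q(2)[OF um(2) k0] by blast
        have "\<bar>mdist U (q i') (q j') - mdist U u v\<bar> \<le> mdist U (q i') u + mdist U (q j') v"
          by (rule mdist_perturb) (use qm um in auto)
        then have "\<bar>mdist U (q i') (q j') - mdist U u v\<bar> < 1 / Suc k"
          using i' j' half mdist_commute[of U u "q i'"] mdist_commute[of U v "q j'"] by linarith
        moreover have "u \<in> b i' k" "v \<in> b j' k"
          using i' j' half um mdist_commute[of U u "q i'"] mdist_commute[of U v "q j'"] k0
          unfolding b_def mem_Collect_eq half by auto
        ultimately show ?thesis using uv by blast
      qed
      then show ?thesis using XA[OF uv(1,3)] unfolding Q_def by blast
    qed
    moreover have "X \<in> V U ({0} \<union> {r..})" using Xc XA assms(4) by (auto simp: V_iff)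
    ultimately show "X \<in> ?R" using Xc by simp
  next
    fix X assume X: "X \<in> ?R"
    then have Xc: "X \<in> closed_subsets U" and XB: "\<And>u v. u \<in> X \<Longrightarrow> v \<in> X \<Longrightarrow> mdist U u v \<in> {0} \<union> {r..}"
      by (auto simp: V_iff)
    have XU: "X \<subseteq> mspace U" using closed_subsets_subset[OF Xc] .
    have uniq: "u = u'" if "u \<in> X" "u' \<in> X" "u \<in> B i" "u' \<in> B i" for u u' i
    proof -
      have m: "u \<in> mspace U" "u' \<in> mspace U" using that XU by auto
      have "mdist U u u' < r"
        using mdist_triangle[OF m(1) qm[of i] m(2)] that(3,4) mdist_commute[of U u "q i"]
        by (simp add: B_def)
      then have "mdist U u u' = 0" using XB[OF that(1,2)] by auto
      then show ?thesis using m by simp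
    qed
    have "mdist U u v \<in> A" if uv: "u \<in> X" "v \<in> X" for u v
    proof -
      have um: "u \<in> mspace U" "v \<in> mspace U" using uv XU by auto
      have r2: "r / 2 > 0" using assms(3) by simp
      obtain i where i: "mdist U u (q i) < r / 2" using q(2)[OF um(1) r2] by blast
      obtain j where j: "mdist U v (q j) < r / 2" using q(2)[OF um(2) r2] by blast
      have uB: "u \<in> B i" "v \<in> B j"
        using um i j mdist_commute[of U u "q i"] mdist_commute[of U v "q j"] by (auto simp: B_def)
      then have "Q X i j" using X uv by blast
      then obtain a where a: "a \<in> A" and near: "\<And>k. \<exists>i' j'. \<bar>mdist U (q i') (q j') - a\<bar> < 1 / Suc k \<and>
        X \<inter> (B i \<inter> b i' k) \<noteq> {} \<and> X \<inter> (B j \<inter> b j' k) \<noteq> {}"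
        unfolding Q_def by blast
      have "mdist U u v = a"
      proof (rule ccontr)
        assume "mdist U u v \<noteq> a"
        \<comment> \<open>A third: both points are off by less than \<open>1 / Suc k\<close>, and so
          is the distance between the two centres when compared with \<open>a\<close>.\<close>
        then have "\<bar>mdist U u v - a\<bar> / 3 > 0" by simp
        then obtain k where "inverse (real (Suc k)) < \<bar>mdist U u v - a\<bar> / 3"
          using reals_Archimedean by blast
        then have k: "1 / real (Suc k) < \<bar>mdist U u v - a\<bar> / 3" by (simp only: inverse_eq_divide)
        obtain i' j' where ij: "\<bar>mdist U (q i') (q j') - a\<bar> < 1 / Suc k"
          "X \<inter> (B i \<inter> b i' k) \<noteq> {}" "X \<inter> (B j \<inter> b j' k) \<noteq> {}" using near by blast
        have "u \<in> b i' k" "v \<in> b j' k"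
          using ij(2,3) uniq uB uv by blast+
        moreover have "\<bar>mdist U (q i') (q j') - mdist U u v\<bar> \<le> mdist U (q i') u + mdist U (q j') v"
          by (rule mdist_perturb) (use qm um in auto)
        moreover have "\<bar>mdist U u v - a\<bar> \<le> \<bar>mdist U (q i') (q j') - mdist U u v\<bar> +
            \<bar>mdist U (q i') (q j') - a\<bar>" by linarith
        ultimately show False using ij(1) k unfolding b_def mem_Collect_eq by argo
      qed
      then show ?thesis using a by simp
    qed
    then show "X \<in> V U A" using Xc by (simp add: V_iff)
  qed
  also have "\<dots> \<in> sets (effros U)" by measurable
  finally show ?thesis .
qed

lemma V_in_sets_effros:
  assumes "polish_metric U" "distance_set A" "closed A \<or> \<not> 0 islimpt A"
  shows "V U A \<in> sets (effros U)"
proof (cases "closed A")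
  case True
  then show ?thesis by (rule V_closed_in_sets_effros[OF assms(1)])
next
  case False
  then have lim: "\<not> 0 islimpt A" using assms(3) by blast
  obtain r where r: "r > 0" "\<And>a. a \<in> A \<Longrightarrow> a \<noteq> 0 \<Longrightarrow> r \<le> a"
    using distance_set_gap[OF assms(2) lim] by metis
  then show ?thesis
    by (intro V_discrete_in_sets_effros[OF assms(1) distance_set_countable[OF assms(2) lim]]) auto
qed

subsection \<open>Suslin subsets of the Baire space\<close>

text \<open>Projections of closed sets of pairs: a pair is in a closed set as soon as all its finite
  initial segments can be matched in it. The self-referential tree is built from such finite
  tests.\<close>

definition suslin :: "(nat \<Rightarrow> nat) set \<Rightarrow> bool" where
  "suslin S \<longleftrightarrow> (\<exists>C. closed C \<and> S = fst ` (C :: ((nat \<Rightarrow> nat) \<times> (nat \<Rightarrow> nat)) set))"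

abbreviation baire :: "(nat \<Rightarrow> nat) measure" where
  "baire \<equiv> \<Pi>\<^sub>M i\<in>UNIV. count_space UNIV"

lemma space_baire: "space baire = UNIV"
  by (simp add: space_PiM)

lemma continuous_on_discrete_pair:
  fixes f g :: "'a::topological_space \<Rightarrow> nat" and h :: "nat \<Rightarrow> nat \<Rightarrow> nat"
  assumes "continuous_on UNIV f" "continuous_on UNIV g"
  shows "continuous_on UNIV (\<lambda>p. h (f p) (g p))"
proof -
  have "open ((\<lambda>p. h (f p) (g p)) -` B)" for B :: "nat set"
  proof -
    have "(\<lambda>p. h (f p) (g p)) -` B = (\<Union>(a, b)\<in>{(a, b). h a b \<in> B}. f -` {a} \<inter> g -` {b})"
      by auto
    moreover have "open (f -` {a})" "open (g -` {b})" for a b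
      using assms by (auto intro!: open_vimage open_discrete)
    ultimately show ?thesis by (auto intro!: open_UN open_Int)
  qed
  then show ?thesis by (simp add: continuous_on_open_vimage)
qed

lemma closed_nat: "closed (A :: nat set)"
  by (simp add: closed_def open_discrete)

lemma continuous_on_coordinate:
  "continuous_on UNIV f \<Longrightarrow> continuous_on UNIV (\<lambda>p. f p (i :: nat) :: nat)"
  by (rule continuous_on_product_then_coordinatewise)

lemma suslin_closed:
  assumes "closed S"
  shows "suslin S"
  unfolding suslin_def
  by (intro exI[of _ "S \<times> UNIV"] conjI closed_Times assms closed_UNIV) auto

lemma suslin_UN:
  assumes "\<And>k :: nat. suslin (S k)"
  shows "suslin (\<Union>k. S k)"
proof -
  have "\<forall>k. \<exists>C :: ((nat \<Rightarrow> nat) \<times> (nat \<Rightarrow> nat)) set. closed C \<and> S k = fst ` C"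
    using assms by (simp add: suslin_def)
  from choice[OF this] obtain C :: "nat \<Rightarrow> ((nat \<Rightarrow> nat) \<times> (nat \<Rightarrow> nat)) set"
    where "\<forall>k. closed (C k) \<and> S k = fst ` C k" ..
  then have C: "closed (C k)" "S k = fst ` C k" for k by simp_all
  \<comment> \<open>The first entry of the witness selects \<open>k\<close>, the remaining ones
    witness membership in \<open>S k\<close>.\<close>
  define D where "D = {p. (fst p, \<lambda>i. snd p (Suc i)) \<in> C (snd p 0)}"
  have cont: "continuous_on UNIV (\<lambda>p :: (nat \<Rightarrow> nat) \<times> (nat \<Rightarrow> nat). (fst p, \<lambda>i. snd p (Suc i)))"
    by (intro continuous_intros continuous_on_coordinatewise_then_product continuous_on_coordinate)
  have "D = (\<Inter>k. {p. snd p 0 \<noteq> k} \<union> (\<lambda>p. (fst p, \<lambda>i. snd p (Suc i))) -` C k)"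
    by (auto simp: D_def)
  moreover have "closed {p :: (nat \<Rightarrow> nat) \<times> (nat \<Rightarrow> nat). snd p 0 \<noteq> k}" for k
  proof -
    have "{p :: (nat \<Rightarrow> nat) \<times> (nat \<Rightarrow> nat). snd p 0 \<noteq> k} = (\<lambda>p. snd p 0) -` (- {k})" by auto
    then show ?thesis
      by (simp only:) (intro closed_vimage closed_nat continuous_on_coordinate continuous_intros)
  qed
  ultimately have "closed D"
    using C(1) cont by (auto intro!: closed_INT closed_Un closed_vimage)
  moreover have "(\<Union>k. S k) = fst ` D"
  proof (intro equalityI subsetI)
    fix x assume "x \<in> (\<Union>k. S k)"
    then obtain k y where "(x, y) \<in> C k" using C(2) by force
    then have "(x, \<lambda>i. case i of 0 \<Rightarrow> k | Suc j \<Rightarrow> y j) \<in> D" by (simp add: D_def)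
    then show "x \<in> fst ` D" by force
  next
    fix x assume "x \<in> fst ` D"
    then show "x \<in> (\<Union>k. S k)" using C(2) by (force simp: D_def)
  qed
  ultimately show ?thesis unfolding suslin_def by blast
qed

text \<open>One witness interleaves, through the pairing of indices, a witness for every
  \<open>k\<close>.\<close>

lemma suslin_INT:
  assumes "\<And>k :: nat. suslin (S k)"
  shows "suslin (\<Inter>k. S k)"
proof -
  have "\<forall>k. \<exists>C :: ((nat \<Rightarrow> nat) \<times> (nat \<Rightarrow> nat)) set. closed C \<and> S k = fst ` C"
    using assms by (simp add: suslin_def)
  from choice[OF this] obtain C :: "nat \<Rightarrow> ((nat \<Rightarrow> nat) \<times> (nat \<Rightarrow> nat)) set"
    where "\<forall>k. closed (C k) \<and> S k = fst ` C k" ..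
  then have C: "closed (C k)" "S k = fst ` C k" for k by simp_all
  define e where "e k p = (fst p, \<lambda>i. snd p (prod_encode (k, i)))"
    for k and p :: "(nat \<Rightarrow> nat) \<times> (nat \<Rightarrow> nat)"
  define D where "D = (\<Inter>k. e k -` C k)"
  have cont: "continuous_on UNIV (e k)" for k
    unfolding e_def
    by (intro continuous_intros continuous_on_coordinatewise_then_product continuous_on_coordinate)
  have "closed D"
    unfolding D_def using C(1) cont by (auto intro!: closed_INT closed_vimage)
  moreover have "(\<Inter>k. S k) = fst ` D"
  proof (intro equalityI subsetI)
    fix x assume "x \<in> (\<Inter>k. S k)"
    then have "\<forall>k. \<exists>y. (x, y) \<in> C k" using C(2) by force
    then obtain y where y: "\<And>k. (x, y k) \<in> C k" by metis
    have "(x, \<lambda>i. y (fst (prod_decode i)) (snd (prod_decode i))) \<in> D"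
      using y by (simp add: D_def e_def)
    then show "x \<in> fst ` D" by force
  next
    fix x assume "x \<in> fst ` D"
    then show "x \<in> (\<Inter>k. S k)" using C(2) by (force simp: D_def e_def)
  qed
  ultimately show ?thesis unfolding suslin_def by blast
qed

text \<open>The complement of a Suslin set need not be Suslin, so the induction carries a set and
  its complement together; unions and intersections then exchange roles.\<close>

lemma sets_baire_suslin:
  assumes "S \<in> sets baire"
  shows "suslin S"
proof -
  have "S \<in> sigma_sets UNIV {{f. f i \<in> B} | (i :: nat) (B :: nat set). True}"
    using assms by (simp add: sets_PiM_single PiE_UNIV_domain)
  then have "suslin S \<and> suslin (- S)"
  proof (induction rule: sigma_sets.induct)
    case (Basic a)
    then obtain i B where a: "a = (\<lambda>f. f i) -` B" by auto
    have "closed ((\<lambda>f :: nat \<Rightarrow> nat. f i) -` B)" for B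
      by (intro closed_vimage closed_nat continuous_on_product_coordinates)
    then show ?case unfolding a vimage_Compl[symmetric] by (simp add: suslin_closed)
  next
    case Empty
    then show ?case by (simp add: suslin_closed)
  next
    case (Compl a)
    then show ?case by (simp add: Compl_eq_Diff_UNIV[symmetric])
  next
    case (Union a)
    then have "suslin (\<Union>i. a i)" "suslin (\<Inter>i. - a i)"
      by (auto intro!: suslin_UN suslin_INT)
    then show ?case by simp
  qed
  then show ?thesis by blast
qed

lemma suslin_projection:
  assumes "suslin S"
  shows "suslin {x. \<exists>z. (\<lambda>i. prod_encode (x i, z i)) \<in> S}"
proof -
  obtain C :: "((nat \<Rightarrow> nat) \<times> (nat \<Rightarrow> nat)) set" where C: "closed C" "S = fst ` C" using assms unfolding suslin_def by blast
  \<comment> \<open>The projected sequence \<open>z\<close> and the Suslin witness are merged entry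
    by entry into a single witness.\<close>
  define e where "e p = ((\<lambda>i. prod_encode (fst p i, fst (prod_decode (snd p i)))),
    (\<lambda>i. snd (prod_decode (snd p i))))" for p :: "(nat \<Rightarrow> nat) \<times> (nat \<Rightarrow> nat)"
  have "continuous_on UNIV (\<lambda>p :: (nat \<Rightarrow> nat) \<times> (nat \<Rightarrow> nat). prod_encode (fst p i, fst (prod_decode (snd p i))))"
    "continuous_on UNIV (\<lambda>p :: (nat \<Rightarrow> nat) \<times> (nat \<Rightarrow> nat). snd (prod_decode (snd p i)))" for i
    using continuous_on_discrete_pair[of "\<lambda>p :: (nat \<Rightarrow> nat) \<times> (nat \<Rightarrow> nat). fst p i" "\<lambda>p. snd p i"
        "\<lambda>a b. prod_encode (a, fst (prod_decode b))"]
      continuous_on_discrete_pair[of "\<lambda>p :: (nat \<Rightarrow> nat) \<times> (nat \<Rightarrow> nat). fst p i" "\<lambda>p. snd p i"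
        "\<lambda>a b. snd (prod_decode b)"]
    by (simp_all add: continuous_on_coordinate continuous_on_fst continuous_on_snd)
  then have "continuous_on UNIV e"
    unfolding e_def by (intro continuous_on_Pair continuous_on_coordinatewise_then_product)
  then have "closed (e -` C)" using C(1) by (intro closed_vimage)
  moreover have "{x. \<exists>z. (\<lambda>i. prod_encode (x i, z i)) \<in> S} = fst ` (e -` C)"
  proof (intro equalityI subsetI)
    fix x assume "x \<in> {x. \<exists>z. (\<lambda>i. prod_encode (x i, z i)) \<in> S}"
    then obtain z y where "(\<lambda>i. prod_encode (x i, z i), y) \<in> C" using C(2) by force
    then have "(x, \<lambda>i. prod_encode (z i, y i)) \<in> e -` C" by (simp add: e_def)
    then show "x \<in> fst ` (e -` C)" by force
  next
    fix x assume "x \<in> fst ` (e -` C)"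
    then obtain w where "e (x, w) \<in> C" by (metis imageE prod.collapse vimageD)
    then have "(\<lambda>i. prod_encode (x i, fst (prod_decode (w i)))) \<in> S"
      using C(2) by (force simp: e_def)
    then show "x \<in> {x. \<exists>z. (\<lambda>i. prod_encode (x i, z i)) \<in> S}"
      by (intro CollectI exI[of _ "\<lambda>i. fst (prod_decode (w i))"])
  qed
  ultimately show ?thesis unfolding suslin_def by blast
qed

lemma tendsto_eventual_coordinates:
  fixes f :: "nat \<Rightarrow> nat \<Rightarrow> nat"
  assumes "\<And>i. \<exists>N. \<forall>n\<ge>N. f n i = l i"
  shows "f \<longlonglongrightarrow> l"
proof -
  have "(\<lambda>n. f n i) \<longlonglongrightarrow> l i" for i
    using assms[of i] by (intro tendsto_eventually) (auto simp: eventually_sequentially)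
  then have "limitin (product_topology (\<lambda>i. euclidean) UNIV) f l sequentially"
    unfolding limitin_componentwise by simp
  then show ?thesis by (simp add: euclidean_product_topology)
qed

lemma closed_baire_pairI:
  fixes C :: "((nat \<Rightarrow> nat) \<times> (nat \<Rightarrow> nat)) set"
  assumes "closed C" "\<And>n. \<exists>p\<in>C. \<forall>i<n. fst p i = x i \<and> snd p i = y i"
  shows "(x, y) \<in> C"
proof -
  obtain p where p: "\<And>n. p n \<in> C" "\<And>n i. i < n \<Longrightarrow> fst (p n) i = x i \<and> snd (p n) i = y i"
    using assms(2) by metis
  have "(\<lambda>n. fst (p n)) \<longlonglongrightarrow> x" "(\<lambda>n. snd (p n)) \<longlonglongrightarrow> y"
    by (rule tendsto_eventual_coordinates, use p(2) Suc_le_lessD in blast)+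
  then have "(\<lambda>n. (fst (p n), snd (p n))) \<longlonglongrightarrow> (x, y)" by (rule tendsto_Pair)
  then have "p \<longlonglongrightarrow> (x, y)" by simp
  then show ?thesis using closed_sequentially[OF assms(1)] p(1) by blast
qed

subsection \<open>Well-founded trees do not form a Suslin set\<close>

text \<open>Every \<open>x\<close> codes some set of finite sequences, since
  \<open>list_encode\<close> numbers all of them; being a tree is stated separately by
  \<open>prefix_closed\<close>.\<close>

definition tree_code :: "(nat \<Rightarrow> nat) \<Rightarrow> nat list set" where
  "tree_code x = {u. x (list_encode u) \<noteq> 0}"

definition prefix_closed :: "nat list set \<Rightarrow> bool" where
  "prefix_closed T \<longleftrightarrow> (\<forall>u v. u @ v \<in> T \<longrightarrow> u \<in> T)"

definition has_branch :: "nat list set \<Rightarrow> bool" where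
  "has_branch T \<longleftrightarrow> (\<exists>b. \<forall>n. map b [0..<n] \<in> T)"

lemma length_le_list_encode: "length u \<le> list_encode u"
proof (induction u)
  case (Cons a u)
  then show ?case using le_prod_encode_2[of "list_encode u" a] by simp
qed simp

text \<open>The tree of attempts to verify that its own code belongs to \<open>S\<close>: whether \<open>u\<close> is a node only
  depends on the nodes with codes below \<open>length u\<close>, so this circular description is a recursion on
  codes.\<close>

lemma suslin_self_referential_tree:
  assumes "suslin S"
  obtains x where "prefix_closed (tree_code x)" "has_branch (tree_code x) \<longleftrightarrow> x \<in> S"
proof -
  obtain C :: "((nat \<Rightarrow> nat) \<times> (nat \<Rightarrow> nat)) set" where C: "closed C" "S = fst ` C" using assms unfolding suslin_def by blast
  \<comment> \<open>A node \<open>u\<close> is a finite attempt at a witness: no initial segment of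
    \<open>x\<close> and \<open>u\<close>, up to the length of \<open>u\<close>, is refuted by
    \<open>C\<close>. Only entries of \<open>x\<close> below \<open>length u\<close> are
    read.\<close>
  define good where "good x u \<longleftrightarrow> (\<forall>k\<le>length u. \<exists>p\<in>C. \<forall>i<k. fst p i = x i \<and> snd p i = u ! i)"
    for x :: "nat \<Rightarrow> nat" and u
  have good_cong: "good x u \<longleftrightarrow> good x' u" if "\<And>i. i < length u \<Longrightarrow> x i = x' i" for x x' u
    using that unfolding good_def by (metis order_less_le_trans)
  \<comment> \<open>Entry \<open>c\<close> depends on entries below
    \<open>length (list_decode c)\<close>, which is at most \<open>c\<close>. Reading the unfinished
    list in place of \<open>x\<close> is therefore harmless, whatever \<open>nth\<close> returns
    beyond its end.\<close>
  define P where "P xs \<longleftrightarrow> (\<forall>c<length xs. xs ! c = of_bool (good (nth xs) (list_decode c)))" for xs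
  have len: "length (list_decode c) \<le> c" for c
    using length_le_list_encode[of "list_decode c"] by simp
  have "\<exists>z. P (xs @ [z])" if xs: "P xs" for xs
  proof -
    define z :: nat where "z = of_bool (good (nth xs) (list_decode (length xs)))"
    have "good (nth (xs @ [z])) (list_decode c) = good (nth xs) (list_decode c)"
      if "c \<le> length xs" for c
      using that len[of c] by (intro good_cong) (simp add: nth_append)
    then have "P (xs @ [z])"
      using xs by (auto simp: P_def nth_append less_Suc_eq z_def)
    then show ?thesis by blast
  qed
  moreover have "P []" by (simp add: P_def)
  ultimately obtain x where x: "\<And>n. P (map x [0..<n])" using list_choice[of P] by blast
  have xc: "x c = of_bool (good x (list_decode c))" for c
  proof -
    have "map x [0..<Suc c] ! c = of_bool (good (nth (map x [0..<Suc c])) (list_decode c))"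
      using x[of "Suc c"] unfolding P_def by (metis diff_zero length_map length_upt lessI)
    moreover have "good (nth (map x [0..<Suc c])) (list_decode c) = good x (list_decode c)"
      using len[of c] by (intro good_cong) (simp del: upt_Suc)
    ultimately show ?thesis by (simp del: upt_Suc)
  qed
  have T: "u \<in> tree_code x \<longleftrightarrow> good x u" for u by (simp add: tree_code_def xc)
  have "prefix_closed (tree_code x)"
    unfolding prefix_closed_def T
  proof (intro allI impI)
    fix u v assume g: "good x (u @ v)"
    show "good x u"
      unfolding good_def
    proof (intro allI impI)
      fix k assume k: "k \<le> length u"
      then obtain p where "p \<in> C" "\<forall>i<k. fst p i = x i \<and> snd p i = (u @ v) ! i"
        using g unfolding good_def by (metis le_add1 length_append order_trans)
      then show "\<exists>p\<in>C. \<forall>i<k. fst p i = x i \<and> snd p i = u ! i"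
        using k by (intro bexI[of _ p]) (auto simp: nth_append)
    qed
  qed
  moreover have "has_branch (tree_code x) \<longleftrightarrow> x \<in> S"
  proof
    assume "has_branch (tree_code x)"
    then obtain b where b: "\<And>n. good x (map b [0..<n])" unfolding has_branch_def T by blast
    have "\<exists>p\<in>C. \<forall>i<n. fst p i = x i \<and> snd p i = b i" for n
    proof -
      obtain p where "p \<in> C" "\<forall>i<n. fst p i = x i \<and> snd p i = map b [0..<n] ! i"
        using b[of n] unfolding good_def by (metis diff_zero length_map length_upt order_refl)
      then show ?thesis by (intro bexI[of _ p]) auto
    qed
    then have "(x, b) \<in> C" by (rule closed_baire_pairI[OF C(1)])
    then show "x \<in> S" using C(2) by force
  next
    assume "x \<in> S"
    then obtain y where y: "(x, y) \<in> C" using C(2) by auto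
    have "good x (map y [0..<n])" for n
      unfolding good_def using y by (intro allI impI bexI[of _ "(x, y)"]) auto
    then show "has_branch (tree_code x)" unfolding has_branch_def T by blast
  qed
  ultimately show thesis using that by blast
qed

subsection \<open>Reducing well-foundedness to membership in \<open>V U A\<close>\<close>

fun lcp :: "'a list \<Rightarrow> 'a list \<Rightarrow> nat" where
  "lcp (x # xs) (y # ys) = (if x = y then Suc (lcp xs ys) else 0)"
| "lcp _ _ = 0"

lemma le_lcp_iff: "k \<le> lcp u v \<longleftrightarrow> k \<le> length u \<and> k \<le> length v \<and> take k u = take k v"
proof (induction u v arbitrary: k rule: lcp.induct)
  case (1 x xs y ys)
  then show ?case by (cases k) auto
qed auto

lemma lcp_commute: "lcp u v = lcp v u"
  by (induction u v rule: lcp.induct) auto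

lemma lcp_le_length: "lcp u v \<le> length u" "lcp u v \<le> length v"
  using le_lcp_iff[of "lcp u v" u v] by auto

text \<open>For decreasing \<open>e\<close> this is the ultrametric inequality of the distance
  \<open>e (lcp u v)\<close>.\<close>

lemma min_lcp_le: "min (lcp u v) (lcp v w) \<le> lcp u w"
  using le_lcp_iff[of "min (lcp u v) (lcp v w)" u v] le_lcp_iff[of "min (lcp u v) (lcp v w)" v w]
    le_lcp_iff[of "min (lcp u v) (lcp v w)" u w] by simp

text \<open>The constants serve the triangles with apex \<open>None\<close>. The bound
  \<open>e n / 2\<close> makes \<open>a (length u)\<close> and \<open>a (length v)\<close> differ by
  at most \<open>e (lcp u v)\<close>, as both nodes are at least as long as their common prefix.
  From \<open>e 0 < r\<close> every \<open>a n\<close> is at least \<open>r / 2\<close>, so two of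
  them exceed any \<open>e k\<close>.\<close>

lemma tree_points:
  fixes U :: "'u metric" and e a :: "nat \<Rightarrow> real"
  assumes U: "urysohn_space U" and e: "decseq e" "\<And>n. 0 < e n"
    and a: "\<And>n. \<bar>a n - r\<bar> \<le> e n / 2" "e 0 < r"
  obtains H :: "nat list option \<Rightarrow> 'u" where "range H \<subseteq> mspace U"
    "\<And>u v. mdist U (H (Some u)) (H (Some v)) = (if u = v then 0 else e (lcp u v))"
    "\<And>u. mdist U (H None) (H (Some u)) = a (length u)"
proof -
  define dd :: "nat list option \<Rightarrow> nat list option \<Rightarrow> real" where
    "dd p q = (case p of
        None \<Rightarrow> (case q of None \<Rightarrow> 0 | Some v \<Rightarrow> a (length v))
      | Some u \<Rightarrow> (case q of None \<Rightarrow> a (length u)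
          | Some v \<Rightarrow> if u = v then 0 else e (lcp u v)))" for p q
  have dd [simp]: "dd None None = 0" "dd None (Some v) = a (length v)"
    "dd (Some u) None = a (length u)" "dd (Some u) (Some v) = (if u = v then 0 else e (lcp u v))"
    for u v by (simp_all add: dd_def)
  have emono: "e m \<le> e n" if "n \<le> m" for m n using e(1) that by (rule decseqD)
  have a_big: "a n \<ge> r / 2" for n using a(1)[of n] a(2) emono[of 0 n] by linarith
  have r0: "r > 0" using a(2) e(2)[of 0] by simp
  have a0: "a n \<ge> 0" for n using a_big[of n] r0 by linarith
  have a_diff: "\<bar>a (length u) - a (length v)\<bar> \<le> e (lcp u v)" for u v :: "nat list"
    using a(1)[of "length u"] a(1)[of "length v"] emono[OF lcp_le_length(1)[of u v]]
      emono[OF lcp_le_length(2)[of u v]] by linarith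
  have a_sum: "e k \<le> a m + a n" for k m n
    using a_big[of m] a_big[of n] a(2) emono[of 0 k] by simp
  have comm: "dd p q = dd q p" for p q by (cases p; cases q) (simp_all add: lcp_commute)
  have nn: "dd p q \<ge> 0" for p q
    using a0 e(2) by (cases p; cases q) (auto simp: less_imp_le)
  have tri: "dd p q \<le> dd p s + dd s q" for p q s
  proof (cases p; cases q; cases s)
    fix u v w assume c: "p = Some u" "q = Some v" "s = Some w"
    have "e (lcp u v) \<le> e (lcp u w) + e (lcp w v)"
      using emono[OF min_lcp_le[of u w v]] e(2)[of "lcp u w"] e(2)[of "lcp w v"]
      by (simp add: min_def split: if_splits)
    then show ?thesis using c e(2) by (auto simp: less_imp_le)
  next
    fix u v assume "p = Some u" "q = Some v" "s = None"
    then show ?thesis using a_sum a0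
      by (auto intro!: add_nonneg_nonneg)
  next
    fix u w assume "p = Some u" "q = None" "s = Some w"
    then show ?thesis using a_diff[of u w] by auto
  next
    fix v w assume "p = None" "q = Some v" "s = Some w"
    then show ?thesis using a_diff[of v w] lcp_commute[of v w] by auto
  qed (use a0 in simp_all)
  \<comment> \<open>Index 0 is the apex, index \<open>Suc c\<close> the node with code
    \<open>c\<close>.\<close>
  define dec where "dec i = (case i of 0 \<Rightarrow> None | Suc c \<Rightarrow> Some (list_decode c))" for i
  have nn': "dd p q \<in> {0..}" for p q using nn by simp
  have refl: "dd p p = 0" for p by (cases p) simp_all
  obtain h where h: "range h \<subseteq> mspace U" "\<And>i j. mdist U (h i) (h j) = dd (dec i) (dec j)"
    by (rule realise_pseudometric[OF urysohn_extension_property[OF U] order_refl,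
        of "\<lambda>i j. dd (dec i) (dec j)"]) (rule nn' refl comm tri that; assumption)+
  define H where "H p = h (case p of None \<Rightarrow> 0 | Some u \<Rightarrow> Suc (list_encode u))" for p
  have "mdist U (H p) (H q) = dd p q" for p q
    by (simp add: H_def h(2) dec_def split: option.splits)
  moreover have "range H \<subseteq> mspace U" using h(1) by (auto simp: H_def)
  ultimately show thesis using that[of H] by simp
qed

definition tree_space :: "'u metric \<Rightarrow> (nat list option \<Rightarrow> 'u) \<Rightarrow> nat list set \<Rightarrow> 'u set" where
  "tree_space U H T = mclosure U (insert (H None) ((\<lambda>u. H (Some u)) ` T))"

text \<open>The nodes along a branch form a Cauchy sequence, and the apex is at distance
  \<open>r\<close> from their limit, because \<open>a n\<close> tends to \<open>r\<close>.\<close>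

lemma tree_space_branch:
  assumes complete: "mcomplete_of U" and HU: "range H \<subseteq> mspace U"
    and Hd: "\<And>u v. mdist U (H (Some u)) (H (Some v)) = (if u = v then 0 else e (lcp u v))"
      "\<And>u. mdist U (H None) (H (Some u)) = a (length u)"
    and e: "\<And>n. e n \<le> (1/2) ^ n" and a: "\<And>n. \<bar>a n - r\<bar> \<le> e n / 2"
    and b: "has_branch T"
  shows "\<exists>p\<in>tree_space U H T. \<exists>q\<in>tree_space U H T. mdist U p q = r"
proof -
  obtain b where b: "\<And>n. map b [0..<n] \<in> T" using b by (auto simp: has_branch_def)
  have Hm: "H p \<in> mspace U" for p using HU by blast
  define \<sigma> where "\<sigma> n = H (Some (map b [0..<n]))" for n
  have "mdist U (\<sigma> n) (\<sigma> (Suc n)) \<le> 1 * (1/2) ^ n" for n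
  proof -
    have "n \<le> lcp (map b [0..<n]) (map b [0..<Suc n])"
      unfolding le_lcp_iff by (simp add: take_map)
    then have "lcp (map b [0..<n]) (map b [0..<Suc n]) = n"
      using lcp_le_length(1)[of "map b [0..<n]" "map b [0..<Suc n]"] by simp
    moreover have "map b [0..<n] \<noteq> map b [0..<Suc n]" by (metis diff_zero length_map length_upt n_not_Suc_n)
    ultimately show ?thesis using e[of n] by (simp add: \<sigma>_def Hd(1) del: upt_Suc)
  qed
  moreover have "range \<sigma> \<subseteq> mspace U" using Hm by (auto simp: \<sigma>_def)
  ultimately obtain l where l: "l \<in> mspace U" "\<And>n. mdist U (\<sigma> n) l \<le> 2 * 1 * (1/2) ^ n"
    using geometric_limit[OF complete, of \<sigma> 1] by blast
  have "mdist U (H None) l = r"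
  proof (rule ccontr)
    assume "mdist U (H None) l \<noteq> r"
    then have "\<bar>mdist U (H None) l - r\<bar> > 0" by simp
    then obtain n where n: "3 * (1/2) ^ n < \<bar>mdist U (H None) l - r\<bar>"
      using half_power_small by blast
    have "\<bar>mdist U (H None) (\<sigma> n) - mdist U (H None) l\<bar> \<le> mdist U (H None) (H None) + mdist U (\<sigma> n) l"
      by (rule mdist_perturb) (use Hm l in \<open>auto simp: \<sigma>_def\<close>)
    moreover have "mdist U (H None) (\<sigma> n) = a n" by (simp add: \<sigma>_def Hd(2))
    moreover have "mdist U (H None) (H None) = 0" using Hm by simp
    ultimately show False using n l(2)[of n] a[of n] e[of n] by linarith
  qed
  moreover have "l \<in> tree_space U H T"
    unfolding tree_space_def mclosure_def
  proof (intro CollectI conjI allI impI l(1))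
    fix \<epsilon> :: real assume "\<epsilon> > 0"
    then obtain n where "2 * 1 * (1/2) ^ n < \<epsilon>" using half_power_small by blast
    then have "mdist U l (\<sigma> n) < \<epsilon>" using l(2)[of n] mdist_commute[of U l "\<sigma> n"] by simp
    then show "\<exists>s\<in>insert (H None) ((\<lambda>u. H (Some u)) ` T). mdist U l s < \<epsilon>"
      using b by (auto simp: \<sigma>_def)
  qed
  moreover have "H None \<in> tree_space U H T"
    unfolding tree_space_def by (rule subsetD[OF mclosure_superset]) (use Hm in auto)
  ultimately show ?thesis by blast
qed

text \<open>Nodes close to a point \<open>v\<close> share long prefixes. If \<open>v\<close> were a
  new limit point, there would be nodes of unbounded length around it, and their common prefixes
  would fit together to a branch.\<close>

lemma tree_space_no_branch:
  assumes HU: "range H \<subseteq> mspace U"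
    and Hd: "\<And>u v. mdist U (H (Some u)) (H (Some v)) = (if u = v then 0 else e (lcp u v))"
    and e: "decseq e" "\<And>n. 0 < e n"
    and T: "prefix_closed T" "\<not> has_branch T"
  shows "tree_space U H T = insert (H None) ((\<lambda>u. H (Some u)) ` T)" (is "_ = ?S")
proof (rule ccontr)
  have Hm: "H p \<in> mspace U" for p using HU by blast
  have emono: "e m \<le> e n" if "n \<le> m" for m n using e(1) that by (rule decseqD)
  have SU: "?S \<subseteq> mspace U" using Hm by auto
  assume "tree_space U H T \<noteq> ?S"
  then obtain v where v: "v \<in> mclosure U ?S" "v \<notin> ?S"
    using mclosure_superset[OF SU] unfolding tree_space_def by blast
  then have vm: "v \<in> mspace U" and near: "\<And>\<epsilon>. \<epsilon> > 0 \<Longrightarrow> \<exists>s\<in>?S. mdist U v s < \<epsilon>"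
    by (auto simp: mclosure_def)
  have pos: "mdist U v s > 0" if "s \<in> ?S" for s
  proof -
    have "v \<noteq> s" "s \<in> mspace U" using that v(2) SU by auto
    then show ?thesis using vm mdist_nonneg[of U v s] by (simp add: less_le)
  qed
  have nearT: "\<exists>u\<in>T. mdist U v (H (Some u)) < \<epsilon>" if "\<epsilon> > 0" for \<epsilon>
  proof -
    have "min \<epsilon> (mdist U v (H None)) > 0" using that pos by simp
    from near[OF this] show ?thesis by auto
  qed
  have "\<exists>u\<in>T. mdist U v (H (Some u)) < e n / 2" for n using nearT[of "e n / 2"] e(2) by simp
  then obtain u where u: "\<And>n. u n \<in> T" "\<And>n. mdist U v (H (Some (u n))) < e n / 2" by metis
  have close: "n < lcp w w'" if "w \<noteq> w'" "mdist U v (H (Some w)) < e n / 2"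
    "mdist U v (H (Some w')) < e n / 2" for w w' n
  proof -
    have "mdist U (H (Some w)) (H (Some w')) < e n"
      using mdist_triangle[OF Hm[of "Some w"] vm Hm[of "Some w'"]] that(2,3)
        mdist_commute[of U v "H (Some w)"] by simp
    then have "e (lcp w w') < e n" using Hd[of w w'] that(1) by simp
    then show ?thesis using emono[of "lcp w w'" n] by (meson not_less)
  qed
  \<comment> \<open>Since \<open>v\<close> is not itself a node, some node \<open>w\<close> lies
    strictly closer to \<open>v\<close> than \<open>u n\<close>. It differs from \<open>u n\<close>
    and shares more than \<open>n\<close> entries with it, so \<open>u n\<close> is long
    enough.\<close>
  have len: "n < length (u n)" for n
  proof -
    have "min (e n / 2) (mdist U v (H (Some (u n)))) > 0" using e(2) pos u(1) by simp
    from nearT[OF this] obtain w where w: "w \<in> T" "mdist U v (H (Some w)) < e n / 2"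
      "mdist U v (H (Some w)) < mdist U v (H (Some (u n)))" by auto
    then have "w \<noteq> u n" by auto
    then have "n < lcp w (u n)" using close w(2) u(2) by blast
    then show ?thesis using lcp_le_length(2)[of w "u n"] by simp
  qed
  have agree: "u i ! i = u n ! i" if "i < n" for i n
  proof (cases "u i = u n")
    case False
    have "mdist U v (H (Some (u n))) < e i / 2" using u(2)[of n] emono[of i n] that by simp
    then have "Suc i \<le> lcp (u i) (u n)" using close[OF False u(2)] by simp
    then have "take (Suc i) (u i) = take (Suc i) (u n)" unfolding le_lcp_iff by blast
    then show ?thesis by (metis lessI nth_take)
  qed simp
  \<comment> \<open>The branch is read off diagonally; entry \<open>i\<close> is already final in
    \<open>u i\<close>.\<close>
  have "map (\<lambda>i. u i ! i) [0..<n] = take n (u n)" for n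
    using agree[of _ n] len[of n] by (intro nth_equalityI) auto
  moreover have "take n (u n) \<in> T" for n
    using T(1) u(1)[of n] append_take_drop_id[of n "u n"] unfolding prefix_closed_def by metis
  ultimately have "has_branch T" unfolding has_branch_def by metis
  then show False using T(2) by blast
qed

text \<open>Whether the closure meets an open set is a countable disjunction over the nodes, each a
  condition on one coordinate of the code.\<close>

lemma tree_space_measurable:
  assumes "range H \<subseteq> mspace U"
  shows "(\<lambda>x. tree_space U H (tree_code x)) \<in> baire \<rightarrow>\<^sub>M effros U"
  unfolding effros_def
proof (rule measurable_measure_of)
  have S: "insert (H None) ((\<lambda>u. H (Some u)) ` T) \<subseteq> mspace U" for T
    using assms by auto
  show "(\<lambda>x. tree_space U H (tree_code x)) \<in> space baire \<rightarrow> closed_subsets U"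
    unfolding tree_space_def using mclosure_closed[OF S] by blast
  fix Y assume "Y \<in> {{X \<in> closed_subsets U. X \<inter> W \<noteq> {}} |W. openin (mtopology_of U) W}"
  then obtain W where W: "openin (mtopology_of U) W" "Y = {X \<in> closed_subsets U. X \<inter> W \<noteq> {}}"
    by blast
  have "tree_space U H (tree_code x) \<in> Y \<longleftrightarrow>
      H None \<in> W \<or> (\<exists>u. H (Some u) \<in> W \<and> x (list_encode u) \<noteq> 0)" for x
  proof -
    have "tree_space U H (tree_code x) \<in> Y \<longleftrightarrow> tree_space U H (tree_code x) \<inter> W \<noteq> {}"
      unfolding W(2) tree_space_def using mclosure_closed[OF S] by blast
    also have "\<dots> \<longleftrightarrow> insert (H None) ((\<lambda>u. H (Some u)) ` tree_code x) \<inter> W \<noteq> {}"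
      unfolding tree_space_def by (rule mclosure_meets_open[OF S W(1)])
    finally show ?thesis by (auto simp: tree_code_def)
  qed
  then have "(\<lambda>x. tree_space U H (tree_code x)) -` Y \<inter> space baire =
      {x \<in> space baire. H None \<in> W \<or> (\<exists>u. H (Some u) \<in> W \<and> x (list_encode u) \<noteq> 0)}"
    by blast
  also have "\<dots> \<in> sets baire" by measurable
  finally show "(\<lambda>x. tree_space U H (tree_code x)) -` Y \<inter> space baire \<in> sets baire" .
qed auto

text \<open>The map sends a code to the space of its tree. All distances of the space before closing
  lie in \<open>A\<close>, so on trees only a limit of nodes can spoil membership in
  \<open>V U A\<close>.\<close>

lemma V_not_suslin_reducible:
  fixes U :: "'u metric"
  assumes U: "urysohn_space U" and A: "distance_set A" "0 islimpt A" "\<not> closed A"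
  obtains g :: "(nat \<Rightarrow> nat) \<Rightarrow> 'u set" where "g \<in> baire \<rightarrow>\<^sub>M effros U"
    "\<not> suslin {x. g x \<in> V U A}"
proof -
  note A0 = distance_setD[OF A(1)]
  have complete: "mcomplete_of U" using U by (simp add: urysohn_space_def polish_metric_def)
  obtain r where r: "r \<in> closure A" "r \<notin> A"
    using A(3) closure_subset[of A] by (metis closure_closed subsetI subset_antisym closed_closure)
  have "closure A \<subseteq> {0..}" using A0(2) by (intro closure_minimal) auto
  then have "r > 0" using r A0(1) by (cases "r = 0") force+
  \<comment> \<open>Membership in \<open>A\<close> makes the distances between nodes admissible, the
    bound \<open>r\<close> provides \<open>e 0 < r\<close>, and the geometric bound gives
    convergence along branches.\<close>
  define Q where "Q n x \<longleftrightarrow> x \<in> A \<and> 0 < x \<and> x < r \<and> x \<le> (1/2) ^ n" for n :: nat and x :: real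
  have small: "\<exists>x\<in>A. 0 < x \<and> x < \<epsilon>" if "\<epsilon> > 0" for \<epsilon>
  proof -
    obtain x where "x \<in> A" "x \<noteq> 0" "dist x 0 < \<epsilon>"
      using A(2) \<open>\<epsilon> > 0\<close> unfolding islimpt_approachable by blast
    moreover have "x \<ge> 0" using \<open>x \<in> A\<close> A0(2) by auto
    ultimately show ?thesis by (intro bexI[of _ x]) (auto simp: dist_real_def)
  qed
  have "\<exists>e. \<forall>n. Q n (e n) \<and> e (Suc n) \<le> e n"
  proof (rule dependent_nat_choice)
    have "min r 1 > 0" using \<open>r > 0\<close> by simp
    from small[OF this] show "\<exists>x. Q 0 x" by (auto simp: Q_def)
  next
    fix x n assume "Q n x"
    then have "min x ((1/2) ^ Suc n) > 0" by (simp add: Q_def)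
    from small[OF this] obtain y where "y \<in> A" "0 < y" "y < min x ((1/2) ^ Suc n)" by blast
    then show "\<exists>y. Q (Suc n) y \<and> y \<le> x" using \<open>Q n x\<close> by (intro exI[of _ y]) (auto simp: Q_def)
  qed
  then obtain e where e: "\<And>n. Q n (e n)" "\<And>n. e (Suc n) \<le> e n" by blast
  have e': "decseq e" "\<And>n. 0 < e n" "\<And>n. e n \<in> A" "\<And>n. e n \<le> (1/2) ^ n" "e 0 < r"
    using e by (auto simp: Q_def decseq_Suc_iff)
  have "\<exists>x\<in>A. \<bar>x - r\<bar> \<le> e n / 2" for n
    using r(1) e'(2)[of n] closure_approachable[of r A]
    by (metis dist_real_def half_gt_zero less_imp_le)
  then obtain a where a: "\<And>n. a n \<in> A" "\<And>n. \<bar>a n - r\<bar> \<le> e n / 2" by metis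
  obtain H :: "nat list option \<Rightarrow> 'u" where H: "range H \<subseteq> mspace U"
    "\<And>u v. mdist U (H (Some u)) (H (Some v)) = (if u = v then 0 else e (lcp u v))"
    "\<And>u. mdist U (H None) (H (Some u)) = a (length u)"
    by (rule tree_points[OF U e'(1,2) a(2) e'(5)], rule that)
  have Hm: "H p \<in> mspace U" for p using H(1) by blast
  have HN: "mdist U (H None) (H None) = 0" "mdist U (H (Some u)) (H None) = a (length u)" for u
    using Hm H(3)[of u] mdist_commute[of U "H None" "H (Some u)"] by simp_all
  have wf: "tree_space U H T \<in> V U A \<longleftrightarrow> \<not> has_branch T" if T: "prefix_closed T" for T
  proof
    assume V: "tree_space U H T \<in> V U A"
    show "\<not> has_branch T"
      using tree_space_branch[OF complete H e'(4) a(2)] V r(2) unfolding V_iff by blast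
  next
    assume "\<not> has_branch T"
    from tree_space_no_branch[OF H(1,2) e'(1,2) T this]
    have eq: "tree_space U H T = insert (H None) ((\<lambda>u. H (Some u)) ` T)" .
    have "tree_space U H T \<in> closed_subsets U"
      unfolding tree_space_def using Hm by (intro mclosure_closed) auto
    moreover have "mdist U s t \<in> A" if "s \<in> tree_space U H T" "t \<in> tree_space U H T" for s t
      using that H(2,3) HN A0(1) a(1) e'(3) unfolding eq by auto
    ultimately show "tree_space U H T \<in> V U A" by (simp add: V_iff)
  qed
  \<comment> \<open>For the self-referential code, having a branch would be equivalent to membership
    in \<open>V U A\<close>, that is, to having none.\<close>
  have "\<not> suslin {x. tree_space U H (tree_code x) \<in> V U A}"
  proof
    assume "suslin {x. tree_space U H (tree_code x) \<in> V U A}"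
    then obtain x where "prefix_closed (tree_code x)"
      "has_branch (tree_code x) \<longleftrightarrow> x \<in> {x. tree_space U H (tree_code x) \<in> V U A}"
      by (rule suslin_self_referential_tree)
    then show False using wf by blast
  qed
  then show thesis using that tree_space_measurable[OF H(1)] by blast
qed

lemma V_borel_imp:
  assumes "urysohn_space U" "distance_set A" "V U A \<in> sets (effros U)"
  shows "closed A \<or> \<not> 0 islimpt A"
proof (rule ccontr)
  assume "\<not> ?thesis"
  then obtain g where g: "g \<in> baire \<rightarrow>\<^sub>M effros U" "\<not> suslin {x. g x \<in> V U A}"
    using V_not_suslin_reducible[OF assms(1,2)] by blast
  have "g -` V U A \<inter> space baire \<in> sets baire" by (rule measurable_sets[OF g(1) assms(3)])
  then have "suslin {x. g x \<in> V U A}"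
    using sets_baire_suslin by (simp add: space_baire vimage_def)
  then show False using g(2) by blast
qed

subsection \<open>Analytic sets as images of Borel subsets of the Baire space\<close>

lemma second_countable_euclidean:
  "second_countable (euclidean :: 'a::second_countable_topology topology)"
proof -
  obtain B :: "'a set set" where B: "countable B" "\<And>C. C \<in> B \<Longrightarrow> open C"
    "\<And>S. open S \<Longrightarrow> \<exists>U. U \<subseteq> B \<and> S = \<Union> U"
    using univ_second_countable by blast
  have "\<exists>V\<in>B. x \<in> V \<and> V \<subseteq> S" if "open S" "x \<in> S" for x S
    using B(3)[OF that(1)] that(2) by blast
  then show ?thesis
    unfolding second_countable_def using B(1,2) by (intro exI[of _ B]) simp
qed

lemma polish_topology_mtopology_of:
  assumes "polish_metric m"
  shows "polish_topology (mtopology_of m)"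
proof -
  interpret Metric_space "mspace m" "mdist m" by simp
  obtain y :: "nat \<Rightarrow> _" where y: "range y \<subseteq> mspace m"
    "\<And>x \<epsilon>. x \<in> mspace m \<Longrightarrow> \<epsilon> > 0 \<Longrightarrow> \<exists>n. mdist m x (y n) < \<epsilon>"
    using polish_dense_sequence[OF assms order_refl] assms
    unfolding polish_metric_def by metis
  have ym: "y n \<in> mspace m" for n using y(1) by blast
  define b where "b p = {x \<in> mspace m. mdist m (y (fst p)) x < 1 / real (Suc (snd p))}" for p
  have bo: "openin (mtopology_of m) (b p)" for p
    unfolding b_def by (rule openin_mball_of[OF ym])
  have "\<exists>p. x \<in> b p \<and> b p \<subseteq> W" if W: "openin (mtopology_of m) W" "x \<in> W" for x W
  proof -
    obtain r where r: "r > 0" "\<And>z. z \<in> mspace m \<Longrightarrow> mdist m x z < r \<Longrightarrow> z \<in> W"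
      using openin_metricD[OF W] by blast
    have xm: "x \<in> mspace m" using openin_subset[OF W(1)] W(2) by auto
    obtain k where "inverse (real (Suc k)) < r / 2" using reals_Archimedean[of "r / 2"] r(1) by auto
    then have k: "1 / real (Suc k) < r / 2" by (simp only: inverse_eq_divide)
    have k0: "1 / real (Suc k) > 0" by simp
    obtain n where n: "mdist m x (y n) < 1 / real (Suc k)" using y(2)[OF xm k0] by blast
    have "x \<in> b (n, k)" using n xm mdist_commute[of m x "y n"] by (simp add: b_def)
    moreover have "z \<in> W" if "z \<in> b (n, k)" for z
    proof -
      have z: "z \<in> mspace m" "mdist m (y n) z < 1 / real (Suc k)" using that by (auto simp: b_def)
      then have "mdist m x z < r" using mdist_triangle[OF xm ym[of n] z(1)] n k by linarith
      then show ?thesis using r(2) z(1) by blast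
    qed
    ultimately show ?thesis by blast
  qed
  then have "second_countable (mtopology_of m)"
    unfolding second_countable_def using bo by (intro exI[of _ "range b"]) auto
  moreover have "completely_metrizable_space (mtopology_of m)"
    using assms completely_metrizable_space_mtopology
    by (simp add: polish_metric_def mcomplete_of_def mtopology_of_def)
  ultimately show ?thesis by (simp add: polish_topology_def)
qed

lemma polish_topologyE:
  assumes "polish_topology T" "topspace T \<noteq> {}"
  obtains m where "polish_metric m" "mtopology_of m = T"
proof -
  obtain M d where M: "Metric_space M d" "Metric_space.mcomplete M d" "T = Metric_space.mtopology M d"
    using assms(1) by (auto simp: polish_topology_def completely_metrizable_space_def)
  interpret Metric_space M d by (rule M(1))
  have T: "mtopology_of (metric (M, d)) = T" using M(3) by simp
  moreover have "separable_space T"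
    using assms(1) second_countable_imp_separable_space by (auto simp: polish_topology_def)
  ultimately have "polish_metric (metric (M, d))"
    using M(2) assms(2) topspace_mtopology M(3) by (simp add: polish_metric_def)
  then show thesis using that T by blast
qed

lemma space_borel_of_topology [simp]: "space (borel_of_topology T) = topspace T"
  unfolding borel_of_topology_def by (rule space_measure_of) (auto dest: openin_subset)

lemma open_in_sets_borel_of_topology: "openin T W \<Longrightarrow> W \<in> sets (borel_of_topology T)"
  unfolding borel_of_topology_def
  by (subst sets_measure_of) (auto dest: openin_subset)

section \<open>Polish topologies for Borel subsets of the Baire space\<close>

lemma convergent_nat_sequence:
  fixes f :: "nat \<Rightarrow> nat"
  assumes "(\<lambda>n. real (f n)) \<longlonglongrightarrow> l"
  shows "\<exists>k. l = real k \<and> (\<exists>N. \<forall>n\<ge>N. f n = k)"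
proof -
  obtain N where N: "\<And>n. n \<ge> N \<Longrightarrow> \<bar>real (f n) - l\<bar> < 1 / 2"
    using LIMSEQ_D[OF assms, of "1 / 2"] by auto
  have "f n = f N" if "n \<ge> N" for n
  proof -
    have "\<bar>real (f n) - real (f N)\<bar> < 1" using N[OF that] N[of N] by linarith
    then show ?thesis by linarith
  qed
  then have ev: "\<forall>n\<ge>N. f n = f N" by blast
  then have "(\<lambda>n. real (f n)) \<longlonglongrightarrow> real (f N)"
    by (intro tendsto_eventually) (metis (mono_tags, lifting) eventually_sequentially)
  then show ?thesis using LIMSEQ_unique[OF assms] ev by blast
qed

text \<open>The function type into \<^typ>\<open>real\<close> carries a complete metric in the library, the one into
  \<^typ>\<open>nat\<close> does not.\<close>

lemma closed_real_image:
  fixes C :: "((nat \<Rightarrow> nat) \<times> (nat \<Rightarrow> nat)) set"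
  assumes "closed C"
  shows "closed ((\<lambda>p. (\<lambda>i. real (fst p i), \<lambda>i. real (snd p i))) ` C)"
  unfolding closed_sequential_limits
proof (intro allI impI, elim conjE)
  fix q l
  assume q: "\<forall>n. q n \<in> (\<lambda>p. (\<lambda>i. real (fst p i), \<lambda>i. real (snd p i))) ` C" and lim: "q \<longlonglongrightarrow> l"
  then have "\<forall>n. \<exists>p\<in>C. q n = (\<lambda>i. real (fst p i), \<lambda>i. real (snd p i))" by blast
  then obtain p where p: "\<And>n. p n \<in> C" "\<And>n. q n = (\<lambda>i. real (fst (p n) i), \<lambda>i. real (snd (p n) i))"
    by metis
  have coord: "(\<lambda>n. h n i) \<longlonglongrightarrow> c i" if "h \<longlonglongrightarrow> c" for h :: "nat \<Rightarrow> nat \<Rightarrow> real" and c i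
    using that limitin_componentwise[of "\<lambda>_. euclidean" UNIV h c sequentially]
    by (simp add: euclidean_product_topology)
  have lims: "(\<lambda>n. real (fst (p n) i)) \<longlonglongrightarrow> fst l i" "(\<lambda>n. real (snd (p n) i)) \<longlonglongrightarrow> snd l i" for i
    using coord[OF tendsto_fst[OF lim], of i] coord[OF tendsto_snd[OF lim], of i]
    by (simp_all add: p(2))
  have "\<forall>i. \<exists>k. fst l i = real k \<and> (\<exists>N. \<forall>n\<ge>N. fst (p n) i = k)"
    "\<forall>i. \<exists>k. snd l i = real k \<and> (\<exists>N. \<forall>n\<ge>N. snd (p n) i = k)"
    using convergent_nat_sequence[OF lims(1)] convergent_nat_sequence[OF lims(2)] by simp_all
  then obtain x y where x: "\<And>i. fst l i = real (x i)" "\<And>i. \<exists>N. \<forall>n\<ge>N. fst (p n) i = x i"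
    and y: "\<And>i. snd l i = real (y i)" "\<And>i. \<exists>N. \<forall>n\<ge>N. snd (p n) i = y i"
    by metis
  have "(\<lambda>n. (fst (p n), snd (p n))) \<longlonglongrightarrow> (x, y)"
    using x(2) y(2) by (intro tendsto_Pair tendsto_eventual_coordinates)
  then have "(x, y) \<in> C" using closed_sequentially[OF assms, of p] p(1) by simp
  moreover have "l = (\<lambda>i. real (x i), \<lambda>i. real (y i))"
    using x(1) y(1) by (simp add: prod_eq_iff fun_eq_iff)
  ultimately show "l \<in> (\<lambda>p. (\<lambda>i. real (fst p i), \<lambda>i. real (snd p i))) ` C" by force
qed

lemma isometry_onto_inverse_openin:
  assumes f: "isometry_onto m m' f" and W: "openin (mtopology_of m) W"
  shows "openin (mtopology_of m') {t \<in> mspace m'. inv_into (mspace m) f t \<in> W}"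
proof -
  interpret Metric_space "mspace m'" "mdist m'" by simp
  define g where "g = inv_into (mspace m) f"
  have g: "g t \<in> mspace m" "f (g t) = t" if "t \<in> mspace m'" for t
    using f that by (auto simp: g_def isometry_onto_def inv_into_into f_inv_into_f)
  have gd: "mdist m (g s) (g t) = mdist m' s t" if "s \<in> mspace m'" "t \<in> mspace m'" for s t
    using f g[OF that(1)] g[OF that(2)] unfolding isometry_onto_def isometric_embedding_def
    by metis
  have "\<exists>r>0. mball t r \<subseteq> {t \<in> mspace m'. g t \<in> W}" if t: "t \<in> mspace m'" "g t \<in> W" for t
  proof -
    obtain r where "r > 0" "\<And>y. y \<in> mspace m \<Longrightarrow> mdist m (g t) y < r \<Longrightarrow> y \<in> W"
      using openin_metricD[OF W t(2)] by blast
    then show ?thesis using g gd t(1) by (intro exI[of _ r]) auto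
  qed
  then show ?thesis unfolding g_def[symmetric] mtopology_of_def openin_mtopology by blast
qed

text \<open>A Borel set \<open>S\<close> need not be Polish in the topology of the Baire space, but
  a closed set \<open>C\<close> that projects onto it is. The domain demanded by
  \<open>analytic_in\<close> is a copy of \<open>C\<close> on a set of reals, followed by the
  projection.\<close>

lemma analytic_inI:
  fixes f :: "(nat \<Rightarrow> nat) \<Rightarrow> 'b"
  assumes S: "S \<in> sets baire" "S \<noteq> {}" and f: "f \<in> restrict_space baire S \<rightarrow>\<^sub>M N"
  shows "analytic_in N (f ` S)"
proof -
  obtain C :: "((nat \<Rightarrow> nat) \<times> (nat \<Rightarrow> nat)) set" where C: "closed C" "S = fst ` C"
    using sets_baire_suslin[OF S(1)] unfolding suslin_def by blast
  define \<iota> where "\<iota> p = (\<lambda>i. real (fst p i), \<lambda>i. real (snd p i))"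
    for p :: "(nat \<Rightarrow> nat) \<times> (nat \<Rightarrow> nat)"
  define m where "m = submetric euclidean_metric (\<iota> ` C)"
  have mspace: "mspace m = \<iota> ` C" by (simp add: m_def)
  have closed: "closed (\<iota> ` C)" unfolding \<iota>_def by (rule closed_real_image[OF C(1)])
  have "C \<noteq> {}" using S(2) C(2) by blast
  then have "\<iota> ` C \<in> closed_subsets euclidean_metric"
    using closed by (simp add: closed_subsets_def)
  moreover have "mcomplete_of (euclidean_metric :: ((nat \<Rightarrow> real) \<times> (nat \<Rightarrow> real)) metric)"
    by (simp add: mcomplete_of_def complete_UNIV)
  ultimately have "mcomplete_of m" unfolding m_def by (rule closed_subset_complete[rotated])
  moreover have "separable_space (mtopology_of m)"
    unfolding m_def mtopology_of_submetric mtopology_of_euclidean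
    by (intro second_countable_imp_separable_space second_countable_subtopology
        second_countable_euclidean)
  ultimately have "polish_metric m" using \<open>C \<noteq> {}\<close> by (simp add: polish_metric_def mspace)
  then obtain m' :: "real metric" and h where m': "polish_metric m'" "isometry_onto m m' h"
    by (rule polish_metric_real_copy)
  define T where "T = mtopology_of m'"
  define g where "g = inv_into (mspace m) h"
  \<comment> \<open>Points of the copy lead back to real-valued sequences with natural entries; the
    floor recovers the first component as a sequence of naturals.\<close>
  define k where "k t = (\<lambda>i. nat \<lfloor>fst (g t) i\<rfloor>)" for t
  have g: "g t \<in> \<iota> ` C" if "t \<in> mspace m'" for t
    using m'(2) that by (auto simp: g_def isometry_onto_def mspace[symmetric] inv_into_into)
  have kC: "\<exists>p\<in>C. k t = fst p \<and> g t = \<iota> p" if t: "t \<in> mspace m'" for t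
  proof -
    obtain p where "p \<in> C" "g t = \<iota> p" using g[OF t] by blast
    then show ?thesis by (intro bexI[of _ p]) (auto simp: k_def \<iota>_def)
  qed
  have "(\<lambda>t. k t i) \<in> borel_of_topology T \<rightarrow>\<^sub>M count_space UNIV" for i
    unfolding measurable_count_space_eq2_countable
  proof (intro conjI ballI)
    fix c :: nat
    \<comment> \<open>Among natural numbers the open interval of radius 1/2 around \<open>c\<close>
      contains only \<open>c\<close>, so \<open>k t i = c\<close> becomes an open condition.\<close>
    define O' where "O' = {p :: (nat \<Rightarrow> real) \<times> (nat \<Rightarrow> real). fst p i \<in> {real c - 1/2 <..< real c + 1/2}}"
    have "O' = (\<lambda>p. fst p i) -` {real c - 1/2 <..< real c + 1/2}" by (auto simp: O'_def)
    moreover have "continuous_on UNIV (\<lambda>p :: (nat \<Rightarrow> real) \<times> (nat \<Rightarrow> real). fst p i)"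
      by (rule continuous_on_product_then_coordinatewise[OF continuous_on_fst[OF continuous_on_id]])
    ultimately have "open O'" by (simp add: open_vimage)
    then have "openin (mtopology_of m) (\<iota> ` C \<inter> O')"
      unfolding m_def mtopology_of_submetric mtopology_of_euclidean openin_subtopology
      by (auto simp: Int_commute)
    from isometry_onto_inverse_openin[OF m'(2) this]
    have "{t \<in> mspace m'. g t \<in> \<iota> ` C \<inter> O'} \<in> sets (borel_of_topology T)"
      unfolding g_def[symmetric] T_def by (rule open_in_sets_borel_of_topology)
    moreover have "k t i = c \<longleftrightarrow> g t \<in> \<iota> ` C \<inter> O'" if t: "t \<in> mspace m'" for t
    proof -
      obtain p where p: "p \<in> C" "k t = fst p" "g t = \<iota> p" using kC[OF t] by blast
      have "k t i = c \<longleftrightarrow> real (fst p i) \<in> {real c - 1/2 <..< real c + 1/2}"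
        unfolding p(2) greaterThanLessThan_iff by linarith
      then show ?thesis using p by (auto simp: O'_def \<iota>_def)
    qed
    then have "(\<lambda>t. k t i) -` {c} \<inter> space (borel_of_topology T) = {t \<in> mspace m'. g t \<in> \<iota> ` C \<inter> O'}"
      by (auto simp: T_def)
    ultimately show "(\<lambda>t. k t i) -` {c} \<inter> space (borel_of_topology T) \<in> sets (borel_of_topology T)"
      by simp
  qed auto
  then have "k \<in> borel_of_topology T \<rightarrow>\<^sub>M baire"
    by (intro measurable_PiM_single') (auto simp: PiE_UNIV_domain)
  moreover have "k \<in> space (borel_of_topology T) \<rightarrow> S"
    using kC C(2) by (force simp: T_def)
  ultimately have "k \<in> borel_of_topology T \<rightarrow>\<^sub>M restrict_space baire S"
    by (intro measurable_restrict_space2)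
  then have "f \<circ> k \<in> borel_of_topology T \<rightarrow>\<^sub>M N" using f by (rule measurable_comp)
  moreover have "k ` mspace m' = S"
  proof (intro equalityI subsetI)
    fix x assume "x \<in> k ` mspace m'"
    then show "x \<in> S" using kC C(2) by force
  next
    fix x assume "x \<in> S"
    then obtain p where p: "p \<in> C" "x = fst p" using C(2) by blast
    have inj: "inj_on h (mspace m)"
    proof (rule inj_onI)
      fix u v assume uv: "u \<in> mspace m" "v \<in> mspace m" "h u = h v"
      have "mdist m' (h u) (h v) = mdist m u v" "h u \<in> mspace m'"
        using m'(2) uv(1,2) by (auto simp: isometry_onto_def isometric_embedding_def)
      then have "mdist m u v = 0" using uv(3) by simp
      then show "u = v" using uv(1,2) by simp
    qed
    have pm: "\<iota> p \<in> mspace m" using p(1) by (simp add: mspace)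
    have "g (h (\<iota> p)) = \<iota> p" unfolding g_def by (rule inv_into_f_f[OF inj pm])
    then have "k (h (\<iota> p)) = x" using p(2) by (simp add: k_def \<iota>_def)
    moreover have "h (\<iota> p) \<in> mspace m'"
      using m'(2) pm by (auto simp: isometry_onto_def isometric_embedding_def)
    ultimately show "x \<in> k ` mspace m'" by blast
  qed
  then have "(f \<circ> k) ` topspace T = f ` S" by (metis T_def image_comp topspace_mtopology_of)
  ultimately show ?thesis
    unfolding analytic_in_def using polish_topology_mtopology_of[OF m'(1)] T_def by blast
qed

text \<open>Replaces points of a Polish space by sequences of naturals with Borel control. The
  explicit rate allows distances of coded points to be estimated from finitely many entries of their
  codes.\<close>

lemma polish_coding:
  assumes "polish_metric m"
  obtains D :: "(nat \<Rightarrow> nat) set" and q y where "D \<in> sets baire" "q ` D = mspace m"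
    "range y \<subseteq> mspace m" "\<And>z n. z \<in> D \<Longrightarrow> mdist m (y (z n)) (q z) \<le> 2 * (1/2) ^ n"
    "\<And>W. openin (mtopology_of m) W \<Longrightarrow> {z \<in> D. q z \<in> W} \<in> sets baire"
proof -
  have complete: "mcomplete_of m" using assms by (simp add: polish_metric_def)
  obtain y :: "nat \<Rightarrow> _" where y: "range y \<subseteq> mspace m"
    "\<And>x \<epsilon>. x \<in> mspace m \<Longrightarrow> \<epsilon> > 0 \<Longrightarrow> \<exists>n. mdist m x (y n) < \<epsilon>"
    using polish_dense_sequence[OF assms order_refl] assms
    unfolding polish_metric_def by metis
  have ym: "y n \<in> mspace m" for n using y(1) by blast
  (* z codes the limit of the sequence y (z n), which is required to converge geometrically. *)
  define D where "D = {z :: nat \<Rightarrow> nat. \<forall>n. mdist m (y (z n)) (y (z (Suc n))) \<le> (1/2) ^ n}"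
  have "\<exists>l. l \<in> mspace m \<and> (\<forall>n. mdist m (y (z n)) l \<le> 2 * (1/2) ^ n)" if "z \<in> D" for z
  proof -
    have "range (\<lambda>n. y (z n)) \<subseteq> mspace m" using ym by blast
    moreover have "mdist m (y (z n)) (y (z (Suc n))) \<le> 1 * (1/2) ^ n" for n
      using that by (simp add: D_def)
    ultimately obtain l where "l \<in> mspace m" "\<And>n. mdist m (y (z n)) l \<le> 2 * 1 * (1/2) ^ n"
      using geometric_limit[OF complete, of "\<lambda>n. y (z n)" 1] by blast
    then show ?thesis by auto
  qed
  then obtain q where q: "\<And>z. z \<in> D \<Longrightarrow> q z \<in> mspace m"
    "\<And>z n. z \<in> D \<Longrightarrow> mdist m (y (z n)) (q z) \<le> 2 * (1/2) ^ n" by metis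
  \<comment> \<open>With the values \<open>c\<close> and \<open>d\<close> named, the condition is a
    countable combination of conditions on single coordinates.\<close>
  have D_eq: "D = {z \<in> space baire. \<forall>n. \<exists>c d. mdist m (y c) (y d) \<le> (1/2) ^ n \<and> z n = c \<and> z (Suc n) = d}"
    by (auto simp: D_def space_baire)
  have D: "D \<in> sets baire" unfolding D_eq by measurable
  have surj: "mspace m \<subseteq> q ` D"
  proof
    fix x assume x: "x \<in> mspace m"
    have "\<exists>c. mdist m x (y c) < (1/2) ^ Suc n" for n by (rule y(2)[OF x]) simp
    \<comment> \<open>Precision \<open>(1/2) ^ Suc n\<close> at step \<open>n\<close> keeps
      consecutive choices within \<open>(1/2) ^ n\<close>, so \<open>z\<close> is an admissible
      code.\<close>
    then obtain z where z: "\<And>n. mdist m x (y (z n)) < (1/2) ^ Suc n" by metis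
    have "mdist m (y (z n)) (y (z (Suc n))) \<le> (1/2) ^ n" for n
    proof -
      have "mdist m (y (z n)) (y (z (Suc n))) \<le> mdist m x (y (z n)) + mdist m x (y (z (Suc n)))"
        using mdist_triangle[OF ym x ym, of "z n" "z (Suc n)"] mdist_commute[of m x "y (z n)"] by simp
      also have "\<dots> \<le> (1/2) ^ Suc n + (1/2) ^ Suc (Suc n)"
        using z[of n] z[of "Suc n"] by linarith
      also have "\<dots> \<le> (1/2) ^ n" by simp
      finally show ?thesis .
    qed
    then have zD: "z \<in> D" by (simp add: D_def)
    have "x = q z"
    proof (rule mdist_small_imp_eq[OF x q(1)[OF zD]])
      fix \<epsilon> :: real assume "\<epsilon> > 0"
      then obtain n where n: "3 * (1/2) ^ n < \<epsilon>" using half_power_small by blast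
      have "mdist m x (q z) \<le> mdist m x (y (z n)) + mdist m (y (z n)) (q z)"
        by (rule mdist_triangle[OF x ym q(1)[OF zD]])
      moreover have "(1/2 :: real) ^ Suc n \<le> (1/2) ^ n" by simp
      ultimately show "mdist m x (q z) < \<epsilon>" using n z[of n] q(2)[OF zD, of n] by linarith
    qed
    then show "x \<in> q ` D" using zD by blast
  qed
  have "{z \<in> D. q z \<in> W} \<in> sets baire" if W: "openin (mtopology_of m) W" for W
  proof -
    \<comment> \<open>Entry \<open>z n\<close> certifies that the limit is in \<open>W\<close> if
      the ball of radius \<open>2 * (1/2) ^ n\<close> around its point lies in \<open>W\<close>,
      since the rate puts the limit into this ball. For open \<open>W\<close> some entry of the code
      is such a certificate.\<close>
    define K where "K n = {c. \<forall>v\<in>mspace m. mdist m (y c) v \<le> 2 * (1/2) ^ n \<longrightarrow> v \<in> W}" for n :: nat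
    have "q z \<in> W \<longleftrightarrow> (\<exists>n. \<exists>c. c \<in> K n \<and> z n = c)" if zD: "z \<in> D" for z
    proof
      assume "q z \<in> W"
      then obtain r where r: "r > 0" "\<And>v. v \<in> mspace m \<Longrightarrow> mdist m (q z) v < r \<Longrightarrow> v \<in> W"
        using openin_metricD[OF W] by blast
      obtain n where n: "4 * (1/2) ^ n < r" using half_power_small[OF r(1)] by blast
      have "v \<in> W" if v: "v \<in> mspace m" "mdist m (y (z n)) v \<le> 2 * (1/2) ^ n" for v
      proof -
        have "mdist m (q z) v \<le> mdist m (y (z n)) (q z) + mdist m (y (z n)) v"
          using mdist_triangle[OF q(1)[OF zD] ym v(1), of "z n"] mdist_commute[of m "q z" "y (z n)"]
          by simp
        then have "mdist m (q z) v < r" using v(2) q(2)[OF zD, of n] n by linarith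
        then show ?thesis using r(2) v(1) by blast
      qed
      then show "\<exists>n. \<exists>c. c \<in> K n \<and> z n = c" unfolding K_def by blast
    next
      assume "\<exists>n. \<exists>c. c \<in> K n \<and> z n = c"
      then show "q z \<in> W" using q[OF zD] unfolding K_def by blast
    qed
    then have "{z \<in> D. q z \<in> W} = D \<inter> {z \<in> space baire. \<exists>n. \<exists>c. c \<in> K n \<and> z n = c}"
      by (auto simp: space_baire)
    moreover have "{z \<in> space baire. \<exists>n. \<exists>c. c \<in> K n \<and> z n = c} \<in> sets baire" by measurable
    ultimately show ?thesis using sets.Int[OF D] by simp
  qed
  then show thesis using that[OF D _ y(1) q(2)] surj q(1) by blast
qed

subsection \<open>Analyticity of \<open>V U A\<close>\<close>

text \<open>Turns equality of closed sets into countably many conditions, each measurable in both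
  sets.\<close>

lemma effros_eqI:
  assumes q: "range q \<subseteq> mspace U" "\<And>x \<epsilon>. x \<in> mspace U \<Longrightarrow> \<epsilon> > 0 \<Longrightarrow> \<exists>n::nat. mdist U x (q n) < \<epsilon>"
    and XY: "X \<in> closed_subsets U" "Y \<in> closed_subsets U"
    and hits: "\<And>i k. X \<inter> {y \<in> mspace U. mdist U (q i) y < 1 / real (Suc k)} \<noteq> {} \<longleftrightarrow>
      Y \<inter> {y \<in> mspace U. mdist U (q i) y < 1 / real (Suc k)} \<noteq> {}"
  shows "X = Y"
proof -
  have qm: "q n \<in> mspace U" for n using q(1) by blast
  have sub: "X' \<subseteq> Y'" if X': "X' \<in> closed_subsets U" and Y': "Y' \<in> closed_subsets U"
    and hits: "\<And>i k. X' \<inter> {y \<in> mspace U. mdist U (q i) y < 1 / real (Suc k)} \<noteq> {} \<Longrightarrow>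
      Y' \<inter> {y \<in> mspace U. mdist U (q i) y < 1 / real (Suc k)} \<noteq> {}" for X' Y'
  proof
    fix x assume x: "x \<in> X'"
    have xm: "x \<in> mspace U" using closed_subsets_subset[OF X'] x by blast
    show "x \<in> Y'"
    proof (rule closed_subsetsD[OF Y' xm])
      fix \<epsilon> :: real assume "\<epsilon> > 0"
      then obtain k where "inverse (real (Suc k)) < \<epsilon> / 2" using reals_Archimedean[of "\<epsilon> / 2"] by auto
      then have k: "1 / real (Suc k) < \<epsilon> / 2" by (simp only: inverse_eq_divide)
      have k0: "1 / real (Suc k) > 0" by simp
      obtain i where i: "mdist U x (q i) < 1 / real (Suc k)" using q(2)[OF xm k0] by blast
      have "mdist U (q i) x < 1 / real (Suc k)" using i mdist_commute[of U x "q i"] by simp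
      then have "X' \<inter> {y \<in> mspace U. mdist U (q i) y < 1 / real (Suc k)} \<noteq> {}"
        using x xm by blast
      from hits[OF this] obtain y where y: "y \<in> Y'" "y \<in> mspace U" "mdist U (q i) y < 1 / real (Suc k)"
        by blast
      have "mdist U x y < \<epsilon>" using mdist_triangle[OF xm qm[of i] y(2)] i y(3) k by linarith
      then show "\<exists>s\<in>Y'. mdist U x s < \<epsilon>" using y(1) by blast
    qed
  qed
  show ?thesis using sub[OF XY] sub[OF XY(2,1)] hits by blast
qed

lemma measurable_baireI:
  "(\<And>i. (\<lambda>w. f w i) \<in> M \<rightarrow>\<^sub>M count_space UNIV) \<Longrightarrow> f \<in> M \<rightarrow>\<^sub>M baire"
  by (intro measurable_PiM_single') (auto simp: PiE_UNIV_domain)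

lemma measurable_baire_decode:
  "(\<lambda>w. fst (prod_decode (w i))) \<in> baire \<rightarrow>\<^sub>M count_space UNIV"
  "(\<lambda>w. snd (prod_decode (w i))) \<in> baire \<rightarrow>\<^sub>M count_space UNIV"
  by (rule measurable_compose[OF measurable_component_singleton]; simp)+

text \<open>If \<open>V U A\<close> is the image of \<open>f\<close>, then \<open>g x\<close>
  belongs to it iff some code \<open>z\<close> satisfies \<open>f (c z) = g x\<close>. This is the
  projection of a Borel set of pairs, so the preimage under \<open>g\<close> would be
  Suslin.\<close>

lemma V_analytic_imp:
  assumes U: "urysohn_space U" and A: "distance_set A" and an: "analytic_in (effros U) (V U A)"
    and ne: "V U A \<noteq> {}"
  shows "closed A \<or> \<not> 0 islimpt A"
proof (rule ccontr)
  assume "\<not> ?thesis"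
  then obtain g where g: "g \<in> baire \<rightarrow>\<^sub>M effros U" "\<not> suslin {x. g x \<in> V U A}"
    using V_not_suslin_reducible[OF U A] by blast
  obtain T :: "real topology" and f where T: "polish_topology T"
    "f \<in> borel_of_topology T \<rightarrow>\<^sub>M effros U" "f ` topspace T = V U A"
    using an unfolding analytic_in_def by blast
  obtain m where m: "polish_metric m" "mtopology_of m = T"
    using polish_topologyE[OF T(1)] T(3) ne by blast
  obtain D c y where D: "D \<in> sets baire" "c ` D = mspace m"
    "\<And>W. openin (mtopology_of m) W \<Longrightarrow> {z \<in> D. c z \<in> W} \<in> sets baire"
    by (rule polish_coding[OF m(1)]) blast
  have spD: "space (restrict_space baire D) = D" by (simp add: space_restrict_space space_baire)
  have "c \<in> restrict_space baire D \<rightarrow>\<^sub>M borel_of_topology T"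
    unfolding borel_of_topology_def
  proof (rule measurable_measure_of)
    show "{W. openin T W} \<subseteq> Pow (topspace T)" using openin_subset by blast
    show "c \<in> space (restrict_space baire D) \<rightarrow> topspace T"
      unfolding spD using D(2) m(2) by (auto simp: topspace_mtopology_of[of m, symmetric] simp del: topspace_mtopology_of)
    fix W assume "W \<in> {W. openin T W}"
    then have "{z \<in> D. c z \<in> W} \<in> sets baire" using D(3) m(2) by simp
    moreover have "c -` W \<inter> space (restrict_space baire D) = {z \<in> D. c z \<in> W}"
      unfolding spD by blast
    ultimately show "c -` W \<inter> space (restrict_space baire D) \<in> sets (restrict_space baire D)"
      using D(1) by (subst sets_restrict_space_iff) (auto simp: space_baire)
  qed
  then have fc: "f \<circ> c \<in> restrict_space baire D \<rightarrow>\<^sub>M effros U" using T(2) by (rule measurable_comp)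
  have UP: "polish_metric U" using U by (simp add: urysohn_space_def)
  obtain q :: "nat \<Rightarrow> _" where q: "range q \<subseteq> mspace U"
    "\<And>x \<epsilon>. x \<in> mspace U \<Longrightarrow> \<epsilon> > 0 \<Longrightarrow> \<exists>n. mdist U x (q n) < \<epsilon>"
    using polish_dense_sequence[OF UP order_refl] UP
    unfolding polish_metric_def by metis
  have qm: "q n \<in> mspace U" for n using q(1) by blast
  define B where "B i k = {y \<in> mspace U. mdist U (q i) y < 1 / real (Suc k)}" for i k
  define hit where "hit i k = {X \<in> closed_subsets U. X \<inter> B i k \<noteq> {}}" for i k
  have hit: "hit i k \<in> sets (effros U)" for i k
    unfolding hit_def B_def by (rule hit_in_sets_effros[OF openin_mball_of[OF qm]])
  define Z where "Z i k = {z \<in> D. f (c z) \<in> hit i k}" for i k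
  define Xs where "Xs i k = {x. g x \<in> hit i k}" for i k
  have Z [measurable]: "Z i k \<in> sets baire" for i k
  proof -
    have "Z i k = (f \<circ> c) -` hit i k \<inter> space (restrict_space baire D)"
      unfolding spD Z_def by auto
    then have "Z i k \<in> sets (restrict_space baire D)" using measurable_sets[OF fc hit] by simp
    then show ?thesis using D(1) by (subst (asm) sets_restrict_space_iff) (auto simp: space_baire)
  qed
  have Xs [measurable]: "Xs i k \<in> sets baire" for i k
  proof -
    have "Xs i k = g -` hit i k \<inter> space baire" by (auto simp: Xs_def space_baire)
    then show ?thesis using measurable_sets[OF g(1) hit] by simp
  qed
  note D(1) [measurable]
  define l r :: "(nat \<Rightarrow> nat) \<Rightarrow> nat \<Rightarrow> nat" where
    "l w = (\<lambda>i. fst (prod_decode (w i)))" and "r w = (\<lambda>i. snd (prod_decode (w i)))" for w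
  have lr [measurable]: "l \<in> baire \<rightarrow>\<^sub>M baire" "r \<in> baire \<rightarrow>\<^sub>M baire"
    unfolding l_def r_def by (intro measurable_baireI measurable_baire_decode)+
  \<comment> \<open>A sequence \<open>w\<close> codes the pair of \<open>l w = x\<close> and
    \<open>r w = z\<close>; the last conjunct says that \<open>f (c z)\<close> and
    \<open>g x\<close> meet the same balls.\<close>
  define E where "E = {w \<in> space baire. r w \<in> D \<and> (\<forall>i k. r w \<in> Z i k \<longleftrightarrow> l w \<in> Xs i k)}"
  have "E \<in> sets baire" unfolding E_def by measurable
  then have "suslin {x. \<exists>z. (\<lambda>i. prod_encode (x i, z i)) \<in> E}"
    by (intro suslin_projection sets_baire_suslin)
  moreover have "(\<exists>z. (\<lambda>i. prod_encode (x i, z i)) \<in> E) \<longleftrightarrow> g x \<in> V U A" for x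
  proof -
    have gc: "g x \<in> closed_subsets U" using measurable_space[OF g(1), of x] by (simp add: space_baire)
    have fcc: "f (c z) \<in> closed_subsets U" if "z \<in> D" for z
      using measurable_space[OF fc, of z] that by (simp add: spD)
    have "(\<lambda>i. prod_encode (x i, z i)) \<in> E \<longleftrightarrow> z \<in> D \<and> f (c z) = g x" for z
    proof -
      have "(\<lambda>i. prod_encode (x i, z i)) \<in> E \<longleftrightarrow> z \<in> D \<and> (\<forall>i k. z \<in> Z i k \<longleftrightarrow> x \<in> Xs i k)"
        by (simp add: E_def l_def r_def space_baire)
      also have "\<dots> \<longleftrightarrow> z \<in> D \<and> (\<forall>i k. f (c z) \<inter> B i k \<noteq> {} \<longleftrightarrow> g x \<inter> B i k \<noteq> {})"
      proof (rule conj_cong[OF refl])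
        assume "z \<in> D"
        then have "z \<in> Z i k \<longleftrightarrow> f (c z) \<inter> B i k \<noteq> {}" "x \<in> Xs i k \<longleftrightarrow> g x \<inter> B i k \<noteq> {}" for i k
          using fcc gc by (simp_all add: Z_def Xs_def hit_def)
        then show "(\<forall>i k. z \<in> Z i k \<longleftrightarrow> x \<in> Xs i k) \<longleftrightarrow>
            (\<forall>i k. f (c z) \<inter> B i k \<noteq> {} \<longleftrightarrow> g x \<inter> B i k \<noteq> {})" by (simp only:)
      qed
      also have "\<dots> \<longleftrightarrow> z \<in> D \<and> f (c z) = g x"
        using effros_eqI[OF q fcc gc] unfolding B_def by blast
      finally show ?thesis .
    qed
    moreover have "V U A = (\<lambda>z. f (c z)) ` D"
      using T(3) m(2) D(2) by (metis image_image topspace_mtopology_of)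
    ultimately show ?thesis by auto
  qed
  ultimately show False using g(2) by simp
qed

text \<open>A closed \<open>Y\<close> is in \<open>V U A\<close> iff some dense sequence of
  \<open>Y\<close> has an isometric copy in \<open>X\<close>: one direction is universality, the
  other extends the copying map to \<open>Y\<close>. Such pairs of sequences form a Borel set of
  codes.\<close>

lemma polish_universal_imp_analytic:
  fixes U :: "'u metric"
  assumes U: "polish_metric U" and X: "polish_universal U A X"
  shows "analytic_in (effros U) (V U A)"
proof -
  have complete: "mcomplete_of U" using U by (simp add: polish_metric_def)
  have XV: "X \<in> V U A" using X by (simp add: polish_universal_def)
  then have Xc: "X \<in> closed_subsets U" by (simp add: V_iff)
  have Xsub: "X \<subseteq> mspace U" "X \<noteq> {}" using Xc by (auto simp: closed_subsets_iff)
  let ?X = "submetric U X"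
  note Xm = submetric_closed_mspace[OF Xc]
  have "separable_space (mtopology_of ?X)"
    using polish_topology_mtopology_of[OF U] unfolding polish_topology_def mtopology_of_submetric
    by (intro second_countable_imp_separable_space second_countable_subtopology) blast
  then have PX: "polish_metric ?X"
    using closed_subset_complete[OF complete Xc] Xm Xsub(2) by (simp add: polish_metric_def del: mspace_submetric)
  obtain D1 c1 y1 where D1: "D1 \<in> sets baire" "c1 ` D1 = mspace U" "range y1 \<subseteq> mspace U"
    "\<And>z n. z \<in> D1 \<Longrightarrow> mdist U (y1 (z n)) (c1 z) \<le> 2 * (1/2) ^ n"
    "\<And>W. openin (mtopology_of U) W \<Longrightarrow> {z \<in> D1. c1 z \<in> W} \<in> sets baire"
    by (rule polish_coding[OF U]) blast
  obtain D2 c2 y2 where D2: "D2 \<in> sets baire" "c2 ` D2 = mspace ?X" "range y2 \<subseteq> mspace ?X"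
    "\<And>z n. z \<in> D2 \<Longrightarrow> mdist ?X (y2 (z n)) (c2 z) \<le> 2 * (1/2) ^ n"
    by (rule polish_coding[OF PX]) blast
  have mem1: "c1 z \<in> mspace U" if "z \<in> D1" for z using D1(2) that by blast
  have mem2: "c2 z \<in> X" if "z \<in> D2" for z using D2(2) that unfolding Xm by blast
  have y1m: "y1 n \<in> mspace U" for n using D1(3) by blast
  have y2m: "y2 n \<in> mspace U" for n using D2(3) Xsub(1) unfolding Xm by blast
  \<comment> \<open>A single sequence \<open>w\<close> holds countably many pairs of codes:
    \<open>s w i\<close> for the \<open>i\<close>-th point in \<open>U\<close>, \<open>t w i\<close>
    for its partner in \<open>X\<close>.\<close>
  define s t where "s w i = (\<lambda>n. fst (prod_decode (w (prod_encode (i, n)))))"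
    and "t w i = (\<lambda>n. snd (prod_decode (w (prod_encode (i, n)))))"
    for w :: "nat \<Rightarrow> nat" and i :: nat
  have st [measurable]: "(\<lambda>w. s w i) \<in> baire \<rightarrow>\<^sub>M baire" "(\<lambda>w. t w i) \<in> baire \<rightarrow>\<^sub>M baire" for i
    unfolding s_def t_def by (intro measurable_baireI measurable_baire_decode)+
  (* Equality of the distances of coded points, expressed by approximants so that only countably
     many values occur. *)
  define S where "S = {w \<in> space baire. (\<forall>i. s w i \<in> D1 \<and> t w i \<in> D2) \<and>
    (\<forall>i j n. \<exists>a b c d. \<bar>mdist U (y1 a) (y1 b) - mdist U (y2 c) (y2 d)\<bar> \<le> 8 * (1/2) ^ n \<and>
      s w i n = a \<and> s w j n = b \<and> t w i n = c \<and> t w j n = d)}"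
  note D1(1) [measurable] D2(1) [measurable]
  have sn [measurable]: "(\<lambda>w. s w i n) \<in> baire \<rightarrow>\<^sub>M count_space UNIV"
    "(\<lambda>w. t w i n) \<in> baire \<rightarrow>\<^sub>M count_space UNIV" for i n
    unfolding s_def t_def by (rule measurable_baire_decode)+
  have Sm: "S \<in> sets baire" unfolding S_def by measurable
  have S: "w \<in> S \<longleftrightarrow> (\<forall>i. s w i \<in> D1 \<and> t w i \<in> D2) \<and>
      (\<forall>i j. mdist U (c1 (s w i)) (c1 (s w j)) = mdist U (c2 (t w i)) (c2 (t w j)))" for w
  proof (cases "\<forall>i. s w i \<in> D1 \<and> t w i \<in> D2")
    case True
    \<comment> \<open>Each coded point is within \<open>2 * (1/2) ^ n\<close> of its
      \<open>n\<close>-th approximant and a distance involves two points, hence 4; comparing two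
      distances gives the 8 in \<open>S\<close>.\<close>
    have near: "\<bar>mdist U (y1 (s w i n)) (y1 (s w j n)) - mdist U (c1 (s w i)) (c1 (s w j))\<bar> \<le> 4 * (1/2) ^ n"
      "\<bar>mdist U (y2 (t w i n)) (y2 (t w j n)) - mdist U (c2 (t w i)) (c2 (t w j))\<bar> \<le> 4 * (1/2) ^ n"
      for i j n
    proof -
      have m: "c1 (s w i) \<in> mspace U" "c1 (s w j) \<in> mspace U" "c2 (t w i) \<in> mspace U" "c2 (t w j) \<in> mspace U"
        using True mem1 mem2 Xsub(1) by auto
      show "\<bar>mdist U (y1 (s w i n)) (y1 (s w j n)) - mdist U (c1 (s w i)) (c1 (s w j))\<bar> \<le> 4 * (1/2) ^ n"
        using mdist_perturb[OF y1m[of "s w i n"] y1m[of "s w j n"] m(1,2)]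
          D1(4)[of "s w i" n] D1(4)[of "s w j" n] True by force
      show "\<bar>mdist U (y2 (t w i n)) (y2 (t w j n)) - mdist U (c2 (t w i)) (c2 (t w j))\<bar> \<le> 4 * (1/2) ^ n"
        using mdist_perturb[OF y2m[of "t w i n"] y2m[of "t w j n"] m(3,4)]
          D2(4)[of "t w i" n] D2(4)[of "t w j" n] True by force
    qed
    have "(\<forall>n. \<bar>mdist U (y1 (s w i n)) (y1 (s w j n)) - mdist U (y2 (t w i n)) (y2 (t w j n))\<bar> \<le> 8 * (1/2) ^ n)
      \<longleftrightarrow> mdist U (c1 (s w i)) (c1 (s w j)) = mdist U (c2 (t w i)) (c2 (t w j))"
      (is "?L \<longleftrightarrow> ?R") for i j
    proof
      assume L: ?L
      show ?R
      proof (rule ccontr)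
        let ?\<delta> = "\<bar>mdist U (c1 (s w i)) (c1 (s w j)) - mdist U (c2 (t w i)) (c2 (t w j))\<bar>"
        assume "\<not> ?R"
        then have "?\<delta> > 0" by simp
        \<comment> \<open>The 8 permitted by \<open>S\<close> and the error 4 on each side sum to
          16.\<close>
        then obtain n where "16 * (1/2) ^ n < ?\<delta>" using half_power_small by blast
        then show False using near[where i = i and j = j and n = n] L[rule_format, of n] by linarith
      qed
    next
      assume R: ?R
      show ?L
      proof
        fix n
        show "\<bar>mdist U (y1 (s w i n)) (y1 (s w j n)) - mdist U (y2 (t w i n)) (y2 (t w j n))\<bar> \<le> 8 * (1/2) ^ n"
          using near[where i = i and j = j and n = n] R by linarith
      qed
    qed
    then show ?thesis using True by (simp add: S_def space_baire)
  qed (auto simp: S_def)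
  define F where "F w = mclosure U (range (\<lambda>i. c1 (s w i)))" for w
  have rng: "range (\<lambda>i. c1 (s w i)) \<subseteq> mspace U" if "w \<in> S" for w
    using that S mem1 by blast
  have Fc: "F w \<in> closed_subsets U" if "w \<in> S" for w
    unfolding F_def by (rule mclosure_closed[OF rng[OF that]]) auto
  have spS: "space (restrict_space baire S) = S" by (simp add: space_restrict_space space_baire)
  have "F \<in> restrict_space baire S \<rightarrow>\<^sub>M effros U"
    unfolding effros_def
  proof (rule measurable_measure_of)
    show "F \<in> space (restrict_space baire S) \<rightarrow> closed_subsets U" unfolding spS using Fc by blast
    fix Y assume "Y \<in> {{X \<in> closed_subsets U. X \<inter> W \<noteq> {}} |W. openin (mtopology_of U) W}"
    then obtain W where W: "openin (mtopology_of U) W" "Y = {X \<in> closed_subsets U. X \<inter> W \<noteq> {}}"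
      by blast
    have ZW [measurable]: "{z \<in> D1. c1 z \<in> W} \<in> sets baire" by (rule D1(5)[OF W(1)])
    have "F w \<in> Y \<longleftrightarrow> (\<exists>i. s w i \<in> {z \<in> D1. c1 z \<in> W})" if "w \<in> S" for w
    proof -
      have "F w \<in> Y \<longleftrightarrow> F w \<inter> W \<noteq> {}" using Fc[OF that] W(2) by blast
      also have "\<dots> \<longleftrightarrow> range (\<lambda>i. c1 (s w i)) \<inter> W \<noteq> {}"
        unfolding F_def by (rule mclosure_meets_open[OF rng[OF that] W(1)])
      also have "\<dots> \<longleftrightarrow> (\<exists>i. c1 (s w i) \<in> W)" by blast
      finally show ?thesis using that S by simp
    qed
    then have "F -` Y \<inter> space (restrict_space baire S) =
        S \<inter> {w \<in> space baire. \<exists>i. s w i \<in> {z \<in> D1. c1 z \<in> W}}"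
      unfolding spS by (auto simp: space_baire)
    moreover have "{w \<in> space baire. \<exists>i. s w i \<in> {z \<in> D1. c1 z \<in> W}} \<in> sets baire" by measurable
    ultimately show "F -` Y \<inter> space (restrict_space baire S) \<in> sets (restrict_space baire S)"
      using Sm by (subst sets_restrict_space_iff) (auto simp: space_baire)
  qed auto
  moreover have FS: "F ` S = V U A"
  proof (intro equalityI subsetI)
    fix Y assume "Y \<in> F ` S"
    then obtain w where w: "w \<in> S" "Y = F w" by blast
    have Yc: "Y \<in> closed_subsets U" using Fc w by blast
    note Ym = submetric_closed_mspace[OF Yc]
    define R where "R = range (\<lambda>i. (c1 (s w i), c2 (t w i)))"
    have sub: "range (\<lambda>i. c1 (s w i)) \<subseteq> Y" unfolding w(2) F_def by (rule mclosure_superset[OF rng[OF w(1)]])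
    have c2X: "c2 (t w i) \<in> X" for i using w(1) S mem2 by blast
    have iso: "partial_isometry (submetric U Y) ?X R"
      using sub c2X w(1) S unfolding partial_isometry_def R_def Ym Xm by auto
    have dense: "\<exists>(a, b)\<in>R. mdist (submetric U Y) x a < \<epsilon>"
      if "x \<in> mspace (submetric U Y)" "\<epsilon> > 0" for x \<epsilon>
      using that unfolding Ym w(2) F_def mclosure_def R_def by auto
    obtain h where h: "isometric_embedding (submetric U Y) ?X h"
      by (rule partial_isometry_extend[OF iso dense closed_subset_complete[OF complete Xc]])
    have "mdist U u v \<in> A" if "u \<in> Y" "v \<in> Y" for u v
    proof -
      have "mdist U (h u) (h v) = mdist U u v" "h u \<in> X" "h v \<in> X"
        using h that unfolding isometric_embedding_def Ym Xm by auto
      then show ?thesis using XV unfolding V_iff by metis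
    qed
    then show "Y \<in> V U A" using Yc by (simp add: V_iff)
  next
    fix Y assume Y: "Y \<in> V U A"
    then have Yc: "Y \<in> closed_subsets U" by (simp add: V_iff)
    note Ym = submetric_closed_mspace[OF Yc]
    have Ysub: "Y \<subseteq> mspace U" "Y \<noteq> {}" using Yc by (auto simp: closed_subsets_iff)
    obtain h where h: "isometric_embedding (submetric U Y) ?X h"
      using X Y by (auto simp: polish_universal_def isometrically_embeds_def)
    then have hX: "h u \<in> X" "\<And>v. v \<in> Y \<Longrightarrow> mdist U (h u) (h v) = mdist U u v" if "u \<in> Y" for u
      using that unfolding isometric_embedding_def Ym Xm by auto
    obtain y :: "nat \<Rightarrow> 'u" where y: "range y \<subseteq> Y" "\<And>x \<epsilon>. x \<in> Y \<Longrightarrow> \<epsilon> > 0 \<Longrightarrow> \<exists>n. mdist U x (y n) < \<epsilon>"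
      using polish_dense_sequence[OF U Ysub] by blast
    have yY: "y i \<in> Y" for i using y(1) by blast
    have "\<forall>i. \<exists>z\<in>D1. c1 z = y i" using D1(2) yY Ysub(1) by (metis image_iff subsetD)
    then obtain a where a: "\<And>i. a i \<in> D1" "\<And>i. c1 (a i) = y i" by metis
    have "\<forall>i. \<exists>z\<in>D2. c2 z = h (y i)" using D2(2) hX(1)[OF yY] unfolding Xm by (metis image_iff)
    then obtain b where b: "\<And>i. b i \<in> D2" "\<And>i. c2 (b i) = h (y i)" by metis
    \<comment> \<open>The codes of the dense sequence and of its image are interleaved so that
      \<open>s\<close> and \<open>t\<close> return them.\<close>
    define w where "w p = (case prod_decode p of (i, n) \<Rightarrow> prod_encode (a i n, b i n))" for p
    have sw: "s w i = a i" "t w i = b i" for i by (simp_all add: s_def t_def w_def)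
    have wS: "w \<in> S" unfolding S sw using a b hX(2)[OF yY yY] by simp
    have "F w = mclosure U (range y)" by (simp add: F_def sw a(2))
    moreover have "mclosure U (range y) = Y"
    proof
      show "mclosure U (range y) \<subseteq> Y" by (rule mclosure_minimal[OF y(1) Yc])
      show "Y \<subseteq> mclosure U (range y)" using y(2) Ysub(1) unfolding mclosure_def by auto
    qed
    ultimately show "Y \<in> F ` S" using wS by blast
  qed
  moreover have "S \<noteq> {}" using FS XV by blast
  ultimately show ?thesis using analytic_inI[OF Sm] by metis
qed

theorem theorem4p14:
  fixes U :: "'u metric" and A :: "real set"
  assumes "urysohn_space U"
    and "distance_set A"
  shows "(four_values A \<and> (closed A \<or> \<not> 0 islimpt A)
            \<longleftrightarrow> four_values A \<and> V U A \<in> sets (effros U))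
       \<and> (four_values A \<and> V U A \<in> sets (effros U)
            \<longleftrightarrow> four_values A \<and> analytic_in (effros U) (V U A))
       \<and> (four_values A \<and> analytic_in (effros U) (V U A)
            \<longleftrightarrow> (\<exists>X\<in>V U A. urysohn_for U A X))
       \<and> ((\<exists>X\<in>V U A. urysohn_for U A X)
            \<longleftrightarrow> four_values A \<and> (\<exists>X\<in>V U A. polish_universal U A X))"
proof -
  have polish: "polish_metric U" using assms(1) by (simp add: urysohn_space_def)
  obtain u where u: "u \<in> mspace U" using polish by (auto simp: polish_metric_def)
  have "mclosure U {u} = {u}"
    by (rule mclosure_discrete[of _ _ 1]) (use u in auto)
  then have "{u} \<in> V U A"
    using mclosure_closed[of "{u}" U] u distance_setD(1)[OF assms(2)] by (simp add: V_iff)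
  \<comment> \<open>Singletons belong to \<open>V U A\<close> because \<open>0 \<in> A\<close>; the
    analytic case parametrises the set by a nonempty Polish space.\<close>
  then have ne: "V U A \<noteq> {}" by blast
  \<comment> \<open>The implications run in the cycle (i), (iv), (v), (iii), (i), and (ii) is
    attached to (i).\<close>
  have i_ii: "closed A \<or> \<not> 0 islimpt A \<longleftrightarrow> V U A \<in> sets (effros U)"
    using V_in_sets_effros[OF polish assms(2)] V_borel_imp[OF assms] by blast
  have i_iv: "\<exists>X\<in>V U A. urysohn_for U A X" if "four_values A" "closed A \<or> \<not> 0 islimpt A"
    using urysohn_for_exists[OF assms that] .
  have iv_v: "four_values A \<and> (\<exists>X\<in>V U A. polish_universal U A X)"
    if "\<exists>X\<in>V U A. urysohn_for U A X"
    using that urysohn_for_imp_four_values[OF assms] by (auto simp: urysohn_for_def)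
  have v_iii: "analytic_in (effros U) (V U A)" if "\<exists>X\<in>V U A. polish_universal U A X"
    using that polish_universal_imp_analytic[OF polish] by blast
  have iii_i: "closed A \<or> \<not> 0 islimpt A" if "analytic_in (effros U) (V U A)"
    by (rule V_analytic_imp[OF assms that ne])
  show ?thesis using i_ii i_iv iv_v v_iii iii_i by blast
qed

end
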